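(* Let $\mathfrak M,\mathfrak N$ be separable Hilbert spaces and let $\{\Gamma_n\}_{n\ge 0}$ be a choice sequence, i.e. a sequence of contractions $\Gamma_0\in\mathbf L(\mathfrak M,\mathfrak N)$, $\Gamma_n\in\mathbf L(\mathfrak D_{\Gamma_{n-1}},\mathfrak D_{\Gamma_{n-1}^*})$, $n\ge 1$, such that no $\Gamma_n$ is isometric or co-isometric. Let $\mathcal U_0=\mathcal U_0(\{\Gamma_n\}_{n\ge0})$ and $\widetilde{\mathcal U}_0=\widetilde{\mathcal U}_0(\{\Gamma_n\}_{n\ge0})$ be the associated block operator CMV matrices, acting from $\mathfrak M\oplus\mathfrak H_0$ to $\mathfrak N\oplus\mathfrak H_0$ and from $\mathfrak M\oplus\widetilde{\mathfrak H}_0$ to $\mathfrak N\oplus\widetilde{\mathfrak H}_0$, respectively. Then the conservative systems $$\zeta_0=\{\mathcal U_0;\mathfrak M,\mathfrak N,\mathfrak H_0\},\qquad \widetilde\zeta_0=\{\widetilde{\mathcal U}_0;\mathfrak M,\mathfrak N,\widetilde{\mathfrak H}_0\}$$ are unitarily equivalent and simple, and the Schur parameters of the (common) transfer function of $\zeta_0$ and $\widetilde\zeta_0$ are $\{\Gamma_n\}_{n\ge 0}$.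
   Context: $\mathbf L(\mathfrak H_1,\mathfrak H_2)$ denotes the bounded linear operators from the complex Hilbert space $\mathfrak H_1$ to $\mathfrak H_2$. For a contraction $T\in\mathbf L(\mathfrak H_1,\mathfrak H_2)$: $D_T=(I-T^*T)^{1/2}$, $D_{T^*}=(I-TT^* )^{1/2}$, $\mathfrak D_T=\overline{\mathrm{ran}}\,D_T$, $\mathfrak D_{T^*}=\overline{\mathrm{ran}}\,D_{T^*}$. The elementary rotation of $T$ is the unitary operator $$\mathbf J_T=\begin{bmatrix}T&D_{T^*}\\ D_T&-T^*\end{bmatrix}:\mathfrak H_1\oplus\mathfrak D_{T^*}\to\mathfrak H_2\oplus\mathfrak D_T .$$ Schur class and Schur parameters. $\mathbf S(\mathfrak M,\mathfrak N)$ is the set of holomorphic functions on $\mathbb D=\{|\lambda|<1\}$ whose values are contractions in $\mathbf L(\mathfrak M,\mathfrak N)$. For $\Theta\in\mathbf S(\mathfrak M,\mathfrak N)$ put $\Theta_0=\Theta$, $\Gamma_0=\Theta(0)$; given $\Theta_n$ and $\Gamma_n=\Theta_n(0)$, let $\Theta_{n+1}\in\mathbf S(\mathfrak D_{\Gamma_n},\mathfrak D_{\Gamma_n^*})$ be the unique function with $$\Theta_n(\lambda)=\Gamma_n+\lambda D_{\Gamma_n^*}\Theta_{n+1}(\lambda)\bigl(I+\lambda\Gamma_n^*\Theta_{n+1}(\lambda)\bigr)^{-1}D_{\Gamma_n},\quad\lambda\in\mathbb D,$$ and $\Gamma_{n+1}=\Theta_{n+1}(0)$. $\Theta_n$ is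 the $n$-th Schur iterate and the $\Gamma_n$ are the Schur parameters of $\Theta$. Block operator CMV matrices. For a choice sequence $\{\Gamma_n\}_{n\ge0}$ let $$\mathfrak H_0=\bigoplus_{n\ge0}(\mathfrak D_{\Gamma_{2n}}\oplus\mathfrak D_{\Gamma^*_{2n+1}}),\qquad \widetilde{\mathfrak H}_0=\bigoplus_{n\ge0}(\mathfrak D_{\Gamma^*_{2n}}\oplus\mathfrak D_{\Gamma_{2n+1}})$$ (Hilbert space orthogonal sums). Here $\mathbf J_{\Gamma_0}:\mathfrak M\oplus\mathfrak D_{\Gamma_0^*}\to\mathfrak N\oplus\mathfrak D_{\Gamma_0}$ and $\mathbf J_{\Gamma_k}:\mathfrak D_{\Gamma_{k-1}}\oplus\mathfrak D_{\Gamma_k^*}\to\mathfrak D_{\Gamma_{k-1}^*}\oplus\mathfrak D_{\Gamma_k}$, $k\ge1$. Writing $\mathfrak M\oplus\widetilde{\mathfrak H}_0=(\mathfrak M\oplus\mathfrak D_{\Gamma_0^*})\oplus\bigoplus_{n\ge1}(\mathfrak D_{\Gamma_{2n-1}}\oplus\mathfrak D_{\Gamma_{2n}^*})$ and $\mathfrak N\oplus\mathfrak H_0=(\mathfrak N\oplus\mathfrak D_{\Gamma_0})\oplus\bigoplus_{n\ge1}(\mathfrak D_{\Gamma_{2n-1}^*}\oplus\mathfrak D_{\Gamma_{2n}})$, define the unitary operators $$\mathcal L_0=\mathbf J_{\Gamma_0}\oplus\bigoplus_{n\ge1}\mathbf J_{\Gamma_{2n}}:\mathfrak M\oplus\widetilde{\mathfrak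 H}_0\to\mathfrak N\oplus\mathfrak H_0,\qquad \mathcal V_0=\bigoplus_{n\ge1}\mathbf J_{\Gamma_{2n-1}}:\mathfrak H_0\to\widetilde{\mathfrak H}_0,$$ $$\mathcal M_0=I_{\mathfrak M}\oplus\mathcal V_0,\quad \widetilde{\mathcal M}_0=I_{\mathfrak N}\oplus\mathcal V_0,\quad \mathcal U_0=\mathcal L_0\mathcal M_0,\quad \widetilde{\mathcal U}_0=\widetilde{\mathcal M}_0\mathcal L_0 .$$ Systems. A system $\tau=\{U_\tau;\mathfrak M,\mathfrak N,\mathfrak H\}$ is given by $U_\tau=\begin{bmatrix}D&C\\ B&A\end{bmatrix}:\mathfrak M\oplus\mathfrak H\to\mathfrak N\oplus\mathfrak H$. It is conservative if $U_\tau$ is unitary, and simple if $\mathfrak H=\overline{\mathrm{span}}\{A^kB\mathfrak M,\ A^{*l}C^*\mathfrak N:\ k,l\ge0\}$. Its transfer function is $\Theta_\tau(\lambda)=D+\lambda C(I-\lambda A)^{-1}B$, $\lambda\in\mathbb D$ (it lies in $\mathbf S(\mathfrak M,\mathfrak N)$ when $\tau$ is conservative). Two systems $\begin{bmatrix}D&C_j\\ B_j&A_j\end{bmatrix}$ with state spaces $\mathfrak H_j$, $j=1,2$, and the same $\mathfrak M,\mathfrak N,D$ are unitarily equivalent if there is a unitary $V:\mathfrak H_1\to\mathfrak H_2$ with $A_1=V^{-1}A_2V$, $B_1=V^{-1}B_2$, $C_1=C_2V$. *)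

theory Defs
  imports "HOL-Analysis.Analysis"
begin

section \<open>Complex Hilbert spaces\<close>

text \<open>The inner product is linear in its first argument.\<close>

class complex_inner = real_normed_vector +
  fixes scaleC :: "complex \<Rightarrow> 'a \<Rightarrow> 'a" (infixr "*\<^sub>C" 75)
    and cinner :: "'a \<Rightarrow> 'a \<Rightarrow> complex"
  assumes scaleC_add_right: "c *\<^sub>C (x + y) = c *\<^sub>C x + c *\<^sub>C y"
    and scaleC_add_left: "(c + d) *\<^sub>C x = c *\<^sub>C x + d *\<^sub>C x"
    and scaleC_scaleC: "c *\<^sub>C (d *\<^sub>C x) = (c * d) *\<^sub>C x"
    and scaleC_of_real: "complex_of_real r *\<^sub>C x = r *\<^sub>R x"
    and cinner_commute: "cinner x y = cnj (cinner y x)"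
    and cinner_add_left: "cinner (x + y) z = cinner x z + cinner y z"
    and cinner_scaleC_left: "cinner (c *\<^sub>C x) y = c * cinner x y"
    and cinner_self: "cinner x x = complex_of_real ((norm x)\<^sup>2)"

class chilbert_space = complex_inner + complete_space

global_interpretation complex_vector: vector_space "scaleC :: complex \<Rightarrow> 'a \<Rightarrow> 'a::complex_inner"
  defines cspan = complex_vector.span
    and csubspace = complex_vector.subspace
proof
  show "c *\<^sub>C (x + y) = c *\<^sub>C x + c *\<^sub>C y" for c and x y :: 'a
    by (rule scaleC_add_right)
  show "(c + d) *\<^sub>C x = c *\<^sub>C x + d *\<^sub>C x" for c d and x :: 'a
    by (rule scaleC_add_left)
  show "c *\<^sub>C d *\<^sub>C x = (c * d) *\<^sub>C x" for c d and x :: 'a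
    by (rule scaleC_scaleC)
  show "1 *\<^sub>C x = x" for x :: 'a
    using scaleC_of_real[of 1 x] by simp
qed

lemma cinner_add_right: "cinner x (y + z) = cinner x y + cinner x (z::'a::complex_inner)"
  by (metis cinner_add_left cinner_commute complex_cnj_add)

lemma cinner_scaleC_right: "cinner x (c *\<^sub>C y) = cnj c * cinner x (y::'a::complex_inner)"
  by (metis cinner_commute cinner_scaleC_left complex_cnj_mult)

lemma norm_scaleC: "norm (c *\<^sub>C x) = cmod c * norm (x::'a::complex_inner)"
proof -
  have "complex_of_real ((norm (c *\<^sub>C x))\<^sup>2) = c * cnj c * complex_of_real ((norm x)\<^sup>2)"
    by (metis cinner_self cinner_scaleC_left cinner_scaleC_right mult.assoc)
  also have "\<dots> = complex_of_real ((cmod c * norm x)\<^sup>2)"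
    by (simp add: complex_norm_square[symmetric] power_mult_distrib)
  finally have "(norm (c *\<^sub>C x))\<^sup>2 = (cmod c * norm x)\<^sup>2"
    using of_real_eq_iff by blast
  thus ?thesis by simp
qed

lemma norm_cinner_le_squares:
  "cmod (cinner x y) \<le> ((norm x)\<^sup>2 + (norm (y::'a::complex_inner))\<^sup>2) / 2"
proof -
  obtain c where c: "cmod c = 1" "c * cinner x y = complex_of_real (cmod (cinner x y))"
  proof (cases "cinner x y = 0")
    case True
    thus ?thesis using that[of 1] by simp
  next
    case False
    let ?u = "cinner x y"
    let ?r = "complex_of_real (cmod ?u)"
    have r: "?r \<noteq> 0" using False by simp
    have "cnj ?u / ?r * ?u = (?u * cnj ?u) / ?r" by (simp only: times_divide_eq_left mult.commute[of "cnj ?u"])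
    also have "\<dots> = (?r * ?r) / ?r" by (simp only: complex_norm_square[symmetric] power2_eq_square of_real_mult)
    also have "\<dots> = ?r" using r by (rule nonzero_mult_div_cancel_right)
    finally have "cnj ?u / ?r * ?u = ?r" .
    moreover have "cmod (cnj ?u / ?r) = 1"
      using False by (simp add: norm_divide)
    ultimately show ?thesis by (rule that[rotated])
  qed
  let ?x = "c *\<^sub>C x" and ?r = "complex_of_real (cmod (cinner x y))"
  let ?z = "?x + (- 1) *\<^sub>C y"
  have xy: "cinner ?x y = ?r" using c(2) by (simp only: cinner_scaleC_left)
  have yx: "cinner y ?x = ?r"
    using cinner_commute[of y ?x] by (simp only: xy complex_cnj_complex_of_real)
  have "complex_of_real ((norm ?z)\<^sup>2) = cinner ?z ?z" by (rule cinner_self[symmetric])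
  also have "\<dots> = cinner ?x ?x + cinner ?x ((- 1) *\<^sub>C y)
      + (cinner ((- 1) *\<^sub>C y) ?x + cinner ((- 1) *\<^sub>C y) ((- 1) *\<^sub>C y))"
    by (simp only: cinner_add_left cinner_add_right ac_simps)
  also have "cinner ?x ((- 1) *\<^sub>C y) = - ?r"
    unfolding cinner_scaleC_right xy by simp
  also have "cinner ((- 1) *\<^sub>C y) ?x = - ?r"
    unfolding cinner_scaleC_left yx by simp
  also have "cinner ((- 1) *\<^sub>C y) ((- 1) *\<^sub>C y) = cinner y y"
    unfolding cinner_scaleC_right cinner_scaleC_left by simp
  also have "cinner ?x ?x + - ?r + (- ?r + cinner y y)
      = complex_of_real ((norm ?x)\<^sup>2 + (norm y)\<^sup>2 - 2 * cmod (cinner x y))"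
    unfolding cinner_self by simp
  finally have "(norm ?z)\<^sup>2 = (norm ?x)\<^sup>2 + (norm y)\<^sup>2 - 2 * cmod (cinner x y)"
    by (simp only: of_real_eq_iff)
  moreover have "0 \<le> (norm ?z)\<^sup>2" by simp
  moreover have "norm ?x = norm x" using c(1) by (simp add: norm_scaleC)
  ultimately show ?thesis by simp
qed

instantiation prod :: (complex_inner, complex_inner) complex_inner
begin

definition scaleC_prod_def: "c *\<^sub>C p = (c *\<^sub>C fst p, c *\<^sub>C snd p)"

definition cinner_prod_def: "cinner p q = cinner (fst p) (fst q) + cinner (snd p) (snd q)"

instance
proof
  fix c d :: complex and r :: real and x y z :: "'a \<times> 'b"
  show "c *\<^sub>C (x + y) = c *\<^sub>C x + c *\<^sub>C y"
    by (simp add: scaleC_prod_def scaleC_add_right)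
  show "(c + d) *\<^sub>C x = c *\<^sub>C x + d *\<^sub>C x"
    by (simp add: scaleC_prod_def scaleC_add_left)
  show "c *\<^sub>C d *\<^sub>C x = (c * d) *\<^sub>C x"
    by (simp add: scaleC_prod_def scaleC_scaleC)
  show "complex_of_real r *\<^sub>C x = r *\<^sub>R x"
    by (simp add: scaleC_prod_def scaleR_prod_def scaleC_of_real)
  show "cinner x y = cnj (cinner y x)"
    unfolding cinner_prod_def by (metis cinner_commute complex_cnj_add)
  show "cinner (x + y) z = cinner x z + cinner y z"
    by (simp add: cinner_prod_def cinner_add_left)
  show "cinner (c *\<^sub>C x) y = c * cinner x y"
    by (simp add: cinner_prod_def scaleC_prod_def cinner_scaleC_left distrib_left)
  show "cinner x x = complex_of_real ((norm x)\<^sup>2)"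
    by (simp add: cinner_prod_def cinner_self norm_prod_def)
qed

end

instance prod :: (chilbert_space, chilbert_space) chilbert_space ..


section \<open>Square-summable sequences\<close>

typedef (overloaded) 'a ell2 = "{f :: nat \<Rightarrow> 'a::complex_inner. summable (\<lambda>n. (norm (f n))\<^sup>2)}"
  morphisms ell2_nth Abs_ell2
  by (rule exI[of _ "\<lambda>_. 0"]) simp

setup_lifting type_definition_ell2

lemma summable_ell2: "summable (\<lambda>n. (norm (ell2_nth f n))\<^sup>2)"
  using ell2_nth[of f] by simp

lemma ell2_eqI: "(\<And>n. ell2_nth f n = ell2_nth g n) \<Longrightarrow> f = g"
  by (simp add: ell2_nth_inject[symmetric] fun_eq_iff)

lemma summable_norm_add_sq:
  fixes f g :: "nat \<Rightarrow> 'a::complex_inner"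
  assumes "summable (\<lambda>n. (norm (f n))\<^sup>2)" "summable (\<lambda>n. (norm (g n))\<^sup>2)"
  shows "summable (\<lambda>n. (norm (f n + g n))\<^sup>2)"
proof (rule summable_comparison_test')
  show "summable (\<lambda>n. 2 * (norm (f n))\<^sup>2 + 2 * (norm (g n))\<^sup>2)"
    using assms by (intro summable_add summable_mult)
  fix n
  have "(norm (f n + g n))\<^sup>2 \<le> (norm (f n) + norm (g n))\<^sup>2"
    by (simp add: norm_triangle_ineq power_mono)
  also have "\<dots> \<le> 2 * (norm (f n))\<^sup>2 + 2 * (norm (g n))\<^sup>2"
    using sum_squares_bound[of "norm (f n)" "norm (g n)"] by (simp add: power2_sum)
  finally show "norm ((norm (f n + g n))\<^sup>2) \<le> 2 * (norm (f n))\<^sup>2 + 2 * (norm (g n))\<^sup>2"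
    by simp
qed

lemma summable_norm_scaleC_sq:
  fixes f :: "nat \<Rightarrow> 'a::complex_inner"
  assumes "summable (\<lambda>n. (norm (f n))\<^sup>2)"
  shows "summable (\<lambda>n. (norm (c *\<^sub>C f n))\<^sup>2)"
  using summable_mult[OF assms, of "(cmod c)\<^sup>2"] by (simp add: norm_scaleC power_mult_distrib)

lemma summable_norm_scaleR_sq:
  fixes f :: "nat \<Rightarrow> 'a::complex_inner"
  assumes "summable (\<lambda>n. (norm (f n))\<^sup>2)"
  shows "summable (\<lambda>n. (norm (r *\<^sub>R f n))\<^sup>2)"
  using summable_mult[OF assms, of "r\<^sup>2"] by (simp add: power_mult_distrib)

instantiation ell2 :: (complex_inner) complex_inner
begin

lift_definition zero_ell2 :: "'a ell2" is "\<lambda>_. 0" by simp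

lift_definition plus_ell2 :: "'a ell2 \<Rightarrow> 'a ell2 \<Rightarrow> 'a ell2" is "\<lambda>f g n. f n + g n"
  by (rule summable_norm_add_sq)

lift_definition uminus_ell2 :: "'a ell2 \<Rightarrow> 'a ell2" is "\<lambda>f n. - f n" by simp

lift_definition minus_ell2 :: "'a ell2 \<Rightarrow> 'a ell2 \<Rightarrow> 'a ell2" is "\<lambda>f g n. f n - g n"
  using summable_norm_add_sq[of _ "\<lambda>n. - _ n"] by simp

lift_definition scaleR_ell2 :: "real \<Rightarrow> 'a ell2 \<Rightarrow> 'a ell2" is "\<lambda>r f n. r *\<^sub>R f n"
  by (rule summable_norm_scaleR_sq)

lift_definition scaleC_ell2 :: "complex \<Rightarrow> 'a ell2 \<Rightarrow> 'a ell2" is "\<lambda>c f n. c *\<^sub>C f n"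
  by (rule summable_norm_scaleC_sq)

definition cinner_ell2_def: "cinner f g = (\<Sum>n. cinner (ell2_nth f n) (ell2_nth g n))"

definition norm_ell2_def: "norm f = sqrt (\<Sum>n. (norm (ell2_nth f n))\<^sup>2)"

definition sgn_ell2_def: "sgn f = inverse (norm f) *\<^sub>R (f :: 'a ell2)"

definition dist_ell2_def: "dist f g = norm (f - g :: 'a ell2)"

definition uniformity_ell2_def:
  "(uniformity :: ('a ell2 \<times> 'a ell2) filter) = (INF e\<in>{0<..}. principal {(x, y). dist x y < e})"

definition open_ell2_def:
  "open (U :: 'a ell2 set) \<longleftrightarrow> (\<forall>x\<in>U. eventually (\<lambda>(x', y). x' = x \<longrightarrow> y \<in> U) uniformity)"

lemma norm_ell2_sq: "(norm (f :: 'a ell2))\<^sup>2 = (\<Sum>n. (norm (ell2_nth f n))\<^sup>2)"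
  unfolding norm_ell2_def by (rule real_sqrt_pow2, rule suminf_nonneg[OF summable_ell2]) simp

lemma summable_cinner_ell2: "summable (\<lambda>n. cinner (ell2_nth f n) (ell2_nth (g :: 'a ell2) n))"
proof (rule summable_comparison_test')
  show "summable (\<lambda>n. ((norm (ell2_nth f n))\<^sup>2 + (norm (ell2_nth g n))\<^sup>2) / 2)"
    by (rule summable_divide[OF summable_add[OF summable_ell2 summable_ell2]])
qed (rule norm_cinner_le_squares)

lemma L2_set_le_norm_ell2: "L2_set (\<lambda>n. norm (ell2_nth f n)) {..<k} \<le> norm (f :: 'a ell2)"
  unfolding L2_set_def norm_ell2_def
  by (rule real_sqrt_le_mono, rule sum_le_suminf[OF summable_ell2]) simp_all

lemma norm_ell2_leI:
  assumes "\<And>k. L2_set (\<lambda>n. norm (ell2_nth f n)) {..<k} \<le> b"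
  shows "norm (f :: 'a ell2) \<le> b"
proof -
  have b: "0 \<le> b" using assms[of 0] by (simp only: lessThan_0 L2_set_empty)
  have "(\<Sum>n. (norm (ell2_nth f n))\<^sup>2) \<le> b\<^sup>2"
  proof (rule suminf_le_const[OF summable_ell2])
    fix k
    show "(\<Sum>n<k. (norm (ell2_nth f n))\<^sup>2) \<le> b\<^sup>2"
      using assms[of k] unfolding L2_set_def by (rule sqrt_le_D)
  qed
  hence "(norm f)\<^sup>2 \<le> b\<^sup>2" by (simp only: norm_ell2_sq)
  thus ?thesis using b by (rule power2_le_imp_le)
qed

instance
proof
  fix a b c :: "'a ell2" and r s :: real
  show "a + b + c = a + (b + c)" by transfer (simp add: add.assoc)
  show "a + b = b + a" by transfer (simp add: add.commute)
  show "0 + a = a" by transfer simp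
  show "- a + a = 0" by transfer simp
  show "a - b = a + - b" by transfer simp
  show "r *\<^sub>R (a + b) = r *\<^sub>R a + r *\<^sub>R b" by transfer (simp add: scaleR_add_right)
  show "(r + s) *\<^sub>R a = r *\<^sub>R a + s *\<^sub>R a" by transfer (simp add: scaleR_add_left)
  show "r *\<^sub>R s *\<^sub>R a = (r * s) *\<^sub>R a" by transfer simp
  show "1 *\<^sub>R a = a" by transfer simp
  show "sgn a = inverse (norm a) *\<^sub>R a" by (rule sgn_ell2_def)
  show "dist a b = norm (a - b)" by (rule dist_ell2_def)
  show "(uniformity :: ('a ell2 \<times> 'a ell2) filter) = (INF e\<in>{0<..}. principal {(x, y). dist x y < e})"
    by (rule uniformity_ell2_def)
  show "open U \<longleftrightarrow> (\<forall>x\<in>U. eventually (\<lambda>(x', y). x' = x \<longrightarrow> y \<in> U) uniformity)" for U :: "'a ell2 set"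
    by (rule open_ell2_def)
  show "norm a = 0 \<longleftrightarrow> a = 0"
  proof
    assume "norm a = 0"
    hence "(\<Sum>n. (norm (ell2_nth a n))\<^sup>2) = 0" using norm_ell2_sq[of a] by simp
    hence "\<forall>n. (norm (ell2_nth a n))\<^sup>2 = 0"
      using suminf_eq_zero_iff[OF summable_ell2[of a]] by simp
    thus "a = 0" by (intro ell2_eqI) (simp add: zero_ell2.rep_eq)
  qed (simp add: norm_ell2_def zero_ell2.rep_eq)
  show "norm (a + b) \<le> norm a + norm b"
  proof (rule norm_ell2_leI)
    fix k
    have "L2_set (\<lambda>n. norm (ell2_nth (a + b) n)) {..<k}
        \<le> L2_set (\<lambda>n. norm (ell2_nth a n) + norm (ell2_nth b n)) {..<k}"
      by (intro L2_set_mono) (auto simp: plus_ell2.rep_eq norm_triangle_ineq)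
    also have "\<dots> \<le> L2_set (\<lambda>n. norm (ell2_nth a n)) {..<k} + L2_set (\<lambda>n. norm (ell2_nth b n)) {..<k}"
      by (rule L2_set_triangle_ineq)
    also have "\<dots> \<le> norm a + norm b"
      by (intro add_mono L2_set_le_norm_ell2)
    finally show "L2_set (\<lambda>n. norm (ell2_nth (a + b) n)) {..<k} \<le> norm a + norm b" .
  qed
  show "norm (r *\<^sub>R a) = \<bar>r\<bar> * norm a"
    using suminf_mult[OF summable_ell2[of a], of "r\<^sup>2"]
    by (simp add: norm_ell2_def scaleR_ell2.rep_eq power_mult_distrib real_sqrt_mult)
next
  fix a b d :: "'a ell2" and z w :: complex and r :: real
  show "z *\<^sub>C (a + b) = z *\<^sub>C a + z *\<^sub>C b" by transfer (simp add: scaleC_add_right)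
  show "(z + w) *\<^sub>C a = z *\<^sub>C a + w *\<^sub>C a" by transfer (simp add: scaleC_add_left)
  show "z *\<^sub>C w *\<^sub>C a = (z * w) *\<^sub>C a" by transfer (simp add: scaleC_scaleC)
  show "complex_of_real r *\<^sub>C a = r *\<^sub>R a" by transfer (simp add: scaleC_of_real)
  show "cinner a b = cnj (cinner b a)"
  proof -
    have "cinner (ell2_nth a n) (ell2_nth b n) = cnj (cinner (ell2_nth b n) (ell2_nth a n))" for n
      by (rule cinner_commute)
    hence "(\<lambda>n. cinner (ell2_nth a n) (ell2_nth b n)) sums cnj (cinner b a)"
      using sums_cnj[THEN iffD2, OF summable_sums[OF summable_cinner_ell2[of b a]]]
      by (simp add: cinner_ell2_def)
    thus ?thesis by (simp add: cinner_ell2_def sums_iff)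
  qed
  show "cinner (a + b) d = cinner a d + cinner b d"
    unfolding cinner_ell2_def
    by (simp add: plus_ell2.rep_eq cinner_add_left suminf_add[OF summable_cinner_ell2 summable_cinner_ell2])
  show "cinner (z *\<^sub>C a) b = z * cinner a b"
    unfolding cinner_ell2_def
    by (simp add: scaleC_ell2.rep_eq cinner_scaleC_left suminf_mult[OF summable_cinner_ell2])
  show "cinner a a = complex_of_real ((norm a)\<^sup>2)"
    unfolding norm_ell2_sq cinner_ell2_def
    by (simp add: cinner_self suminf_of_real[OF summable_ell2])
qed

end

lemma norm_ell2_nth_le: "norm (ell2_nth f n) \<le> norm (f :: 'a::complex_inner ell2)"
proof -
  have "norm (ell2_nth f n) \<le> L2_set (\<lambda>n. norm (ell2_nth f n)) {..<Suc n}"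
    by (rule member_le_L2_set) auto
  also have "\<dots> \<le> norm f" by (rule L2_set_le_norm_ell2)
  finally show ?thesis .
qed

lemma L2_set_lessThan_leD:
  assumes "L2_set (\<lambda>n. norm (h n)) {..<k} \<le> b"
  shows "(\<Sum>n<k. (norm (h n))\<^sup>2) \<le> b\<^sup>2"
  using assms unfolding L2_set_def by (rule sqrt_le_D)

instance ell2 :: (chilbert_space) chilbert_space
proof
  fix X :: "nat \<Rightarrow> 'a ell2"
  assume X: "Cauchy X"
  have "Cauchy (\<lambda>i. ell2_nth (X i) n)" for n
  proof (rule CauchyI)
    fix e :: real assume "0 < e"
    then obtain M where M: "\<forall>i\<ge>M. \<forall>j\<ge>M. norm (X i - X j) < e"
      using CauchyD[OF X, of e] by fast
    have le: "norm (ell2_nth (X i) n - ell2_nth (X j) n) \<le> norm (X i - X j)" for i j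
      using norm_ell2_nth_le[of "X i - X j" n] by (simp add: minus_ell2.rep_eq)
    have "\<forall>i\<ge>M. \<forall>j\<ge>M. norm (ell2_nth (X i) n - ell2_nth (X j) n) < e"
      by (intro allI impI) (rule le_less_trans[OF le], simp add: M)
    thus "\<exists>M. \<forall>i\<ge>M. \<forall>j\<ge>M. norm (ell2_nth (X i) n - ell2_nth (X j) n) < e" ..
  qed
  hence conv: "convergent (\<lambda>i. ell2_nth (X i) n)" for n
    by (rule Cauchy_convergent)
  define L where "L n = lim (\<lambda>i. ell2_nth (X i) n)" for n
  have L: "(\<lambda>i. ell2_nth (X i) n) \<longlonglongrightarrow> L n" for n
    unfolding L_def using conv[of n] by (simp only: convergent_LIMSEQ_iff)
  have fin: "L2_set (\<lambda>n. norm (ell2_nth (X i) n - L n)) {..<k} \<le> e"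
    if M: "\<And>i j. i \<ge> M \<Longrightarrow> j \<ge> M \<Longrightarrow> norm (X i - X j) < e" and i: "i \<ge> M" for e M i k
  proof (rule tendsto_upperbound)
    show "(\<lambda>j. L2_set (\<lambda>n. norm (ell2_nth (X i) n - ell2_nth (X j) n)) {..<k})
        \<longlonglongrightarrow> L2_set (\<lambda>n. norm (ell2_nth (X i) n - L n)) {..<k}"
      unfolding L2_set_def by (intro tendsto_intros L)
    have "L2_set (\<lambda>n. norm (ell2_nth (X i) n - ell2_nth (X j) n)) {..<k} \<le> e" if "j \<ge> M" for j
      using L2_set_le_norm_ell2[of "X i - X j" k] M[OF i that] by (simp add: minus_ell2.rep_eq)
    thus "\<forall>\<^sub>F j in sequentially. L2_set (\<lambda>n. norm (ell2_nth (X i) n - ell2_nth (X j) n)) {..<k} \<le> e"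
      unfolding eventually_sequentially by blast
  qed simp
  obtain M1 where M1: "\<And>i j. i \<ge> M1 \<Longrightarrow> j \<ge> M1 \<Longrightarrow> norm (X i - X j) < 1"
    using CauchyD[OF X, of 1] zero_less_one by fast
  have "summable (\<lambda>n. (norm (ell2_nth (X M1) n - L n))\<^sup>2)"
  proof (rule bounded_imp_summable)
    show "(\<Sum>n\<le>k. (norm (ell2_nth (X M1) n - L n))\<^sup>2) \<le> 1\<^sup>2" for k
      using L2_set_lessThan_leD[OF fin[where e = 1 and M = M1 and i = M1 and k = "Suc k", OF M1]]
      by (simp add: lessThan_Suc_atMost)
  qed simp
  hence "summable (\<lambda>n. (norm (- (ell2_nth (X M1) n - L n) + ell2_nth (X M1) n))\<^sup>2)"
    by (intro summable_norm_add_sq summable_ell2) (simp only: norm_minus_cancel)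
  hence sL: "summable (\<lambda>n. (norm (L n))\<^sup>2)" by simp
  hence nL: "ell2_nth (Abs_ell2 L) = L" by (simp add: Abs_ell2_inverse)
  have "X \<longlonglongrightarrow> Abs_ell2 L"
  proof (rule LIMSEQ_I)
    fix e :: real assume e: "0 < e"
    then obtain M where M: "\<And>i j. i \<ge> M \<Longrightarrow> j \<ge> M \<Longrightarrow> norm (X i - X j) < e / 2"
      using CauchyD[OF X, of "e / 2"] half_gt_zero[OF e] by fast
    have le: "norm (X i - Abs_ell2 L) \<le> e / 2" if "i \<ge> M" for i
    proof (rule norm_ell2_leI)
      show "L2_set (\<lambda>n. norm (ell2_nth (X i - Abs_ell2 L) n)) {..<k} \<le> e / 2" for k
        using fin[where e = "e / 2" and M = M and i = i and k = k, OF M that]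
        by (simp add: minus_ell2.rep_eq nL)
    qed
    have half: "e / 2 < e" using e by simp
    have "\<forall>i\<ge>M. norm (X i - Abs_ell2 L) < e"
      by (intro allI impI) (rule le_less_trans[OF le half])
    thus "\<exists>M. \<forall>i\<ge>M. norm (X i - Abs_ell2 L) < e" ..
  qed
  thus "convergent X" by (auto simp: convergent_def)
qed


section \<open>Operators between closed subspaces\<close>

text \<open>
  All operators below act between closed subspaces of ambient Hilbert spaces (the defect spaces of
  a choice sequence form decreasing sequences of such subspaces). An operator from K to L is a
  function on the ambient types of which only the values on K matter; hence the
  subspaces are explicit arguments. Functions obtained by definite description are undefined off K.
\<close>

definition closed_csubspace :: "'a::chilbert_space set \<Rightarrow> bool" where
  "closed_csubspace K \<longleftrightarrow> csubspace K \<and> closed K"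

definition bounded_op :: "'a::chilbert_space set \<Rightarrow> 'b::chilbert_space set \<Rightarrow> ('a \<Rightarrow> 'b) set" where
  "bounded_op K L = {T. T \<in> K \<rightarrow> L \<and>
     (\<forall>x\<in>K. \<forall>y\<in>K. T (x + y) = T x + T y) \<and>
     (\<forall>c. \<forall>x\<in>K. T (c *\<^sub>C x) = c *\<^sub>C T x) \<and>
     (\<exists>B. \<forall>x\<in>K. norm (T x) \<le> B * norm x)}"

definition contraction :: "'a::chilbert_space set \<Rightarrow> 'b::chilbert_space set \<Rightarrow> ('a \<Rightarrow> 'b) \<Rightarrow> bool" where
  "contraction K L T \<longleftrightarrow> T \<in> bounded_op K L \<and> (\<forall>x\<in>K. norm (T x) \<le> norm x)"

definition adjoint_op ::
    "'a::chilbert_space set \<Rightarrow> 'b::chilbert_space set \<Rightarrow> ('a \<Rightarrow> 'b) \<Rightarrow> 'b \<Rightarrow> 'a" where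
  "adjoint_op K L T = (THE S. S \<in> bounded_op L K \<inter> extensional L \<and>
     (\<forall>x\<in>K. \<forall>y\<in>L. cinner (T x) y = cinner x (S y)))"

definition isometric :: "'a::chilbert_space set \<Rightarrow> ('a \<Rightarrow> 'b::chilbert_space) \<Rightarrow> bool" where
  "isometric K T \<longleftrightarrow> (\<forall>x\<in>K. norm (T x) = norm x)"

definition coisometric ::
    "'a::chilbert_space set \<Rightarrow> 'b::chilbert_space set \<Rightarrow> ('a \<Rightarrow> 'b) \<Rightarrow> bool" where
  "coisometric K L T \<longleftrightarrow> isometric L (adjoint_op K L T)"

definition unitary_op ::
    "'a::chilbert_space set \<Rightarrow> 'b::chilbert_space set \<Rightarrow> ('a \<Rightarrow> 'b) \<Rightarrow> bool" where
  "unitary_op K L U \<longleftrightarrow> U \<in> bounded_op K L \<and>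
     (\<forall>x\<in>K. \<forall>y\<in>K. cinner (U x) (U y) = cinner x y) \<and> U ` K = L"

definition positive_op :: "'a::chilbert_space set \<Rightarrow> ('a \<Rightarrow> 'a) \<Rightarrow> bool" where
  "positive_op K P \<longleftrightarrow> P \<in> bounded_op K K \<and> (\<forall>x\<in>K. cinner (P x) x \<in> \<real>\<^sub>\<ge>\<^sub>0)"

definition sqrt_op :: "'a::chilbert_space set \<Rightarrow> ('a \<Rightarrow> 'a) \<Rightarrow> 'a \<Rightarrow> 'a" where
  "sqrt_op K P = (THE R. R \<in> extensional K \<and> positive_op K R \<and> (\<forall>x\<in>K. R (R x) = P x))"

text \<open>In the next four definitions, T is a contraction from K to L; defect is \<open>D\<^sub>T\<close> and
  codefect is the defect operator of the adjoint of T.\<close>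

definition defect ::
    "'a::chilbert_space set \<Rightarrow> 'b::chilbert_space set \<Rightarrow> ('a \<Rightarrow> 'b) \<Rightarrow> 'a \<Rightarrow> 'a" where
  "defect K L T = sqrt_op K (\<lambda>x. x - adjoint_op K L T (T x))"

definition codefect ::
    "'a::chilbert_space set \<Rightarrow> 'b::chilbert_space set \<Rightarrow> ('a \<Rightarrow> 'b) \<Rightarrow> 'b \<Rightarrow> 'b" where
  "codefect K L T = sqrt_op L (\<lambda>y. y - T (adjoint_op K L T y))"

definition defect_space ::
    "'a::chilbert_space set \<Rightarrow> 'b::chilbert_space set \<Rightarrow> ('a \<Rightarrow> 'b) \<Rightarrow> 'a set" where
  "defect_space K L T = closure (defect K L T ` K)"

definition codefect_space ::
    "'a::chilbert_space set \<Rightarrow> 'b::chilbert_space set \<Rightarrow> ('a \<Rightarrow> 'b) \<Rightarrow> 'b set" where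
  "codefect_space K L T = closure (codefect K L T ` L)"

definition elementary_rotation ::
    "'a::chilbert_space set \<Rightarrow> 'b::chilbert_space set \<Rightarrow> ('a \<Rightarrow> 'b) \<Rightarrow> 'a \<times> 'b \<Rightarrow> 'b \<times> 'a" where
  "elementary_rotation K L T =
     (\<lambda>(x, y). (T x + codefect K L T y, defect K L T x - adjoint_op K L T y))"


section \<open>Schur class and Schur parameters\<close>

definition op_holomorphic_disc ::
    "'a::chilbert_space set \<Rightarrow> 'b::chilbert_space set \<Rightarrow> (complex \<Rightarrow> 'a \<Rightarrow> 'b) \<Rightarrow> bool" where
  \<comment> \<open>complex differentiability in the operator norm at every point of the disc\<close>
  "op_holomorphic_disc K L \<Theta> \<longleftrightarrow>
     (\<forall>z\<in>ball 0 1. \<exists>A\<in>bounded_op K L. \<forall>e>0. \<exists>d>0. \<forall>w\<in>ball 0 1. cmod (w - z) < d \<longrightarrow>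
       (\<forall>x\<in>K. norm (\<Theta> w x - \<Theta> z x - (w - z) *\<^sub>C A x) \<le> e * cmod (w - z) * norm x))"

definition schur_class ::
    "'a::chilbert_space set \<Rightarrow> 'b::chilbert_space set \<Rightarrow> (complex \<Rightarrow> 'a \<Rightarrow> 'b) set" where
  "schur_class K L = {\<Theta>. op_holomorphic_disc K L \<Theta> \<and> (\<forall>z\<in>ball 0 1. contraction K L (\<Theta> z))}"

definition schur_step ::
    "'a::chilbert_space set \<Rightarrow> 'b::chilbert_space set \<Rightarrow> ('a \<Rightarrow> 'b) \<Rightarrow>
     (complex \<Rightarrow> 'a \<Rightarrow> 'b) \<Rightarrow> (complex \<Rightarrow> 'a \<Rightarrow> 'b) \<Rightarrow> bool" where
  "schur_step K L G \<Theta> \<Psi> \<longleftrightarrow>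
     \<Psi> \<in> schur_class (defect_space K L G) (codefect_space K L G) \<and>
     (\<forall>z\<in>ball 0 1. \<forall>x\<in>K. \<Theta> z x = G x + z *\<^sub>C codefect K L G (\<Psi> z
        (the_inv_into (defect_space K L G) (\<lambda>u. u + z *\<^sub>C adjoint_op K L G (\<Psi> z u))
          (defect K L G x))))"

text \<open>
  For a sequence \<open>\<Gamma>\<close>, the operator \<open>\<Gamma> n\<close> acts from \<open>par_dom \<Gamma> n\<close> to \<open>par_cod \<Gamma> n\<close>:
  these are the whole spaces for n = 0, and the two defect spaces of the preceding operator
  otherwise.
\<close>

fun par_dom :: "(nat \<Rightarrow> 'm::chilbert_space \<Rightarrow> 'n::chilbert_space) \<Rightarrow> nat \<Rightarrow> 'm set"
  and par_cod :: "(nat \<Rightarrow> 'm::chilbert_space \<Rightarrow> 'n::chilbert_space) \<Rightarrow> nat \<Rightarrow> 'n set" where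
  "par_dom \<Gamma> 0 = UNIV"
| "par_dom \<Gamma> (Suc n) = defect_space (par_dom \<Gamma> n) (par_cod \<Gamma> n) (\<Gamma> n)"
| "par_cod \<Gamma> 0 = UNIV"
| "par_cod \<Gamma> (Suc n) = codefect_space (par_dom \<Gamma> n) (par_cod \<Gamma> n) (\<Gamma> n)"

text \<open>
  \<open>\<Phi> n\<close> is the n-th Schur iterate. The last clause says that the next iterate is the unique
  function satisfying the recursion (functions being compared on the disc and on their domain).
\<close>

definition schur_parameters ::
    "(complex \<Rightarrow> 'm::chilbert_space \<Rightarrow> 'n::chilbert_space) \<Rightarrow> (nat \<Rightarrow> 'm \<Rightarrow> 'n) \<Rightarrow> bool" where
  "schur_parameters \<Theta> \<Gamma> \<longleftrightarrow> \<Theta> \<in> schur_class UNIV UNIV \<and> (\<exists>\<Phi>. \<Phi> 0 = \<Theta> \<and>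
     (\<forall>n. (\<forall>x\<in>par_dom \<Gamma> n. \<Gamma> n x = \<Phi> n 0 x) \<and>
       schur_step (par_dom \<Gamma> n) (par_cod \<Gamma> n) (\<Gamma> n) (\<Phi> n) (\<Phi> (Suc n)) \<and>
       (\<forall>\<Psi>. schur_step (par_dom \<Gamma> n) (par_cod \<Gamma> n) (\<Gamma> n) (\<Phi> n) \<Psi> \<longrightarrow>
         (\<forall>z\<in>ball 0 1. \<forall>x\<in>par_dom \<Gamma> (Suc n). \<Psi> z x = \<Phi> (Suc n) z x))))"


section \<open>Block operator CMV matrices\<close>

definition choice_sequence :: "(nat \<Rightarrow> 'm::chilbert_space \<Rightarrow> 'n::chilbert_space) \<Rightarrow> bool" where
  "choice_sequence \<Gamma> \<longleftrightarrow> (\<forall>n. contraction (par_dom \<Gamma> n) (par_cod \<Gamma> n) (\<Gamma> n))"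

definition rotation ::
    "(nat \<Rightarrow> 'm::chilbert_space \<Rightarrow> 'n::chilbert_space) \<Rightarrow> nat \<Rightarrow> 'm \<times> 'n \<Rightarrow> 'n \<times> 'm" where
  "rotation \<Gamma> n = elementary_rotation (par_dom \<Gamma> n) (par_cod \<Gamma> n) (\<Gamma> n)"

text \<open>The Hilbert sum of defect spaces; recall that \<open>par_dom \<Gamma> (Suc k)\<close> and \<open>par_cod \<Gamma> (Suc k)\<close>
  are the defect space of \<open>\<Gamma> k\<close> and of its adjoint.\<close>

definition cmv_H :: "(nat \<Rightarrow> 'm::chilbert_space \<Rightarrow> 'n::chilbert_space) \<Rightarrow> ('m \<times> 'n) ell2 set" where
  "cmv_H \<Gamma> = {f. \<forall>n. ell2_nth f n \<in> par_dom \<Gamma> (Suc (2*n)) \<times> par_cod \<Gamma> (Suc (2*n+1))}"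

definition cmv_Ht :: "(nat \<Rightarrow> 'm::chilbert_space \<Rightarrow> 'n::chilbert_space) \<Rightarrow> ('n \<times> 'm) ell2 set" where
  "cmv_Ht \<Gamma> = {f. \<forall>n. ell2_nth f n \<in> par_cod \<Gamma> (Suc (2*n)) \<times> par_dom \<Gamma> (Suc (2*n+1))}"

definition dsum_op ::
    "(nat \<Rightarrow> 'a::chilbert_space \<Rightarrow> 'b::chilbert_space) \<Rightarrow> 'a ell2 \<Rightarrow> 'b ell2" where
  "dsum_op T f = Abs_ell2 (\<lambda>n. T n (ell2_nth f n))"

text \<open>
  The two regroupings of summands: (m, ((a0, b0), (a1, b1), ...)) is mapped to
  ((m, a0), (b0, a1), (b1, a2), ...), and ((n, c0), (d0, c1), (d1, c2), ...) is mapped to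
  (n, ((c0, d0), (c1, d1), ...)).
\<close>

definition shift_in :: "'a::chilbert_space \<times> ('b::chilbert_space \<times> 'a) ell2 \<Rightarrow> ('a \<times> 'b) ell2" where
  "shift_in = (\<lambda>(x, f). Abs_ell2 (\<lambda>n.
     (case n of 0 \<Rightarrow> x | Suc k \<Rightarrow> snd (ell2_nth f k), fst (ell2_nth f n))))"

definition shift_out :: "('a::chilbert_space \<times> 'b::chilbert_space) ell2 \<Rightarrow> 'a \<times> ('b \<times> 'a) ell2" where
  "shift_out g = (fst (ell2_nth g 0),
     Abs_ell2 (\<lambda>n. (snd (ell2_nth g n), fst (ell2_nth g (Suc n)))))"

definition cmv_L ::
    "(nat \<Rightarrow> 'm::chilbert_space \<Rightarrow> 'n::chilbert_space) \<Rightarrow> 'm \<times> ('n \<times> 'm) ell2 \<Rightarrow> 'n \<times> ('m \<times> 'n) ell2" where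
  "cmv_L \<Gamma> = shift_out \<circ> dsum_op (\<lambda>n. rotation \<Gamma> (2*n)) \<circ> shift_in"

definition cmv_V ::
    "(nat \<Rightarrow> 'm::chilbert_space \<Rightarrow> 'n::chilbert_space) \<Rightarrow> ('m \<times> 'n) ell2 \<Rightarrow> ('n \<times> 'm) ell2" where
  "cmv_V \<Gamma> = dsum_op (\<lambda>n. rotation \<Gamma> (2*n+1))"

definition cmv_U ::
    "(nat \<Rightarrow> 'm::chilbert_space \<Rightarrow> 'n::chilbert_space) \<Rightarrow> 'm \<times> ('m \<times> 'n) ell2 \<Rightarrow> 'n \<times> ('m \<times> 'n) ell2" where
  "cmv_U \<Gamma> = cmv_L \<Gamma> \<circ> map_prod id (cmv_V \<Gamma>)"

definition cmv_Ut ::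
    "(nat \<Rightarrow> 'm::chilbert_space \<Rightarrow> 'n::chilbert_space) \<Rightarrow> 'm \<times> ('n \<times> 'm) ell2 \<Rightarrow> 'n \<times> ('n \<times> 'm) ell2" where
  "cmv_Ut \<Gamma> = map_prod id (cmv_V \<Gamma>) \<circ> cmv_L \<Gamma>"


section \<open>Systems\<close>

text \<open>A system is given by a block operator U from M + H to N + H, where the input and
  output spaces M, N are whole types and the state space H is a closed subspace of its type.\<close>

definition sys_D :: "('m \<times> 'h::chilbert_space \<Rightarrow> 'n \<times> 'h) \<Rightarrow> 'm::chilbert_space \<Rightarrow> 'n::chilbert_space" where
  "sys_D U x = fst (U (x, 0))"

definition sys_C :: "('m::chilbert_space \<times> 'h::chilbert_space \<Rightarrow> 'n \<times> 'h) \<Rightarrow> 'h \<Rightarrow> 'n::chilbert_space" where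
  "sys_C U h = fst (U (0, h))"

definition sys_B :: "('m::chilbert_space \<times> 'h::chilbert_space \<Rightarrow> 'n::chilbert_space \<times> 'h) \<Rightarrow> 'm \<Rightarrow> 'h" where
  "sys_B U x = snd (U (x, 0))"

definition sys_A :: "('m::chilbert_space \<times> 'h::chilbert_space \<Rightarrow> 'n::chilbert_space \<times> 'h) \<Rightarrow> 'h \<Rightarrow> 'h" where
  "sys_A U h = snd (U (0, h))"

definition conservative ::
    "'h::chilbert_space set \<Rightarrow> ('m::chilbert_space \<times> 'h \<Rightarrow> 'n::chilbert_space \<times> 'h) \<Rightarrow> bool" where
  "conservative H U \<longleftrightarrow> closed_csubspace H \<and> unitary_op (UNIV \<times> H) (UNIV \<times> H) U"

definition simple_system ::
    "'h::chilbert_space set \<Rightarrow> ('m::chilbert_space \<times> 'h \<Rightarrow> 'n::chilbert_space \<times> 'h) \<Rightarrow> bool" where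
  "simple_system H U \<longleftrightarrow> H = closure (cspan (
     (\<Union>k. range (\<lambda>x. (sys_A U ^^ k) (sys_B U x))) \<union>
     (\<Union>l. range (\<lambda>y. (adjoint_op H H (sys_A U) ^^ l) (adjoint_op H UNIV (sys_C U) y)))))"

definition transfer_function ::
    "'h::chilbert_space set \<Rightarrow> ('m::chilbert_space \<times> 'h \<Rightarrow> 'n::chilbert_space \<times> 'h) \<Rightarrow>
     complex \<Rightarrow> 'm \<Rightarrow> 'n" where
  "transfer_function H U z x = sys_D U x +
     z *\<^sub>C sys_C U (the_inv_into H (\<lambda>h. h - z *\<^sub>C sys_A U h) (sys_B U x))"

definition unitarily_equivalent ::
    "'h::chilbert_space set \<Rightarrow> ('m::chilbert_space \<times> 'h \<Rightarrow> 'n::chilbert_space \<times> 'h) \<Rightarrow>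
     'k::chilbert_space set \<Rightarrow> ('m \<times> 'k \<Rightarrow> 'n \<times> 'k) \<Rightarrow> bool" where
  "unitarily_equivalent H U K W \<longleftrightarrow> sys_D U = sys_D W \<and>
     (\<exists>V. unitary_op H K V \<and>
       (\<forall>h\<in>H. sys_A U h = the_inv_into H V (sys_A W (V h))) \<and>
       (\<forall>x. sys_B U x = the_inv_into H V (sys_B W x)) \<and>
       (\<forall>h\<in>H. sys_C U h = sys_C W (V h)))"

end

theory Submission
  imports Defs
begin

text \<open>
  The matrices are assembled from elementary rotations, and the proof reduces each claim to the
  rotations \<open>J (x, y) = (T x + D\<^sub>* y, D x - T\<^sup>* y)\<close>.

  Rotations are unitary because \<open>T D = D\<^sub>* T\<close> (lemma unitary_J). The square roots D and \<open>D\<^sub>*\<close> are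
  limits of one and the same sequence of polynomials in \<open>T\<^sup>* T\<close> and \<open>T T\<^sup>*\<close>, and T intertwines these two
  operators. Direct sums of rotations and the regroupings of summands are then unitary too, so both
  systems are conservative. Conjugation by \<open>\<V>\<^sub>0\<close> turns \<open>\<U>\<^sub>0 = \<L>\<^sub>0 (I \<oplus> \<V>\<^sub>0)\<close> into
  \<open>(I \<oplus> \<V>\<^sub>0) \<L>\<^sub>0\<close>, the other matrix, so the systems are unitarily equivalent and have the same
  transfer function.

  A conservative system is simple if U maps no set with a nonzero state onto itself without input
  and output (simple_systemI). For the CMV matrix, the entries of the states in such a set vanish
  one after the other, since \<open>D\<^sub>*\<close> is injective on the closure of its range (cmv_no_unitary_part).

  For the Schur parameters, the transfer function is read off closed loops: \<open>\<Theta>(z) x = y\<close> means that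
  \<open>U (x, z h) = (y, h)\<close> for some state h. Let U n be the CMV matrix of the sequence with its first n
  parameters removed. A closed loop of U n consists of one rotation \<open>J (x, z c) = (y, a)\<close> of the n-th
  parameter and of a closed loop of U (n + 1) with input a and output c (transfer_peel). Eliminating
  \<open>a = D x - z T\<^sup>* c\<close> from this rotation gives exactly the Schur recursion. So the transfer functions
  of the U n are the Schur iterates; they lie in the Schur class as transfer functions of conservative
  systems, and they are the only solutions of the recursion by schur_step_unique.
\<close>

section \<open>Inner products, functionals and adjoints\<close>

lemma cinner_zero_left [simp]: "cinner 0 (y::'a::complex_inner) = 0"
  using cinner_add_left[of 0 0 y] by simp

lemma cinner_zero_right [simp]: "cinner (y::'a::complex_inner) 0 = 0"
  using cinner_add_right[of y 0 0] by simp

lemma cinner_minus_left [simp]: "cinner (- x) (y::'a::complex_inner) = - cinner x y"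
  using cinner_add_left[of x "- x" y] by (simp add: eq_neg_iff_add_eq_0 add.commute)

lemma cinner_minus_right [simp]: "cinner x (- (y::'a::complex_inner)) = - cinner x y"
  using cinner_add_right[of x y "- y"] by (simp add: eq_neg_iff_add_eq_0 add.commute)

lemma cinner_diff_left: "cinner (x - y) (z::'a::complex_inner) = cinner x z - cinner y z"
  using cinner_add_left[of x "- y" z] by simp

lemma cinner_diff_right: "cinner x (y - (z::'a::complex_inner)) = cinner x y - cinner x z"
  using cinner_add_right[of x y "- z"] by simp

lemma cinner_scaleR_left: "cinner (r *\<^sub>R x) (y::'a::complex_inner) = r *\<^sub>R cinner x y"
  by (metis cinner_scaleC_left scaleC_of_real scaleR_conv_of_real)

lemma cinner_scaleR_right: "cinner x (r *\<^sub>R (y::'a::complex_inner)) = r *\<^sub>R cinner x y"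
  using cinner_scaleC_right[of x "complex_of_real r" y]
  by (simp add: scaleC_of_real scaleR_conv_of_real)

lemmas cinner_linear = cinner_add_left cinner_add_right cinner_diff_left cinner_diff_right
  cinner_scaleC_left cinner_scaleC_right cinner_scaleR_left cinner_scaleR_right

lemma cinner_eq_0_imp: "cinner (x::'a::complex_inner) x = 0 \<Longrightarrow> x = 0"
  by (simp add: cinner_self)

lemma norm_add_sq:
  "(norm (x + y))\<^sup>2 = (norm x)\<^sup>2 + (norm y)\<^sup>2 + 2 * Re (cinner x (y::'a::complex_inner))"
proof -
  have "complex_of_real ((norm (x + y))\<^sup>2) = cinner x x + cinner y y + (cinner x y + cinner y x)"
    by (simp only: cinner_self[symmetric] cinner_linear ac_simps)
  hence "Re (complex_of_real ((norm (x + y))\<^sup>2))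
      = Re (cinner x x + cinner y y + (cinner x y + cinner y x))" by simp
  thus ?thesis using cinner_commute[of y x] by (simp add: cinner_self)
qed

lemma norm_diff_sq:
  "(norm (x - y))\<^sup>2 = (norm x)\<^sup>2 + (norm y)\<^sup>2 - 2 * Re (cinner x (y::'a::complex_inner))"
  using norm_add_sq[of x "- y"] by simp

lemma cinner_Cauchy_Schwarz: "cmod (cinner x y) \<le> norm x * norm (y::'a::complex_inner)"
proof (cases "x = 0 \<or> y = 0")
  case False
  let ?x = "inverse (norm x) *\<^sub>R x" and ?y = "inverse (norm y) *\<^sub>R y"
  have "cmod (cinner ?x ?y) \<le> 1"
    using norm_cinner_le_squares[of ?x ?y] False by simp
  thus ?thesis using False by (simp add: cinner_linear divide_simps mult.commute split: if_splits)
qed auto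

lemma bounded_linear_cinner_left: "bounded_linear (\<lambda>x. cinner x (y::'a::complex_inner))"
  by (rule bounded_linear_intro[where K = "norm y"])
    (auto simp: cinner_linear cinner_Cauchy_Schwarz)

lemma bounded_linear_cinner_right: "bounded_linear (\<lambda>y. cinner (x::'a::complex_inner) y)"
  by (rule bounded_linear_intro[where K = "norm x"])
    (auto simp: cinner_linear cinner_Cauchy_Schwarz mult.commute[of "norm _" "norm x"])

lemma bounded_linear_scaleC: "bounded_linear (\<lambda>x::'a::complex_inner. c *\<^sub>C x)"
proof (rule bounded_linear_intro[where K = "cmod c"])
  show "c *\<^sub>C r *\<^sub>R x = r *\<^sub>R c *\<^sub>C x" for r and x :: 'a
    by (metis mult.commute scaleC_of_real scaleC_scaleC)
qed (auto simp: scaleC_add_right norm_scaleC)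

lemmas tendsto_cinner_left = bounded_linear.tendsto[OF bounded_linear_cinner_left]
lemmas tendsto_cinner_right = bounded_linear.tendsto[OF bounded_linear_cinner_right]
lemmas tendsto_scaleC = bounded_linear.tendsto[OF bounded_linear_scaleC]

lemma quadratic_nonneg_imp_linear_zero:
  fixes a b :: real
  assumes "\<And>t. 0 \<le> t\<^sup>2 * a + 2 * t * b" "0 \<le> a"
  shows "b = 0"
proof (rule ccontr)
  assume b: "b \<noteq> 0"
  \<comment> \<open>test at \<open>t = - b / (a + 1)\<close>, close to the minimizer \<open>- b / a\<close> but defined also for \<open>a = 0\<close>\<close>
  have "(b / (a + 1))\<^sup>2 * a \<le> (b / (a + 1))\<^sup>2 * (a + 1)"
    by (intro mult_left_mono) auto
  also have "\<dots> = b\<^sup>2 / (a + 1)"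
    using assms(2) by (simp add: power2_eq_square)
  finally have "(- b / (a + 1))\<^sup>2 * a + 2 * (- b / (a + 1)) * b \<le> - (b\<^sup>2 / (a + 1))"
    by (simp add: power2_eq_square)
  moreover have "b\<^sup>2 / (a + 1) > 0"
    using b assms(2) by simp
  ultimately show False using assms(1)[of "- b / (a + 1)"] by linarith
qed

lemma closed_csubspace_UNIV: "closed_csubspace UNIV"
  by (simp add: closed_csubspace_def complex_vector.subspace_UNIV)

lemma csubspace_scaleR: "csubspace K \<Longrightarrow> x \<in> K \<Longrightarrow> r *\<^sub>R x \<in> K"
  by (metis complex_vector.subspace_scale scaleC_of_real)

lemma closed_csubspaceD:
  assumes "closed_csubspace K"
  shows "csubspace K" "closed K" "0 \<in> K" "x \<in> K \<Longrightarrow> y \<in> K \<Longrightarrow> x + y \<in> K"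
    "x \<in> K \<Longrightarrow> y \<in> K \<Longrightarrow> x - y \<in> K" "x \<in> K \<Longrightarrow> c *\<^sub>C x \<in> K" "x \<in> K \<Longrightarrow> r *\<^sub>R x \<in> K"
  using assms by (auto simp: closed_csubspace_def complex_vector.subspace_0
      complex_vector.subspace_add complex_vector.subspace_diff complex_vector.subspace_scale
      csubspace_scaleR)

lemma closed_csubspace_closure:
  assumes "csubspace (S :: 'a::chilbert_space set)"
  shows "closed_csubspace (closure S)"
  unfolding closed_csubspace_def complex_vector.subspace_def
proof (intro conjI ballI allI)
  show "0 \<in> closure S" using assms closure_subset complex_vector.subspace_0 by blast
  fix x assume "x \<in> closure S"
  then obtain f where f: "\<And>n. f n \<in> S" "f \<longlonglongrightarrow> x" unfolding closure_sequential by blast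
  { fix y assume "y \<in> closure S"
    then obtain g where g: "\<And>n. g n \<in> S" "g \<longlonglongrightarrow> y" unfolding closure_sequential by blast
    have "f n + g n \<in> S" for n using assms f g by (simp add: complex_vector.subspace_add)
    thus "x + y \<in> closure S" unfolding closure_sequential
      using tendsto_add[OF f(2) g(2)] by (intro exI[of _ "\<lambda>n. f n + g n"]) auto }
  { fix c
    have "c *\<^sub>C f n \<in> S" for n using assms f by (simp add: complex_vector.subspace_scale)
    thus "c *\<^sub>C x \<in> closure S" unfolding closure_sequential
      using tendsto_scaleC[OF f(2)] by (intro exI[of _ "\<lambda>n. c *\<^sub>C f n"]) auto }
qed simp

lemma closed_csubspace_Times:
  assumes "closed_csubspace K" "closed_csubspace L"
  shows "closed_csubspace (K \<times> L)"
  using assms by (auto simp: closed_csubspace_def complex_vector.subspace_def closed_Times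
      scaleC_prod_def zero_prod_def)

lemma bounded_opI:
  assumes "\<And>x. x \<in> K \<Longrightarrow> T x \<in> L" "\<And>x y. x \<in> K \<Longrightarrow> y \<in> K \<Longrightarrow> T (x + y) = T x + T y"
    "\<And>c x. x \<in> K \<Longrightarrow> T (c *\<^sub>C x) = c *\<^sub>C T x" "\<And>x. x \<in> K \<Longrightarrow> norm (T x) \<le> B * norm x"
  shows "T \<in> bounded_op K L"
  using assms unfolding bounded_op_def by (auto intro!: exI[of _ B])

lemma bounded_opD:
  assumes "T \<in> bounded_op K L"
  shows "x \<in> K \<Longrightarrow> T x \<in> L" "x \<in> K \<Longrightarrow> y \<in> K \<Longrightarrow> T (x + y) = T x + T y"
    "x \<in> K \<Longrightarrow> T (c *\<^sub>C x) = c *\<^sub>C T x"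
  using assms unfolding bounded_op_def by auto

lemma bounded_op_scaleR: "T \<in> bounded_op K L \<Longrightarrow> x \<in> K \<Longrightarrow> T (r *\<^sub>R x) = r *\<^sub>R T x"
  by (metis bounded_opD(3) scaleC_of_real)

lemma bounded_op_bound:
  assumes "T \<in> bounded_op K L"
  obtains B where "0 \<le> B" "\<And>x. x \<in> K \<Longrightarrow> norm (T x) \<le> B * norm x"
proof -
  obtain B where B: "\<forall>x\<in>K. norm (T x) \<le> B * norm x"
    using assms unfolding bounded_op_def by auto
  show thesis
  proof (rule that[of "max B 0"])
    show "norm (T x) \<le> max B 0 * norm x" if "x \<in> K" for x
      using B that by (meson max.cobounded1 mult_right_mono norm_ge_zero order_trans)
  qed simp
qed

lemma bounded_op_diff:
  assumes "T \<in> bounded_op K L" "closed_csubspace K" "x \<in> K" "y \<in> K"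
  shows "T (x - y) = T x - T y"
  using bounded_opD(2)[OF assms(1), of "x - y" y] assms closed_csubspaceD[OF assms(2)]
  by (simp add: eq_diff_eq)

lemma bounded_op_zero:
  assumes "T \<in> bounded_op K L" "closed_csubspace K"
  shows "T 0 = 0"
  using bounded_op_diff[OF assms, of 0 0] closed_csubspaceD[OF assms(2)] by simp

lemma bounded_op_tendsto:
  assumes T: "T \<in> bounded_op K L" and K: "closed_csubspace K"
    and f: "\<And>n. f n \<in> K" "f \<longlonglongrightarrow> x" and x: "x \<in> K"
  shows "(\<lambda>n. T (f n)) \<longlonglongrightarrow> T x"
proof -
  obtain B where B: "\<And>x. x \<in> K \<Longrightarrow> norm (T x) \<le> B * norm x" using bounded_op_bound[OF T] by blast
  have "(\<lambda>n. T (f n) - T x) \<longlonglongrightarrow> 0"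
  proof (rule Lim_null_comparison)
    show "(\<lambda>n. B * norm (f n - x)) \<longlonglongrightarrow> 0"
      using tendsto_mult_right_zero[OF tendsto_norm_zero[OF LIM_zero[OF f(2)]]] .
    show "\<forall>\<^sub>F n in sequentially. norm (T (f n) - T x) \<le> B * norm (f n - x)"
      using B f x closed_csubspaceD[OF K] bounded_op_diff[OF T K] by (metis (lifting) eventuallyI)
  qed
  thus ?thesis by (rule LIM_zero_cancel)
qed

lemma bounded_op_compose:
  assumes "T \<in> bounded_op K L" "S \<in> bounded_op L M"
  shows "(\<lambda>x. S (T x)) \<in> bounded_op K M"
proof -
  obtain B where B: "0 \<le> B" "\<And>x. x \<in> K \<Longrightarrow> norm (T x) \<le> B * norm x"
    using bounded_op_bound[OF assms(1)] by blast
  obtain C where C: "0 \<le> C" "\<And>x. x \<in> L \<Longrightarrow> norm (S x) \<le> C * norm x"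
    using bounded_op_bound[OF assms(2)] by blast
  show ?thesis
  proof (rule bounded_opI)
    show "norm (S (T x)) \<le> C * B * norm x" if "x \<in> K" for x
      using C(2)[OF bounded_opD(1)[OF assms(1) that]] mult_left_mono[OF B(2)[OF that] C(1)]
      by (simp add: mult.assoc)
  qed (use assms in \<open>auto simp: bounded_opD\<close>)
qed

text \<open>Polarization over the complex field: the form \<open>\<langle>A x, y\<rangle>\<close> is recovered from its values at
  \<open>x + y\<close> and \<open>x + \<i> y\<close>.\<close>

lemma real_form_imp_symmetric:
  assumes A: "A \<in> bounded_op K K" and K: "closed_csubspace K"
    and real: "\<And>x. x \<in> K \<Longrightarrow> cinner (A x) x \<in> \<real>" and x: "x \<in> K" and y: "y \<in> K"
  shows "cinner (A x) y = cinner x (A y)"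
proof -
  let ?a = "cinner (A x) y" and ?b = "cinner (A y) x"
  note mem = closed_csubspaceD[OF K]
  have "cinner (A (x + y)) (x + y) = cinner (A x) x + cinner (A y) y + (?a + ?b)"
    using x y by (simp add: bounded_opD[OF A] cinner_linear)
  hence 1: "Im (?a + ?b) = 0"
    using real[of x] real[of y] real[of "x + y"] x y mem by (auto simp: complex_is_Real_iff)
  have "cinner (A (x + \<i> *\<^sub>C y)) (x + \<i> *\<^sub>C y)
      = cinner (A x) x + cinner (A y) y + (- \<i> * ?a + \<i> * ?b)"
    using x y mem by (simp add: bounded_opD[OF A] cinner_linear algebra_simps)
  hence 2: "Im (- \<i> * ?a + \<i> * ?b) = 0"
    using real[of x] real[of y] real[of "x + \<i> *\<^sub>C y"] x y mem by (auto simp: complex_is_Real_iff)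
  have "?a = cnj ?b" using 1 2 by (simp add: complex_eq_iff)
  thus ?thesis using cinner_commute[of x "A y"] by simp
qed

lemma isometry_imp_cinner_eq:
  assumes U: "U \<in> bounded_op K L" and K: "closed_csubspace K"
    and iso: "\<And>x. x \<in> K \<Longrightarrow> norm (U x) = norm x" and x: "x \<in> K" and y: "y \<in> K"
  shows "cinner (U x) (U y) = cinner x y"
proof -
  have re: "Re (cinner (U x) (U v)) = Re (cinner x v)" if "v \<in> K" for v
    using norm_add_sq[of x v] norm_add_sq[of "U x" "U v"] iso[of x] iso[of v] iso[of "x + v"]
      closed_csubspaceD(4)[OF K x that] x that by (simp add: bounded_opD[OF U])
  have "Im (cinner (U x) (U y)) = Im (cinner x y)"
    using re[of "\<i> *\<^sub>C y"] y closed_csubspaceD[OF K] by (simp add: bounded_opD[OF U] cinner_linear)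
  with re[OF y] show ?thesis by (simp add: complex_eq_iff)
qed

lemma unitary_opI:
  assumes "U \<in> bounded_op K L" "closed_csubspace K" "\<And>x. x \<in> K \<Longrightarrow> norm (U x) = norm x"
    "\<And>y. y \<in> L \<Longrightarrow> \<exists>x\<in>K. U x = y"
  shows "unitary_op K L U"
  unfolding unitary_op_def using assms isometry_imp_cinner_eq[OF assms(1,2,3)]
  by (auto simp: bounded_opD[OF assms(1)])

lemma unitary_opD:
  assumes "unitary_op K L U"
  shows "U \<in> bounded_op K L" "x \<in> K \<Longrightarrow> y \<in> K \<Longrightarrow> cinner (U x) (U y) = cinner x y"
    "x \<in> K \<Longrightarrow> norm (U x) = norm x" "w \<in> L \<Longrightarrow> \<exists>x\<in>K. U x = w"
proof -
  show c: "cinner (U x) (U y) = cinner x y" if "x \<in> K" "y \<in> K" for x y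
    using that assms by (simp add: unitary_op_def)
  show "norm (U x) = norm x" if "x \<in> K"
    using c[OF that that] by (simp only: cinner_self of_real_eq_iff) simp
qed (use assms in \<open>auto simp: unitary_op_def\<close>)

lemma unitary_op_compose:
  assumes "unitary_op K L U" "unitary_op L M V"
  shows "unitary_op K M (V \<circ> U)"
  unfolding unitary_op_def
proof (intro conjI ballI)
  show "V \<circ> U \<in> bounded_op K M"
    using bounded_op_compose[OF unitary_opD(1)[OF assms(1)] unitary_opD(1)[OF assms(2)]]
    by (simp add: comp_def)
  show "cinner ((V \<circ> U) x) ((V \<circ> U) y) = cinner x y" if "x \<in> K" "y \<in> K" for x y
    using that assms by (simp add: unitary_opD bounded_opD(1)[OF unitary_opD(1)[OF assms(1)]])
  show "(V \<circ> U) ` K = M"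
    using assms by (simp only: unitary_op_def image_comp[symmetric])
qed

lemma unitary_op_inj_on:
  assumes U: "unitary_op K L U" and K: "closed_csubspace K"
  shows "inj_on U K"
proof (rule inj_onI)
  fix x y assume "x \<in> K" "y \<in> K" "U x = U y"
  hence "norm (x - y) = 0"
    using unitary_opD(3)[OF U, of "x - y"] bounded_op_diff[OF unitary_opD(1)[OF U] K]
      closed_csubspaceD[OF K] by simp
  thus "x = y" by simp
qed

text \<open>The representing vector is the minimizer of
  \<open>\<parallel>x\<parallel>\<^sup>2 - 2 Re f(x)\<close>: minimizing sequences are Cauchy by the parallelogram law,
  and the first-order condition at the minimizer is the representation. Working with this functional
  instead of a distance makes orthogonal projections a corollary.\<close>

lemma riesz_representation:
  fixes f :: "'a::chilbert_space \<Rightarrow> complex"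
  assumes K: "closed_csubspace K"
    and add: "\<And>x y. x \<in> K \<Longrightarrow> y \<in> K \<Longrightarrow> f (x + y) = f x + f y"
    and scale: "\<And>c x. x \<in> K \<Longrightarrow> f (c *\<^sub>C x) = c * f x"
    and bound: "\<And>x. x \<in> K \<Longrightarrow> cmod (f x) \<le> B * norm x"
  shows "\<exists>u\<in>K. \<forall>x\<in>K. f x = cinner x u"
proof -
  note mem = closed_csubspaceD[OF K]
  define q where "q x = (norm x)\<^sup>2 - 2 * Re (f x)" for x
  define m where "m = Inf (q ` K)"
  have scaleR: "f (r *\<^sub>R x) = of_real r * f x" if "x \<in> K" for r x
    using scale[OF that, of "of_real r"] by (simp add: scaleC_of_real)
  have low: "- B\<^sup>2 \<le> q x" if "x \<in> K" for x
  proof -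
    have "Re (f x) \<le> B * norm x" using bound[OF that] complex_Re_le_cmod order_trans by blast
    moreover have "0 \<le> (norm x - B)\<^sup>2" by simp
    ultimately show ?thesis by (simp add: q_def power2_diff mult.commute)
  qed
  have bdd: "bdd_below (q ` K)" using low by (intro bdd_belowI2)
  have m: "m \<le> q x" if "x \<in> K" for x
    unfolding m_def using bdd that by (intro cInf_lower) auto
  have "\<exists>x\<in>K. q x < m + 1 / real (Suc n)" for n
  proof -
    have "Inf (q ` K) < m + 1 / real (Suc n)" by (simp add: m_def)
    thus ?thesis using cInf_lessD[of "q ` K"] mem(3) by blast
  qed
  then obtain X where X: "\<And>n. X n \<in> K" "\<And>n. q (X n) < m + 1 / real (Suc n)" by metis
  have par: "(norm (x - y))\<^sup>2 \<le> 2 * (q x - m) + 2 * (q y - m)" if "x \<in> K" "y \<in> K" for x y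
  proof -
    let ?z = "(1/2) *\<^sub>R (x + y)"
    have e1: "(norm ?z)\<^sup>2 = (norm (x + y))\<^sup>2 / 4" by (simp only: norm_scaleR power_mult_distrib) (simp add: power2_eq_square)
    have e2: "f ?z = of_real (1/2) * (f x + f y)" using that mem by (simp only: scaleR add)
    have "q ?z = (norm (x + y))\<^sup>2 / 4 - Re (f x) - Re (f y)"
      unfolding q_def e1 e2 by (simp add: field_simps)
    moreover have "m \<le> q ?z" using that mem by (intro m) auto
    ultimately have "m \<le> (norm (x + y))\<^sup>2 / 4 - Re (f x) - Re (f y)" by (simp only:)
    moreover have "m \<le> s / 4 - a - b \<Longrightarrow> s = u + v + 2 * c \<Longrightarrow> d = u + v - 2 * c \<Longrightarrow>
        d \<le> 2 * (u - 2 * a - m) + 2 * (v - 2 * b - m)" for s a b c d u v :: real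
      by (simp add: algebra_simps)
    ultimately show ?thesis
      unfolding q_def by (metis norm_add_sq norm_diff_sq)
  qed
  have "Cauchy X"
  proof (rule CauchyI)
    fix e :: real assume e: "0 < e"
    obtain N where N: "1 / real (Suc N) < e\<^sup>2 / 4"
      using reals_Archimedean[of "e\<^sup>2 / 4"] e by (auto simp: inverse_eq_divide)
    have "norm (X i - X j) < e" if "i \<ge> N" "j \<ge> N" for i j
    proof -
      have le: "1 / real (Suc k) \<le> 1 / real (Suc N)" if "k \<ge> N" for k
        using that by (simp add: frac_le)
      have "d \<le> 2 * (a - m) + 2 * (b - m) \<Longrightarrow> a < m + u \<Longrightarrow> b < m + v \<Longrightarrow> u \<le> w \<Longrightarrow> v \<le> w
          \<Longrightarrow> w < s / 4 \<Longrightarrow> d < s" for a b d s u v w :: real by (simp add: algebra_simps)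
      from this[OF par[OF X(1) X(1)] X(2) X(2) le[OF that(1)] le[OF that(2)] N]
      have "(norm (X i - X j))\<^sup>2 < e\<^sup>2" .
      thus ?thesis using e by (simp add: power2_less_imp_less)
    qed
    thus "\<exists>N. \<forall>i\<ge>N. \<forall>j\<ge>N. norm (X i - X j) < e" by blast
  qed
  then obtain u where u: "X \<longlonglongrightarrow> u" using Cauchy_convergent convergent_def by blast
  have uK: "u \<in> K" using X(1) u mem(2) closed_sequentially by blast
  have "(\<lambda>n. f (X n) - f u) \<longlonglongrightarrow> 0"
  proof (rule Lim_null_comparison)
    show "(\<lambda>n. B * norm (X n - u)) \<longlonglongrightarrow> 0"
      using tendsto_mult_right_zero[OF tendsto_norm_zero[OF LIM_zero[OF u]]] .
    have "f (X n) - f u = f (X n - u)" for n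
      using add[of "X n - u" u] X(1) uK mem by simp
    thus "\<forall>\<^sub>F n in sequentially. norm (f (X n) - f u) \<le> B * norm (X n - u)"
      using bound X(1) uK mem(5) by simp
  qed
  hence "(\<lambda>n. f (X n)) \<longlonglongrightarrow> f u" by (rule LIM_zero_cancel)
  hence "(\<lambda>n. q (X n)) \<longlonglongrightarrow> q u"
    unfolding q_def by (intro tendsto_intros u)
  moreover have "(\<lambda>n. m + 1 / real (Suc n)) \<longlonglongrightarrow> m + 0"
    by (intro tendsto_add tendsto_const LIMSEQ_Suc[OF lim_1_over_n])
  ultimately have qu: "q u \<le> m"
    using LIMSEQ_le[of "\<lambda>n. q (X n)" "q u" "\<lambda>n. m + 1 / real (Suc n)" "m + 0"] less_imp_le[OF X(2)]
    by (simp only: add_0_right) blast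
  have re: "Re (cinner u v) = Re (f v)" if v: "v \<in> K" for v
  proof -
    have "0 \<le> t\<^sup>2 * (norm v)\<^sup>2 + 2 * t * (Re (cinner u v) - Re (f v))" for t
    proof -
      have "q u \<le> q (u + t *\<^sub>R v)" using m[of "u + t *\<^sub>R v"] qu mem uK v by fastforce
      also have "\<dots> = q u + t\<^sup>2 * (norm v)\<^sup>2 + 2 * t * (Re (cinner u v) - Re (f v))"
        using uK v mem by (simp add: q_def norm_add_sq add scaleR cinner_linear power_mult_distrib algebra_simps)
      finally show ?thesis by simp
    qed
    from quadratic_nonneg_imp_linear_zero[OF this] show ?thesis by simp
  qed
  have "f v = cinner v u" if v: "v \<in> K" for v
  proof -
    have "Im (cinner u v) = - Im (f v)"
      using re[of "\<i> *\<^sub>C v"] v mem by (simp add: scale cinner_linear)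
    with re[OF v] show ?thesis
      by (subst cinner_commute) (simp add: complex_eq_iff)
  qed
  with uK show ?thesis by blast
qed

lemma adjoint_op_unique:
  assumes K: "closed_csubspace K" and S: "S \<in> bounded_op L K \<inter> extensional L"
      "\<And>x y. x \<in> K \<Longrightarrow> y \<in> L \<Longrightarrow> cinner (T x) y = cinner x (S y)"
    and S': "S' \<in> bounded_op L K \<inter> extensional L"
      "\<And>x y. x \<in> K \<Longrightarrow> y \<in> L \<Longrightarrow> cinner (T x) y = cinner x (S' y)"
  shows "S = S'"
proof (rule extensionalityI[of _ L])
  fix y assume y: "y \<in> L"
  have SK: "S y \<in> K" "S' y \<in> K" using y S(1) S'(1) by (auto simp: bounded_opD)
  have "S y - S' y \<in> K" using closed_csubspaceD(5)[OF K SK] .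
  hence "cinner (S y - S' y) (S y - S' y) = 0"
    using S(2)[OF _ y] S'(2)[OF _ y] by (simp add: cinner_diff_right)
  thus "S y = S' y" using cinner_eq_0_imp by force
qed (use S S' in auto)

lemma adjoint_op:
  assumes K: "closed_csubspace K" and L: "closed_csubspace L" and T: "T \<in> bounded_op K L"
  shows adjoint_op_bounded: "adjoint_op K L T \<in> bounded_op L K"
    and cinner_adjoint_op: "x \<in> K \<Longrightarrow> y \<in> L \<Longrightarrow> cinner (T x) y = cinner x (adjoint_op K L T y)"
proof -
  note mem = closed_csubspaceD[OF K]
  obtain B where B: "0 \<le> B" "\<And>x. x \<in> K \<Longrightarrow> norm (T x) \<le> B * norm x"
    using bounded_op_bound[OF T] by blast
  have ex: "\<exists>u\<in>K. \<forall>x\<in>K. cinner (T x) y = cinner x u" if "y \<in> L" for y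
  proof (rule riesz_representation[OF K])
    show "cmod (cinner (T x) y) \<le> (B * norm y) * norm x" if "x \<in> K" for x
      using order_trans[OF cinner_Cauchy_Schwarz mult_right_mono[OF B(2)[OF that], of "norm y"]]
      by (simp add: mult_ac)
  qed (simp_all add: bounded_opD[OF T] cinner_linear)
  have "\<forall>y\<in>L. \<exists>u. u \<in> K \<and> (\<forall>x\<in>K. cinner (T x) y = cinner x u)" using ex by blast
  then obtain S0 where S0: "\<forall>y\<in>L. S0 y \<in> K \<and> (\<forall>x\<in>K. cinner (T x) y = cinner x (S0 y))"
    using bchoice by metis
  define S where "S = restrict S0 L"
  have S: "S y \<in> K \<and> (\<forall>x\<in>K. cinner (T x) y = cinner x (S y))" if "y \<in> L" for y
    using S0 that unfolding S_def restrict_apply by (simp only: if_True) blast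
  have eqI: "u = v" if "u \<in> K" "v \<in> K" "\<And>x. x \<in> K \<Longrightarrow> cinner x u = cinner x v" for u v
    using that(3)[OF mem(5)[OF that(1,2)]] cinner_eq_0_imp[of "u - v"]
    by (simp add: cinner_diff_right)
  have "S \<in> bounded_op L K"
  proof (rule bounded_opI[where B = B])
    show "S (y + z) = S y + S z" if "y \<in> L" "z \<in> L" for y z
      using S[OF that(1)] S[OF that(2)] S[OF closed_csubspaceD(4)[OF L that]] mem
      by (intro eqI) (auto simp: cinner_linear)
    show "S (c *\<^sub>C y) = c *\<^sub>C S y" if "y \<in> L" for c y
      using S[OF that] S[OF closed_csubspaceD(6)[OF L that]] mem
      by (intro eqI) (auto simp: cinner_linear)
    show "norm (S y) \<le> B * norm y" if "y \<in> L" for y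
    proof (cases "S y = 0")
      case False
      have "(norm (S y))\<^sup>2 = cmod (cinner (S y) (S y))" by (simp add: cinner_self norm_power)
      also have "\<dots> = cmod (cinner (T (S y)) y)" using S[OF that] by simp
      also have "\<dots> \<le> norm (T (S y)) * norm y" by (rule cinner_Cauchy_Schwarz)
      also have "\<dots> \<le> B * norm (S y) * norm y"
        using B(2)[of "S y"] S[OF that] by (intro mult_right_mono) auto
      finally show ?thesis using False by (simp add: power2_eq_square mult_ac)
    qed (use B in auto)
  qed (use S in auto)
  moreover have "S \<in> extensional L" by (simp add: S_def)
  ultimately have props: "S \<in> bounded_op L K \<inter> extensional L \<and> (\<forall>x\<in>K. \<forall>y\<in>L. cinner (T x) y = cinner x (S y))"
    using S by blast
  have "adjoint_op K L T = S"
    unfolding adjoint_op_def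
  proof (rule the_equality)
    fix S' assume "S' \<in> bounded_op L K \<inter> extensional L \<and> (\<forall>x\<in>K. \<forall>y\<in>L. cinner (T x) y = cinner x (S' y))"
    with props show "S' = S" by (intro adjoint_op_unique[OF K, of S' L T S]) auto
  qed (use props in auto)
  with props show "adjoint_op K L T \<in> bounded_op L K"
    and "x \<in> K \<Longrightarrow> y \<in> L \<Longrightarrow> cinner (T x) y = cinner x (adjoint_op K L T y)" by auto
qed

lemma cinner_adjoint_op':
  assumes "closed_csubspace K" "closed_csubspace L" "T \<in> bounded_op K L" "x \<in> K" "y \<in> L"
  shows "cinner (adjoint_op K L T y) x = cinner y (T x)"
  using cinner_adjoint_op[OF assms] cinner_commute[of "adjoint_op K L T y" x] cinner_commute[of y "T x"]
  by simp

lemma contraction_adjoint_op: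
  assumes K: "closed_csubspace K" and L: "closed_csubspace L" and T: "contraction K L T"
  shows "contraction L K (adjoint_op K L T)"
proof -
  have T': "T \<in> bounded_op K L" using T by (simp add: contraction_def)
  note S = adjoint_op_bounded[OF K L T']
  have "norm (adjoint_op K L T y) \<le> norm y" if y: "y \<in> L" for y
  proof (cases "adjoint_op K L T y = 0")
    case False
    let ?s = "adjoint_op K L T y"
    have s: "?s \<in> K" using bounded_opD(1)[OF S y] .
    have "(norm ?s)\<^sup>2 = cmod (cinner (T ?s) y)"
      using cinner_adjoint_op[OF K L T' s y] by (simp add: cinner_self norm_power)
    also have "\<dots> \<le> norm (T ?s) * norm y" by (rule cinner_Cauchy_Schwarz)
    also have "\<dots> \<le> norm ?s * norm y"
      using T s by (intro mult_right_mono) (auto simp: contraction_def)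
    finally show ?thesis using False by (simp add: power2_eq_square)
  qed simp
  thus ?thesis using S by (simp add: contraction_def)
qed

text \<open>The vector p that represents \<open>y \<mapsto> \<langle>y, x\<rangle>\<close> on the closed span of S is the orthogonal
  projection of x, and the remainder \<open>x - p\<close> is orthogonal to S.\<close>

lemma closure_cspan_eq:
  assumes H: "closed_csubspace H" and S: "S \<subseteq> H"
    and orth: "\<And>h. h \<in> H \<Longrightarrow> (\<And>s. s \<in> S \<Longrightarrow> cinner s h = 0) \<Longrightarrow> h = 0"
  shows "closure (cspan S) = H"
proof (rule antisym)
  let ?E = "closure (cspan S)"
  show sub: "?E \<subseteq> H"
    using H S by (intro closure_minimal complex_vector.span_minimal) (auto simp: closed_csubspace_def)
  have E: "closed_csubspace ?E"
    by (rule closed_csubspace_closure) (rule complex_vector.subspace_span)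
  show "H \<subseteq> ?E"
  proof
    fix x assume x: "x \<in> H"
    have "\<exists>p\<in>?E. \<forall>y\<in>?E. cinner y x = cinner y p"
      by (rule riesz_representation[OF E, where B = "norm x"])
        (auto simp: cinner_linear mult.commute[of "norm x"] cinner_Cauchy_Schwarz)
    then obtain p where p: "p \<in> ?E" "\<And>y. y \<in> ?E \<Longrightarrow> cinner y x = cinner y p" by blast
    have "x - p = 0"
    proof (rule orth)
      show "x - p \<in> H" using x p(1) sub closed_csubspaceD[OF H] by blast
      show "cinner s (x - p) = 0" if "s \<in> S" for s
        using p(2)[of s] that closure_subset complex_vector.span_base[of s S]
        by (auto simp: cinner_diff_right)
    qed
    thus "x \<in> ?E" using p(1) by simp
  qed
qed

text \<open>A solution of \<open>x - A x = b\<close> is a fixed point of the strict contraction \<open>x \<mapsto> b + A x\<close>.\<close>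

lemma bounded_op_perturbed_identity_bij:
  assumes K: "closed_csubspace K" and A: "A \<in> bounded_op K K"
    and r: "r < 1" and bound: "\<And>x. x \<in> K \<Longrightarrow> norm (A x) \<le> r * norm x"
  shows "bij_betw (\<lambda>x. x - A x) K K"
    and "\<And>x. x \<in> K \<Longrightarrow> (1 - r) * norm x \<le> norm (x - A x)"
proof -
  note mem = closed_csubspaceD[OF K]
  show lower: "(1 - r) * norm x \<le> norm (x - A x)" if "x \<in> K" for x
    using bound[OF that] norm_triangle_ineq2[of x "A x"] by (simp add: algebra_simps)
  show "bij_betw (\<lambda>x. x - A x) K K"
    unfolding bij_betw_def
  proof (intro conjI inj_onI equalityI subsetI)
    fix x y assume xy: "x \<in> K" "y \<in> K" "x - A x = y - A y"
    have "(x - y) - A (x - y) = (x - A x) - (y - A y)"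
      using xy(1,2) bounded_op_diff[OF A K] by simp
    hence "(x - y) - A (x - y) = 0" unfolding xy(3) by (simp only: diff_self)
    hence "(1 - r) * norm (x - y) \<le> 0"
      using lower[OF mem(5)[OF xy(1,2)]] by (metis norm_zero)
    hence "norm (x - y) \<le> 0" using r by (simp only: mult_le_0_iff) linarith
    thus "x = y" by simp
  next
    fix b assume b: "b \<in> K"
    have "\<exists>!x\<in>K. b + A x = x"
    proof (rule Banach_fix)
      show "complete K" using mem(2) by (simp add: complete_eq_closed)
      show "K \<noteq> {}" using mem(3) by auto
      show "(\<lambda>x. b + A x) ` K \<subseteq> K" using b mem(4) bounded_opD(1)[OF A] by blast
      show "max r 0 < 1" "0 \<le> max r 0" using r by auto
      show "dist (b + A x) (b + A y) \<le> max r 0 * dist x y" if "x \<in> K" "y \<in> K" for x y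
      proof -
        have "dist (b + A x) (b + A y) = norm (A (x - y))"
          using that bounded_op_diff[OF A K] by (simp add: dist_norm)
        also have "\<dots> \<le> r * norm (x - y)" by (intro bound mem(5) that)
        also have "\<dots> \<le> max r 0 * norm (x - y)" by (intro mult_right_mono) auto
        finally show ?thesis by (simp add: dist_norm)
      qed
    qed
    hence "\<exists>x. x \<in> K \<and> b + A x = x" by (rule ex1_implies_ex)
    then obtain x where "x \<in> K" "b + A x = x" by (elim exE conjE)
    moreover from this have "x - A x = b" by (simp only: diff_eq_eq)
    ultimately show "b \<in> (\<lambda>x. x - A x) ` K" by blast
  next
    show "y \<in> K" if "y \<in> (\<lambda>x. x - A x) ` K" for y
      using that mem(5) bounded_opD(1)[OF A] by blast
  qed
qed

section \<open>Square roots and defect operators\<close>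

text \<open>For a self-adjoint contraction X the positive square root of \<open>I - X\<close> is \<open>I - Y\<close> where Y
  solves \<open>Y = (X + Y\<^sup>2) / 2\<close>. The iterates of this equation from 0 commute with each other and are
  dominated, increments included, by the scalar iterates for \<open>X = 1\<close>, which increase and stay
  at most 1; hence they converge in norm. The iterates are polynomials in X, so whatever
  intertwines two such X also intertwines the iterates and the roots.\<close>

primrec sqrt_iter :: "('a::chilbert_space \<Rightarrow> 'a) \<Rightarrow> nat \<Rightarrow> 'a \<Rightarrow> 'a" where
  "sqrt_iter X 0 = (\<lambda>x. 0)"
| "sqrt_iter X (Suc n) = (\<lambda>x. (1/2) *\<^sub>R (X x + sqrt_iter X n (sqrt_iter X n x)))"

primrec scalar_iter :: "nat \<Rightarrow> real" where
  "scalar_iter 0 = 0"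
| "scalar_iter (Suc n) = (1 + (scalar_iter n)\<^sup>2) / 2"

lemma scalar_iter_bounds: "0 \<le> scalar_iter n" "scalar_iter n \<le> 1"
proof -
  have "0 \<le> scalar_iter n \<and> scalar_iter n \<le> 1"
  proof (induction n)
    case (Suc n)
    hence "(scalar_iter n)\<^sup>2 \<le> 1" by (simp add: power_le_one)
    thus ?case by simp
  qed simp
  thus "0 \<le> scalar_iter n" "scalar_iter n \<le> 1" by auto
qed

lemma Cauchy_scalar_iter: "Cauchy scalar_iter"
proof -
  have "scalar_iter n \<le> scalar_iter (Suc n)" for n
  proof (induction n)
    case (Suc n)
    thus ?case using power_mono[OF Suc scalar_iter_bounds(1), of 2] by simp
  qed simp
  hence "incseq scalar_iter" by (rule incseq_SucI)
  thus ?thesis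
    using incseq_convergent[of scalar_iter 1] scalar_iter_bounds(2) LIMSEQ_imp_Cauchy by metis
qed

locale selfadjoint_contraction =
  fixes K :: "'a::chilbert_space set" and X
  assumes K: "closed_csubspace K" and X: "contraction K K X"
    and sym: "\<And>x y. x \<in> K \<Longrightarrow> y \<in> K \<Longrightarrow> cinner (X x) y = cinner x (X y)"
begin

lemmas mem = closed_csubspaceD[OF K]

lemma X_op: "X \<in> bounded_op K K" and X_le: "x \<in> K \<Longrightarrow> norm (X x) \<le> norm x"
  using X by (auto simp: contraction_def)

lemma iter_op: "sqrt_iter X n \<in> bounded_op K K"
  and iter_le: "x \<in> K \<Longrightarrow> norm (sqrt_iter X n x) \<le> scalar_iter n * norm x"
proof -
  have "sqrt_iter X n \<in> bounded_op K K \<and> (\<forall>x\<in>K. norm (sqrt_iter X n x) \<le> scalar_iter n * norm x)"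
  proof (induction n)
    case 0
    show ?case using mem(3) by (auto intro!: bounded_opI[where B = 0] simp: complex_vector.scale_zero_right)
  next
    case (Suc n)
    let ?Y = "sqrt_iter X n"
    from Suc have Y: "?Y \<in> bounded_op K K" and le: "\<And>x. x \<in> K \<Longrightarrow> norm (?Y x) \<le> scalar_iter n * norm x"
      by auto
    have norm: "norm (sqrt_iter X (Suc n) x) \<le> scalar_iter (Suc n) * norm x" if x: "x \<in> K" for x
    proof -
      have "norm (?Y (?Y x)) \<le> scalar_iter n * (scalar_iter n * norm x)"
        using order_trans[OF le[OF bounded_opD(1)[OF Y x]] mult_left_mono[OF le[OF x] scalar_iter_bounds(1)]] .
      hence "norm (X x + ?Y (?Y x)) \<le> norm x + scalar_iter n * (scalar_iter n * norm x)"
        using X_le[OF x] norm_triangle_ineq[of "X x" "?Y (?Y x)"] by linarith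
      thus ?thesis unfolding sqrt_iter.simps norm_scaleR by (simp add: power2_eq_square algebra_simps)
    qed
    have "sqrt_iter X (Suc n) \<in> bounded_op K K"
    proof (rule bounded_opI[OF _ _ _ norm])
      show "sqrt_iter X (Suc n) (c *\<^sub>C x) = c *\<^sub>C sqrt_iter X (Suc n) x" if "x \<in> K" for c x
        using that by (simp add: bounded_opD[OF X_op] bounded_opD[OF Y] scaleC_add_right
            linear_simps(5)[OF bounded_linear_scaleC])
    qed (simp_all add: mem bounded_opD[OF X_op] bounded_opD[OF Y] algebra_simps)
    with norm show ?case by blast
  qed
  thus "sqrt_iter X n \<in> bounded_op K K"
    "x \<in> K \<Longrightarrow> norm (sqrt_iter X n x) \<le> scalar_iter n * norm x" by auto
qed

lemma iter_mem: "x \<in> K \<Longrightarrow> sqrt_iter X n x \<in> K"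
  using bounded_opD(1)[OF iter_op] .

lemma iter_sym: "x \<in> K \<Longrightarrow> y \<in> K \<Longrightarrow> cinner (sqrt_iter X n x) y = cinner x (sqrt_iter X n y)"
  by (induction n arbitrary: x y) (auto simp: cinner_linear sym iter_mem)

end

lemma intertwine_sqrt_iter:
  assumes "selfadjoint_contraction K X" "selfadjoint_contraction L X'"
    and T: "T \<in> bounded_op K L" and comm: "\<And>x. x \<in> K \<Longrightarrow> T (X x) = X' (T x)" and x: "x \<in> K"
  shows "T (sqrt_iter X n x) = sqrt_iter X' n (T x)"
proof -
  interpret X: selfadjoint_contraction K X by fact
  interpret X': selfadjoint_contraction L X' by fact
  show ?thesis using x
  proof (induction n arbitrary: x)
    case 0
    show ?case using bounded_op_zero[OF T X.K] by simp
  next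
    case (Suc n)
    thus ?case
      using X.iter_mem X.mem bounded_opD(1)[OF X.X_op]
      by (simp add: bounded_op_scaleR[OF T] bounded_opD(2)[OF T] comm)
  qed
qed

context selfadjoint_contraction
begin

lemma iter_commute:
  assumes "x \<in> K"
  shows "sqrt_iter X m (sqrt_iter X n x) = sqrt_iter X n (sqrt_iter X m x)"
proof -
  have "sqrt_iter X m (X y) = X (sqrt_iter X m y)" if "y \<in> K" for y
    using intertwine_sqrt_iter[OF selfadjoint_contraction_axioms selfadjoint_contraction_axioms X_op refl that]
    by simp
  thus ?thesis
    by (intro intertwine_sqrt_iter[OF selfadjoint_contraction_axioms selfadjoint_contraction_axioms iter_op _ assms])
qed

lemma iter_increment_le:
  assumes "x \<in> K"
  shows "norm (sqrt_iter X (Suc n) x - sqrt_iter X n x) \<le> (scalar_iter (Suc n) - scalar_iter n) * norm x"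
  using assms
proof (induction n arbitrary: x)
  case 0
  thus ?case using X_le[of x] by simp
next
  case (Suc n)
  let ?Y = "sqrt_iter X n" and ?Z = "sqrt_iter X (Suc n)" and ?y = "scalar_iter n" and ?z = "scalar_iter (Suc n)"
  let ?d = "?Z x - ?Y x"
  have d: "?d \<in> K" using iter_mem[OF Suc.prems] mem(5) by blast
  have e1: "?Z (?Z x) - ?Y (?Y x) = ?Z ?d + ?Y ?d"
    using iter_mem[OF Suc.prems] bounded_op_diff[OF iter_op K] iter_commute[OF Suc.prems, of n "Suc n"]
    by (simp del: sqrt_iter.simps)
  moreover have "norm (?Z ?d + ?Y ?d) \<le> (?z + ?y) * norm ?d"
    using iter_le[OF d, of "Suc n"] iter_le[OF d, of n] norm_triangle_ineq[of "?Z ?d" "?Y ?d"]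
    by (simp only: distrib_right)
  moreover have "(?z + ?y) * norm ?d \<le> (?z + ?y) * ((?z - ?y) * norm x)"
    using Suc.IH[OF Suc.prems] scalar_iter_bounds(1) by (intro mult_left_mono add_nonneg_nonneg)
  moreover have e2: "sqrt_iter X (Suc (Suc n)) x - ?Z x = (1/2) *\<^sub>R (?Z (?Z x) - ?Y (?Y x))"
    unfolding sqrt_iter.simps(2)[of X "Suc n"] sqrt_iter.simps(2)[of X n, THEN fun_cong, of x]
    by (simp add: algebra_simps del: sqrt_iter.simps)
  moreover have "(scalar_iter (Suc (Suc n)) - ?z) * norm x = (?z + ?y) * ((?z - ?y) * norm x) / 2"
  proof -
    have "2 * ?z = 1 + ?y * ?y" by (simp add: power2_eq_square)
    moreover have "2 * scalar_iter (Suc (Suc n)) = 1 + ?z * ?z"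
      by (subst scalar_iter.simps(2)) (simp only: power2_eq_square, simp)
    ultimately have "2 * ((scalar_iter (Suc (Suc n)) - ?z) * norm x) = (?z + ?y) * ((?z - ?y) * norm x)"
      by algebra
    thus ?thesis by linarith
  qed
  moreover have "norm (sqrt_iter X (Suc (Suc n)) x - ?Z x) = norm (?Z ?d + ?Y ?d) / 2"
    unfolding e2 e1 norm_scaleR by simp
  ultimately show ?case by linarith
qed

lemma iter_diff_le:
  assumes "x \<in> K" "n \<le> m"
  shows "norm (sqrt_iter X m x - sqrt_iter X n x) \<le> (scalar_iter m - scalar_iter n) * norm x"
  using assms(2)
proof (induction m rule: dec_induct)
  case (step m)
  thus ?case
    using iter_increment_le[OF assms(1), of m]
      norm_triangle_ineq[of "sqrt_iter X (Suc m) x - sqrt_iter X m x" "sqrt_iter X m x - sqrt_iter X n x"]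
    by (simp add: left_diff_distrib del: sqrt_iter.simps scalar_iter.simps)
qed simp

definition iter_lim :: "'a \<Rightarrow> 'a" where "iter_lim x = lim (\<lambda>n. sqrt_iter X n x)"

lemma iter_tendsto:
  assumes x: "x \<in> K"
  shows "(\<lambda>n. sqrt_iter X n x) \<longlonglongrightarrow> iter_lim x"
proof -
  have "Cauchy (\<lambda>n. sqrt_iter X n x)"
  proof (rule CauchyI')
    fix e :: real assume e: "0 < e"
    have pos: "0 < norm x + 1" by (simp add: add_nonneg_pos)
    obtain M where M: "\<And>m n. m \<ge> M \<Longrightarrow> n \<ge> M \<Longrightarrow> norm (scalar_iter m - scalar_iter n) < e / (norm x + 1)"
      using CauchyD[OF Cauchy_scalar_iter divide_pos_pos[OF e pos]] by blast
    have "norm (sqrt_iter X m x - sqrt_iter X n x) < e" if "n \<ge> M" "m > n" for m n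
    proof -
      have "norm (sqrt_iter X m x - sqrt_iter X n x) \<le> (scalar_iter m - scalar_iter n) * norm x"
        using iter_diff_le[OF x] that by simp
      also have "\<dots> \<le> norm (scalar_iter m - scalar_iter n) * (norm x + 1)"
        by (intro mult_mono) auto
      also have "\<dots> < e" using M[of m n] that pos by (simp add: pos_less_divide_eq)
      finally show ?thesis .
    qed
    thus "\<exists>M. \<forall>m\<ge>M. \<forall>n>m. dist (sqrt_iter X m x) (sqrt_iter X n x) < e"
      unfolding dist_norm by (metis norm_minus_commute)
  qed
  thus ?thesis unfolding iter_lim_def by (simp add: Cauchy_convergent convergent_LIMSEQ_iff[symmetric])
qed

lemma iter_lim_mem: "x \<in> K \<Longrightarrow> iter_lim x \<in> K"
  using closed_sequentially[OF mem(2) _ iter_tendsto] iter_mem by blast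

lemma iter_lim_le:
  assumes "x \<in> K"
  shows "norm (iter_lim x) \<le> norm x"
proof (rule LIMSEQ_le_const2[OF tendsto_norm[OF iter_tendsto[OF assms]]])
  have "norm (sqrt_iter X n x) \<le> norm x" for n
    using iter_le[OF assms, of n] mult_right_mono[OF scalar_iter_bounds(2)[of n], of "norm x"] by simp
  thus "\<exists>N. \<forall>n\<ge>N. norm (sqrt_iter X n x) \<le> norm x" by blast
qed

lemma iter_lim_op: "iter_lim \<in> bounded_op K K"
proof (rule bounded_opI[where B = 1])
  show "iter_lim (x + y) = iter_lim x + iter_lim y" if "x \<in> K" "y \<in> K" for x y
    using LIMSEQ_unique[OF iter_tendsto[OF mem(4)[OF that]]]
      tendsto_add[OF iter_tendsto[OF that(1)] iter_tendsto[OF that(2)]] that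
    by (simp add: bounded_opD[OF iter_op])
  show "iter_lim (c *\<^sub>C x) = c *\<^sub>C iter_lim x" if "x \<in> K" for c x
    using LIMSEQ_unique[OF iter_tendsto[OF mem(6)[OF that]]] tendsto_scaleC[OF iter_tendsto[OF that]] that
    by (simp add: bounded_opD[OF iter_op])
qed (auto simp: iter_lim_mem iter_lim_le)

lemma iter_lim_sym:
  assumes "x \<in> K" "y \<in> K"
  shows "cinner (iter_lim x) y = cinner x (iter_lim y)"
  using LIMSEQ_unique[OF tendsto_cinner_left[OF iter_tendsto[OF assms(1)], of y]]
    tendsto_cinner_right[OF iter_tendsto[OF assms(2)], of x] assms
  by (simp add: iter_sym)

lemma iter_lim_eq:
  assumes x: "x \<in> K"
  shows "iter_lim x = (1/2) *\<^sub>R (X x + iter_lim (iter_lim x))"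
proof -
  have "(\<lambda>n. sqrt_iter X n (sqrt_iter X n x - iter_lim x)) \<longlonglongrightarrow> 0"
  proof (rule Lim_null_comparison)
    show "(\<lambda>n. norm (sqrt_iter X n x - iter_lim x)) \<longlonglongrightarrow> 0"
      using tendsto_norm_zero[OF LIM_zero[OF iter_tendsto[OF x]]] .
    have "norm (sqrt_iter X n v) \<le> norm v" if "v \<in> K" for v n
      using iter_le[OF that, of n] mult_right_mono[OF scalar_iter_bounds(2)[of n], of "norm v"] by simp
    thus "\<forall>\<^sub>F n in sequentially. norm (sqrt_iter X n (sqrt_iter X n x - iter_lim x))
        \<le> norm (sqrt_iter X n x - iter_lim x)"
      using x iter_mem iter_lim_mem mem(5) by (intro always_eventually allI) blast
  qed
  hence "(\<lambda>n. sqrt_iter X n (sqrt_iter X n x - iter_lim x) + sqrt_iter X n (iter_lim x))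
      \<longlonglongrightarrow> 0 + iter_lim (iter_lim x)"
    by (intro tendsto_add iter_tendsto iter_lim_mem x)
  hence "(\<lambda>n. sqrt_iter X n (sqrt_iter X n x)) \<longlonglongrightarrow> iter_lim (iter_lim x)"
    using x iter_mem iter_lim_mem by (simp add: bounded_op_diff[OF iter_op K])
  hence "(\<lambda>n. sqrt_iter X (Suc n) x) \<longlonglongrightarrow> (1/2) *\<^sub>R (X x + iter_lim (iter_lim x))"
    unfolding sqrt_iter.simps by (intro tendsto_intros)
  thus ?thesis using LIMSEQ_unique LIMSEQ_Suc[OF iter_tendsto[OF x]] by blast
qed

end

lemma positive_op_symmetric:
  assumes "positive_op K P" "closed_csubspace K" "x \<in> K" "y \<in> K"
  shows "cinner (P x) y = cinner x (P y)"
  using assms real_form_imp_symmetric[of P K x y] nonneg_Reals_subset_Reals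
  unfolding positive_op_def by blast

text \<open>The quadratic polynomial \<open>\<langle>P (y + t P y), y + t P y\<rangle>\<close> in real t is nonnegative and has no
  constant term, so its linear coefficient \<open>2 \<parallel>P y\<parallel>\<^sup>2\<close> is 0.\<close>

lemma positive_op_form_zero:
  assumes P: "positive_op K P" and K: "closed_csubspace K" and y: "y \<in> K"
    and zero: "cinner (P y) y = 0"
  shows "P y = 0"
proof -
  have op: "P \<in> bounded_op K K" using P by (simp add: positive_op_def)
  note mem = closed_csubspaceD[OF K]
  have v: "P y \<in> K" using bounded_opD(1)[OF op y] .
  let ?v = "P y"
  have nonneg: "0 \<le> Re (cinner (P x) x)" if "x \<in> K" for x
    using P that by (auto simp: positive_op_def complex_nonneg_Reals_iff)
  have "0 \<le> t\<^sup>2 * Re (cinner (P ?v) ?v) + 2 * t * Re (cinner ?v ?v)" for t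
  proof -
    have "cinner (P (y + t *\<^sub>R ?v)) (y + t *\<^sub>R ?v)
        = cinner (P y) y + t\<^sup>2 *\<^sub>R cinner (P ?v) ?v + t *\<^sub>R cinner ?v ?v + t *\<^sub>R cinner (P ?v) y"
      using y v mem by (simp add: bounded_opD[OF op] bounded_op_scaleR[OF op] cinner_linear
          power2_eq_square algebra_simps)
    also have "cinner (P ?v) y = cinner ?v ?v"
      using positive_op_symmetric[OF P K v y] .
    finally show ?thesis using nonneg[of "y + t *\<^sub>R ?v"] y v mem zero by simp
  qed
  from quadratic_nonneg_imp_linear_zero[OF this nonneg[OF v]] show ?thesis by (simp add: cinner_self)
qed

context selfadjoint_contraction
begin

definition root :: "'a \<Rightarrow> 'a" where "root = restrict (\<lambda>x. x - iter_lim x) K"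

lemma root_apply: "x \<in> K \<Longrightarrow> root x = x - iter_lim x"
  by (simp add: root_def)

lemma root_op: "root \<in> bounded_op K K"
proof (rule bounded_opI[where B = 2])
  show "norm (root x) \<le> 2 * norm x" if "x \<in> K" for x
    using norm_triangle_ineq4[of x "iter_lim x"] iter_lim_le[OF that] that by (simp add: root_apply)
qed (auto simp: root_apply mem iter_lim_mem bounded_opD[OF iter_lim_op] complex_vector.scale_right_diff_distrib)

lemma root_positive: "positive_op K root"
  unfolding positive_op_def
proof (intro conjI ballI root_op)
  fix x assume x: "x \<in> K"
  have "Im (cinner (iter_lim x) x) = 0"
    using iter_lim_sym[OF x x] cinner_commute[of x "iter_lim x"] by (metis cnj.simps(2) equal_neg_zero)
  moreover have "Re (cinner (iter_lim x) x) \<le> (norm x)\<^sup>2"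
  proof -
    have "Re (cinner (iter_lim x) x) \<le> norm (iter_lim x) * norm x"
      using cinner_Cauchy_Schwarz complex_Re_le_cmod order_trans by blast
    also have "\<dots> \<le> norm x * norm x" using iter_lim_le[OF x] by (intro mult_right_mono) auto
    finally show ?thesis by (simp add: power2_eq_square)
  qed
  ultimately show "cinner (root x) x \<in> \<real>\<^sub>\<ge>\<^sub>0"
    using x by (simp add: root_apply cinner_diff_left complex_nonneg_Reals_iff cinner_self)
qed

lemma root_root:
  assumes x: "x \<in> K"
  shows "root (root x) = x - X x"
proof -
  have "root (root x) = x - 2 *\<^sub>R iter_lim x + iter_lim (iter_lim x)"
    using x iter_lim_mem mem
    by (simp add: root_apply bounded_op_diff[OF iter_lim_op K] scaleR_2)
  also have "2 *\<^sub>R iter_lim x = X x + iter_lim (iter_lim x)"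
    by (subst iter_lim_eq[OF x]) simp
  finally show ?thesis by simp
qed

end

lemma intertwine_root:
  assumes X: "selfadjoint_contraction K X" and X': "selfadjoint_contraction L X'"
    and T: "T \<in> bounded_op K L" and comm: "\<And>x. x \<in> K \<Longrightarrow> T (X x) = X' (T x)" and x: "x \<in> K"
  shows "T (selfadjoint_contraction.root K X x) = selfadjoint_contraction.root L X' (T x)"
proof -
  interpret X: selfadjoint_contraction K X by fact
  interpret X': selfadjoint_contraction L X' by fact
  have Tx: "T x \<in> L" using bounded_opD(1)[OF T x] .
  have "(\<lambda>n. T (sqrt_iter X n x)) \<longlonglongrightarrow> T (X.iter_lim x)"
    using X.iter_tendsto[OF x] X.iter_mem[OF x] X.iter_lim_mem[OF x] by (intro bounded_op_tendsto[OF T X.K])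
  hence "T (X.iter_lim x) = X'.iter_lim (T x)"
    using LIMSEQ_unique X'.iter_tendsto[OF Tx] intertwine_sqrt_iter[OF X X' T comm x] by simp
  thus ?thesis
    using x Tx X.iter_lim_mem by (simp add: X.root_apply X'.root_apply bounded_op_diff[OF T X.K])
qed

context selfadjoint_contraction
begin

text \<open>A positive root S of \<open>I - X\<close> commutes with \<open>X = I - S\<^sup>2\<close>, hence with the
  constructed root R. For \<open>y = (R - S) x\<close> this gives \<open>\<langle>R y, y\<rangle> + \<langle>S y, y\<rangle> = 0\<close>, so both forms
  vanish at y and \<open>R y = S y = 0\<close>.\<close>

lemma root_unique:
  assumes S: "positive_op K S" and SS: "\<And>x. x \<in> K \<Longrightarrow> S (S x) = x - X x" and x: "x \<in> K"
  shows "S x = root x"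
proof -
  have op: "S \<in> bounded_op K K" using S by (simp add: positive_op_def)
  note sm = bounded_opD(1)[OF op] and rm = bounded_opD(1)[OF root_op]
  have SX: "S (X v) = X (S v)" if v: "v \<in> K" for v
  proof -
    have "S (X v) = S (v - S (S v))" using SS[OF v] by simp
    also have "\<dots> = S v - S (S (S v))" using v sm by (simp add: bounded_op_diff[OF op K])
    also have "\<dots> = X (S v)" using SS[OF sm[OF v]] by simp
    finally show ?thesis .
  qed
  have comm: "S (root x) = root (S x)"
    using intertwine_root[OF selfadjoint_contraction_axioms selfadjoint_contraction_axioms op SX x] .
  let ?y = "root x - S x"
  have y: "?y \<in> K" using x sm rm mem(5) by blast
  have "root ?y + S ?y = 0"
    using x sm rm comm root_root[OF x] SS[OF x]
    by (simp add: bounded_op_diff[OF op K] bounded_op_diff[OF root_op K])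
  hence "cinner (root ?y) ?y + cinner (S ?y) ?y = 0"
    by (simp only: cinner_add_left[symmetric] cinner_zero_left)
  moreover have "cinner (root ?y) ?y \<in> \<real>\<^sub>\<ge>\<^sub>0" "cinner (S ?y) ?y \<in> \<real>\<^sub>\<ge>\<^sub>0"
    using root_positive S y by (auto simp: positive_op_def)
  ultimately have "cinner (root ?y) ?y = 0" "cinner (S ?y) ?y = 0"
    by (auto simp: complex_nonneg_Reals_iff complex_eq_iff)
  hence "root ?y = 0" "S ?y = 0"
    using positive_op_form_zero[OF root_positive K y] positive_op_form_zero[OF S K y] by auto
  hence "cinner ?y ?y = 0"
    using positive_op_symmetric[OF root_positive K x y] positive_op_symmetric[OF S K x y]
    by (subst cinner_diff_left) simp
  thus ?thesis using cinner_eq_0_imp by force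
qed

lemma sqrt_op_eq_root:
  assumes "\<And>x. x \<in> K \<Longrightarrow> P x = x - X x"
  shows "sqrt_op K P = root"
  unfolding sqrt_op_def
proof (rule the_equality)
  show "root \<in> extensional K \<and> positive_op K root \<and> (\<forall>x\<in>K. root (root x) = P x)"
    using root_positive root_root assms by (simp add: root_def)
  show "R = root" if "R \<in> extensional K \<and> positive_op K R \<and> (\<forall>x\<in>K. R (R x) = P x)" for R
    using that assms root_unique by (intro extensionalityI[of R K]) (auto simp: root_def)
qed

end

lemma csubspace_image:
  assumes A: "A \<in> bounded_op M M" and M: "closed_csubspace M"
  shows "csubspace (A ` M)"
  unfolding complex_vector.subspace_def
proof (intro conjI ballI allI)
  show "0 \<in> A ` M" using bounded_op_zero[OF A M] closed_csubspaceD(3)[OF M] by (metis imageI)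
  show "x + y \<in> A ` M" if "x \<in> A ` M" "y \<in> A ` M" for x y
    using that closed_csubspaceD(4)[OF M] bounded_opD(2)[OF A] by (metis (no_types, opaque_lifting) imageE imageI)
  show "c *\<^sub>C x \<in> A ` M" if "x \<in> A ` M" for c x
    using that closed_csubspaceD(6)[OF M] bounded_opD(3)[OF A] by (metis (no_types, opaque_lifting) imageE imageI)
qed

lemma closure_invariance:
  assumes A: "A \<in> bounded_op M N" and M: "closed_csubspace M" and S: "S \<subseteq> M"
    and AS: "A ` S \<subseteq> R" and x: "x \<in> closure S"
  shows "A x \<in> closure R"
proof -
  obtain f where f: "\<And>n. f n \<in> S" "f \<longlonglongrightarrow> x" using x unfolding closure_sequential by blast
  have "x \<in> M" using closure_minimal[OF S closed_csubspaceD(2)[OF M]] x by blast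
  hence "(\<lambda>n. A (f n)) \<longlonglongrightarrow> A x" using f S by (intro bounded_op_tendsto[OF A M]) auto
  moreover have "A (f n) \<in> R" for n using f AS by blast
  ultimately show ?thesis unfolding closure_sequential by (intro exI[of _ "\<lambda>n. A (f n)"]) simp
qed

locale contraction_between =
  fixes K :: "'a::chilbert_space set" and L :: "'b::chilbert_space set" and T
  assumes K: "closed_csubspace K" and L: "closed_csubspace L" and T: "contraction K L T"
begin

abbreviation "Ts \<equiv> adjoint_op K L T"
abbreviation "D \<equiv> defect K L T"
abbreviation "Ds \<equiv> codefect K L T"
abbreviation "DD \<equiv> defect_space K L T"
abbreviation "DDs \<equiv> codefect_space K L T"

lemma T_op: "T \<in> bounded_op K L" and T_le: "x \<in> K \<Longrightarrow> norm (T x) \<le> norm x"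
  using T by (auto simp: contraction_def)

lemma Ts_op: "Ts \<in> bounded_op L K" and Ts_le: "y \<in> L \<Longrightarrow> norm (Ts y) \<le> norm y"
  using contraction_adjoint_op[OF K L T] by (auto simp: contraction_def)

lemma cinner_Ts: "x \<in> K \<Longrightarrow> y \<in> L \<Longrightarrow> cinner (T x) y = cinner x (Ts y)"
  and cinner_Ts': "x \<in> K \<Longrightarrow> y \<in> L \<Longrightarrow> cinner (Ts y) x = cinner y (T x)"
  using cinner_adjoint_op[OF K L T_op] cinner_adjoint_op'[OF K L T_op] by auto

sublocale TsT: selfadjoint_contraction K "\<lambda>x. Ts (T x)"
proof
  show "contraction K K (\<lambda>x. Ts (T x))"
    using bounded_op_compose[OF T_op Ts_op] order_trans[OF Ts_le T_le] bounded_opD(1)[OF T_op]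
    by (auto simp: contraction_def)
  show "cinner (Ts (T x)) y = cinner x (Ts (T y))" if "x \<in> K" "y \<in> K" for x y
    using that bounded_opD(1)[OF T_op] by (simp add: cinner_Ts' cinner_Ts)
qed (rule K)

sublocale TTs: selfadjoint_contraction L "\<lambda>y. T (Ts y)"
proof
  show "contraction L L (\<lambda>y. T (Ts y))"
    using bounded_op_compose[OF Ts_op T_op] order_trans[OF T_le Ts_le] bounded_opD(1)[OF Ts_op]
    by (auto simp: contraction_def)
  show "cinner (T (Ts x)) y = cinner x (T (Ts y))" if "x \<in> L" "y \<in> L" for x y
    using that bounded_opD(1)[OF Ts_op] by (simp add: cinner_Ts cinner_Ts')
qed (rule L)

lemma D_eq_root: "D = TsT.root" and Ds_eq_root: "Ds = TTs.root"
  unfolding defect_def codefect_def by (rule TsT.sqrt_op_eq_root TTs.sqrt_op_eq_root, simp)+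

lemma D_op: "D \<in> bounded_op K K" and Ds_op: "Ds \<in> bounded_op L L"
  by (simp_all add: D_eq_root Ds_eq_root TsT.root_op TTs.root_op)

lemma D_D: "x \<in> K \<Longrightarrow> D (D x) = x - Ts (T x)" and Ds_Ds: "y \<in> L \<Longrightarrow> Ds (Ds y) = y - T (Ts y)"
  by (simp_all add: D_eq_root Ds_eq_root TsT.root_root TTs.root_root)

lemma D_sym: "x \<in> K \<Longrightarrow> y \<in> K \<Longrightarrow> cinner (D x) y = cinner x (D y)"
  and Ds_sym: "u \<in> L \<Longrightarrow> v \<in> L \<Longrightarrow> cinner (Ds u) v = cinner u (Ds v)"
  using positive_op_symmetric[OF TsT.root_positive K] positive_op_symmetric[OF TTs.root_positive L]
  by (simp_all add: D_eq_root Ds_eq_root)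

lemma T_D: "x \<in> K \<Longrightarrow> T (D x) = Ds (T x)"
  unfolding D_eq_root Ds_eq_root
  by (rule intertwine_root[OF TsT.selfadjoint_contraction_axioms TTs.selfadjoint_contraction_axioms T_op]) simp_all

lemma Ts_Ds: "y \<in> L \<Longrightarrow> Ts (Ds y) = D (Ts y)"
  unfolding D_eq_root Ds_eq_root
  by (rule intertwine_root[OF TTs.selfadjoint_contraction_axioms TsT.selfadjoint_contraction_axioms Ts_op]) simp_all

lemma DD_closed: "closed_csubspace DD" and DDs_closed: "closed_csubspace DDs"
  unfolding defect_space_def codefect_space_def
  using closed_csubspace_closure csubspace_image D_op Ds_op K L by blast+

lemma DD_sub: "DD \<subseteq> K" and DDs_sub: "DDs \<subseteq> L"
  unfolding defect_space_def codefect_space_def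
  using TsT.mem(2) TTs.mem(2) bounded_opD(1)[OF D_op] bounded_opD(1)[OF Ds_op]
  by (simp_all add: closure_minimal image_subset_iff)

lemma D_mem: "x \<in> K \<Longrightarrow> D x \<in> DD" and Ds_mem: "y \<in> L \<Longrightarrow> Ds y \<in> DDs"
  unfolding defect_space_def codefect_space_def
  using closure_subset[of "D ` K"] closure_subset[of "Ds ` L"] by auto

text \<open>The kernel of the self-adjoint \<open>D\<^sub>*\<close> is orthogonal to its range, hence to the codefect space.\<close>

lemma Ds_eq_0_imp:
  assumes y: "y \<in> DDs" and "Ds y = 0"
  shows "y = 0"
proof -
  have yL: "y \<in> L" using y DDs_sub by blast
  obtain f where f: "\<And>n. f n \<in> Ds ` L" "f \<longlonglongrightarrow> y"
    using y unfolding codefect_space_def closure_sequential by blast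
  have "cinner v y = 0" if "v \<in> Ds ` L" for v
    using that Ds_sym[OF _ yL] assms(2) by auto
  hence "(\<lambda>n. 0) \<longlonglongrightarrow> cinner y y" using tendsto_cinner_left[OF f(2), of y] f(1) by simp
  thus ?thesis using LIMSEQ_unique[OF tendsto_const] cinner_eq_0_imp by metis
qed

lemma T_DD: "x \<in> DD \<Longrightarrow> T x \<in> DDs"
  unfolding defect_space_def codefect_space_def
  using bounded_opD(1)[OF D_op] bounded_opD(1)[OF T_op] T_D
  by (intro closure_invariance[OF T_op K, of "D ` K"]) auto

lemma Ts_DDs: "y \<in> DDs \<Longrightarrow> Ts y \<in> DD"
  unfolding defect_space_def codefect_space_def
  using bounded_opD(1)[OF Ds_op] bounded_opD(1)[OF Ts_op] Ts_Ds
  by (intro closure_invariance[OF Ts_op L, of "Ds ` L"]) auto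

abbreviation "J \<equiv> elementary_rotation K L T"

lemma J_apply: "J (x, y) = (T x + Ds y, D x - Ts y)"
  by (simp add: elementary_rotation_def)

text \<open>The inverse of the rotation is the matrix with rows \<open>T\<^sup>*, D\<close> and \<open>D\<^sub>*, - T\<close>; that it
  is one, and that the rotation is isometric, both come down to \<open>T D = D\<^sub>* T\<close> and its adjoint.\<close>

lemma J_inverse:
  assumes u: "u \<in> L" and v: "v \<in> DD"
  shows "J (Ts u + D v, Ds u - T v) = (u, v)"
proof -
  have vK: "v \<in> K" using v DD_sub by blast
  note m = bounded_opD(1)[OF T_op] bounded_opD(1)[OF Ts_op] bounded_opD(1)[OF D_op] bounded_opD(1)[OF Ds_op]
  have "T (Ts u + D v) + Ds (Ds u - T v) = T (Ts u) + T (D v) + (u - T (Ts u) - Ds (T v))"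
    using u vK m by (simp add: bounded_opD(2)[OF T_op] bounded_op_diff[OF Ds_op L] Ds_Ds)
  moreover have "D (Ts u + D v) - Ts (Ds u - T v) = D (Ts u) + (v - Ts (T v)) - (Ts (Ds u) - Ts (T v))"
    using u vK m by (simp add: bounded_opD(2)[OF D_op] bounded_op_diff[OF Ts_op L] D_D)
  ultimately show ?thesis using T_D[OF vK] Ts_Ds[OF u] by (simp add: J_apply)
qed

lemma norm_J:
  assumes x: "x \<in> K" and y: "y \<in> L"
  shows "norm (J (x, y)) = norm (x, y)"
proof -
  note m = bounded_opD(1)[OF T_op] bounded_opD(1)[OF Ts_op] bounded_opD(1)[OF D_op] bounded_opD(1)[OF Ds_op]
  have D: "cinner (D x) (D x) = cinner x x - cinner (T x) (T x)"
    using x m by (simp add: D_sym D_D cinner_diff_right cinner_Ts)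
  have Ds: "cinner (Ds y) (Ds y) = cinner y y - cinner (Ts y) (Ts y)"
    using y m by (simp add: Ds_sym Ds_Ds cinner_diff_right cinner_Ts')
  have cross: "cinner (T x) (Ds y) = cinner (D x) (Ts y)"
    using x y m by (simp add: cinner_Ts[symmetric] T_D Ds_sym)
  hence "cinner (Ds y) (T x) = cinner (Ts y) (D x)"
    by (metis cinner_commute)
  with D Ds cross have "cinner (J (x, y)) (J (x, y)) = cinner (x, y) (x, y)"
    by (simp add: J_apply cinner_prod_def cinner_linear)
  hence "(norm (J (x, y)))\<^sup>2 = (norm (x, y))\<^sup>2"
    by (simp only: cinner_self of_real_eq_iff)
  thus ?thesis by simp
qed

lemma unitary_J: "unitary_op (K \<times> DDs) (L \<times> DD) J"
proof (rule unitary_opI)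
  note m = bounded_opD(1)[OF T_op] bounded_opD(1)[OF Ts_op] bounded_opD(1)[OF D_op] bounded_opD(1)[OF Ds_op]
  show J: "norm (J p) = norm p" if "p \<in> K \<times> DDs" for p
    using that norm_J DDs_sub by blast
  show "J \<in> bounded_op (K \<times> DDs) (L \<times> DD)"
  proof (rule bounded_opI[where B = 1])
    show "J p \<in> L \<times> DD" if "p \<in> K \<times> DDs" for p
      using that m DDs_sub TTs.mem(4) closed_csubspaceD(5)[OF DD_closed] D_mem Ts_DDs
      by (auto simp: J_apply)
    show "J (p + q) = J p + J q" if "p \<in> K \<times> DDs" "q \<in> K \<times> DDs" for p q
      using that DDs_sub
      by (cases p; cases q) (auto simp: J_apply bounded_opD(2)[OF T_op] bounded_opD(2)[OF Ts_op]
          bounded_opD(2)[OF D_op] bounded_opD(2)[OF Ds_op] subset_iff)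
    show "J (c *\<^sub>C p) = c *\<^sub>C J p" if "p \<in> K \<times> DDs" for c p
      using that DDs_sub
      by (cases p) (auto simp: J_apply bounded_opD(3)[OF T_op] bounded_opD(3)[OF Ts_op]
          bounded_opD(3)[OF D_op] bounded_opD(3)[OF Ds_op] subset_iff scaleC_prod_def scaleC_add_right
          complex_vector.scale_right_diff_distrib)
  qed (use J in auto)
  show "closed_csubspace (K \<times> DDs)" by (rule closed_csubspace_Times[OF K DDs_closed])
  show "\<exists>p\<in>K \<times> DDs. J p = q" if qm: "q \<in> L \<times> DD" for q
  proof -
    obtain u v where q: "q = (u, v)" "u \<in> L" "v \<in> DD" using qm by (cases q) auto
    have "Ts u + D v \<in> K" using q m DD_sub TsT.mem(4) by blast
    moreover have "Ds u - T v \<in> DDs" using q Ds_mem T_DD closed_csubspaceD(5)[OF DDs_closed] by blast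
    ultimately show ?thesis using J_inverse[OF q(2,3)] q(1) by blast
  qed
qed

end

section \<open>Conservative systems and their transfer functions\<close>

lemma bounded_op_add:
  assumes "T \<in> bounded_op K L" "S \<in> bounded_op K L" "closed_csubspace L"
  shows "(\<lambda>x. T x + S x) \<in> bounded_op K L"
proof -
  obtain B where B: "\<And>x. x \<in> K \<Longrightarrow> norm (T x) \<le> B * norm x" using bounded_op_bound[OF assms(1)] by blast
  obtain C where C: "\<And>x. x \<in> K \<Longrightarrow> norm (S x) \<le> C * norm x" using bounded_op_bound[OF assms(2)] by blast
  show ?thesis
  proof (rule bounded_opI)
    show "norm (T x + S x) \<le> (B + C) * norm x" if "x \<in> K" for x
      using norm_triangle_le[OF add_mono[OF B[OF that] C[OF that]]] by (simp add: distrib_right)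
  qed (simp_all add: bounded_opD[OF assms(1)] bounded_opD[OF assms(2)] closed_csubspaceD[OF assms(3)]
      scaleC_add_right)
qed

lemma bounded_op_scaleC_op:
  assumes "T \<in> bounded_op K L" "closed_csubspace L"
  shows "(\<lambda>x. c *\<^sub>C T x) \<in> bounded_op K L"
proof -
  obtain B where B: "\<And>x. x \<in> K \<Longrightarrow> norm (T x) \<le> B * norm x" using bounded_op_bound[OF assms(1)] by blast
  show ?thesis
  proof (rule bounded_opI)
    show "norm (c *\<^sub>C T x) \<le> (cmod c * B) * norm x" if "x \<in> K" for x
      using mult_left_mono[OF B[OF that], of "cmod c"] by (simp add: norm_scaleC mult.assoc)
  qed (simp_all add: bounded_opD[OF assms(1)] closed_csubspaceD[OF assms(2)]
      scaleC_add_right scaleC_scaleC mult.commute)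
qed

text \<open>Input and output spaces are closed subspaces M and N, because those of the Schur iterates
  are defect spaces.\<close>

locale conservative_system =
  fixes M :: "'m::chilbert_space set" and N :: "'n::chilbert_space set" and H :: "'h::chilbert_space set"
    and U
  assumes M: "closed_csubspace M" and N: "closed_csubspace N" and H: "closed_csubspace H"
    and U: "unitary_op (M \<times> H) (N \<times> H) U"
begin

abbreviation "A \<equiv> sys_A U"
abbreviation "B \<equiv> sys_B U"
abbreviation "C \<equiv> sys_C U"
abbreviation "D \<equiv> sys_D U"

lemmas U_op = unitary_opD(1)[OF U]

lemma U_mem: "x \<in> M \<Longrightarrow> h \<in> H \<Longrightarrow> U (x, h) \<in> N \<times> H"
  using bounded_opD(1)[OF U_op] by simp

lemma U_0: "h \<in> H \<Longrightarrow> U (0, h) = (C h, A h)" and U_in: "x \<in> M \<Longrightarrow> U (x, 0) = (D x, B x)"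
  by (simp_all add: sys_A_def sys_C_def sys_B_def sys_D_def)

lemma U_split:
  assumes "x \<in> M" "h \<in> H"
  shows "U (x, h) = (D x + C h, B x + A h)"
proof -
  have "U (x, h) = U ((x, 0) + (0, h))" by simp
  also have "\<dots> = U (x, 0) + U (0, h)"
    by (rule bounded_opD(2)[OF U_op]) (use assms closed_csubspaceD(3)[OF M] closed_csubspaceD(3)[OF H] in auto)
  finally show ?thesis using assms by (simp add: U_0 U_in)
qed

lemma compression_op:
  assumes e: "e \<in> bounded_op P (M \<times> H)" and e_le: "\<And>p. p \<in> P \<Longrightarrow> norm (e p) \<le> norm p"
  shows "(\<lambda>p. fst (U (e p))) \<in> bounded_op P N" "(\<lambda>p. snd (U (e p))) \<in> bounded_op P H"
    "p \<in> P \<Longrightarrow> norm (fst (U (e p))) \<le> norm p" "p \<in> P \<Longrightarrow> norm (snd (U (e p))) \<le> norm p"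
proof -
  note Ue = bounded_op_compose[OF e U_op]
  have le: "norm (U (e p)) \<le> norm p" if "p \<in> P" for p
    using unitary_opD(3)[OF U bounded_opD(1)[OF e that]] e_le[OF that] by simp
  show fst: "norm (fst (U (e p))) \<le> norm p" if "p \<in> P" for p
    using norm_fst_le[of "fst (U (e p))" "snd (U (e p))"] le[OF that] by simp
  show snd: "norm (snd (U (e p))) \<le> norm p" if "p \<in> P" for p
    using norm_snd_le[of "snd (U (e p))" "fst (U (e p))"] le[OF that] by simp
  show "(\<lambda>p. fst (U (e p))) \<in> bounded_op P N"
    by (rule bounded_opI[where B = 1])
      (use fst bounded_opD[OF Ue] in \<open>auto simp: scaleC_prod_def mem_Times_iff\<close>)
  show "(\<lambda>p. snd (U (e p))) \<in> bounded_op P H"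
    by (rule bounded_opI[where B = 1])
      (use snd bounded_opD[OF Ue] in \<open>auto simp: scaleC_prod_def mem_Times_iff\<close>)
qed

lemma embed_op:
  "(\<lambda>h. (0, h)) \<in> bounded_op H (M \<times> H)" "(\<lambda>x. (x, 0)) \<in> bounded_op M (M \<times> H)"
  by (rule bounded_opI[where B = 1],
      auto simp: closed_csubspaceD(3)[OF M] closed_csubspaceD(3)[OF H] scaleC_prod_def norm_Pair)+

lemma A_op: "A \<in> bounded_op H H" and C_op: "C \<in> bounded_op H N"
  and B_op: "B \<in> bounded_op M H" and D_op: "D \<in> bounded_op M N"
  unfolding sys_A_def sys_B_def sys_C_def sys_D_def
  by (intro compression_op(1,2)[OF embed_op(1)] compression_op(1,2)[OF embed_op(2)], simp add: norm_Pair)+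

lemma A_le: "h \<in> H \<Longrightarrow> norm (A h) \<le> norm h" and C_le: "h \<in> H \<Longrightarrow> norm (C h) \<le> norm h"
  and B_le: "x \<in> M \<Longrightarrow> norm (B x) \<le> norm x"
  unfolding sys_A_def sys_B_def sys_C_def
  by (auto intro!: compression_op(3,4)[OF embed_op(1)] compression_op(3,4)[OF embed_op(2)] simp: norm_Pair)

subsection \<open>The resolvent\<close>

definition R :: "complex \<Rightarrow> 'h \<Rightarrow> 'h" where
  "R z = the_inv_into H (\<lambda>h. h - z *\<^sub>C A h)"

lemma zA_op: "(\<lambda>h. z *\<^sub>C A h) \<in> bounded_op H H"
  by (rule bounded_op_scaleC_op[OF A_op H])

lemma zA_le: "h \<in> H \<Longrightarrow> norm (z *\<^sub>C A h) \<le> cmod z * norm h"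
  by (simp add: norm_scaleC A_le mult_left_mono)

lemma R_bij: "cmod z < 1 \<Longrightarrow> bij_betw (\<lambda>h. h - z *\<^sub>C A h) H H"
  using bounded_op_perturbed_identity_bij(1)[OF H zA_op _ zA_le] .

lemma R_mem: "cmod z < 1 \<Longrightarrow> b \<in> H \<Longrightarrow> R z b \<in> H"
  unfolding R_def using R_bij[of z] the_inv_into_into[of "\<lambda>h. h - z *\<^sub>C A h" H b H]
  by (simp add: bij_betw_def)

lemma R_eq: "cmod z < 1 \<Longrightarrow> b \<in> H \<Longrightarrow> R z b - z *\<^sub>C A (R z b) = b"
  unfolding R_def using R_bij[of z] f_the_inv_into_f[of "\<lambda>h. h - z *\<^sub>C A h" H b]
  by (simp add: bij_betw_def)

lemma R_unique: "cmod z < 1 \<Longrightarrow> h \<in> H \<Longrightarrow> R z (h - z *\<^sub>C A h) = h"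
  unfolding R_def using R_bij[of z] the_inv_into_f_f[of "\<lambda>h. h - z *\<^sub>C A h" H h]
  by (simp add: bij_betw_def)

lemma R_le:
  assumes "cmod z < 1" "b \<in> H"
  shows "norm (R z b) \<le> norm b / (1 - cmod z)"
  using bounded_op_perturbed_identity_bij(2)[OF H zA_op assms(1) zA_le R_mem[OF assms]] assms
  by (simp add: R_eq pos_le_divide_eq mult.commute)

lemma R_op:
  assumes z: "cmod z < 1"
  shows "R z \<in> bounded_op H H"
proof (rule bounded_opI[where B = "1 / (1 - cmod z)"])
  show "R z (b + c) = R z b + R z c" if "b \<in> H" "c \<in> H" for b c
  proof -
    have "(R z b + R z c) - z *\<^sub>C A (R z b + R z c)
        = (R z b - z *\<^sub>C A (R z b)) + (R z c - z *\<^sub>C A (R z c))"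
      using R_mem[OF z] that by (simp add: bounded_opD[OF A_op] scaleC_add_right)
    thus ?thesis
      using R_unique[OF z closed_csubspaceD(4)[OF H R_mem[OF z that(1)] R_mem[OF z that(2)]]] that z
      by (simp add: R_eq)
  qed
  show "R z (c *\<^sub>C b) = c *\<^sub>C R z b" if "b \<in> H" for c b
  proof -
    have e: "c *\<^sub>C R z b - z *\<^sub>C A (c *\<^sub>C R z b) = c *\<^sub>C (R z b - z *\<^sub>C A (R z b))"
      using R_mem[OF z] that by (simp add: bounded_opD[OF A_op] complex_vector.scale_right_diff_distrib
          scaleC_scaleC mult.commute)
    show ?thesis
      using R_unique[OF z closed_csubspaceD(6)[OF H R_mem[OF z that], of c]] by (simp only: e R_eq[OF z that])
  qed
qed (use R_mem[OF z] R_le[OF z] in auto)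

lemma R_resolvent_identity:
  assumes w: "cmod w < 1" and z: "cmod z < 1" and b: "b \<in> H"
  shows "w *\<^sub>C R w b - z *\<^sub>C R z b = (w - z) *\<^sub>C R w (R z b)"
    and "R w b - R z b = (w - z) *\<^sub>C R w (A (R z b))"
proof -
  let ?v = "R z b"
  have v: "?v \<in> H" using R_mem[OF z b] .
  have Av: "A ?v \<in> H" using bounded_opD(1)[OF A_op v] .
  have veq: "z *\<^sub>C A ?v = ?v - b" using R_eq[OF z b] by (simp add: algebra_simps)
  have Rv: "R w (?v - w *\<^sub>C A ?v) = ?v" using R_unique[OF w v] .
  have "R w b - R z b = R w (b - (?v - w *\<^sub>C A ?v))"
    using Rv v b bounded_op_diff[OF R_op[OF w] H] closed_csubspaceD[OF H] Av by simp
  also have "b - (?v - w *\<^sub>C A ?v) = (w - z) *\<^sub>C A ?v"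
    using veq by (simp add: complex_vector.scale_left_diff_distrib)
  finally show 2: "R w b - R z b = (w - z) *\<^sub>C R w (A ?v)"
    using bounded_opD(3)[OF R_op[OF w] Av] by simp
  have "R w b = R w (?v - z *\<^sub>C A ?v)" using veq by simp
  hence e1: "R w b = R w ?v - z *\<^sub>C R w (A ?v)"
    using v Av bounded_op_diff[OF R_op[OF w] H] closed_csubspaceD[OF H]
    by (simp add: bounded_opD(3)[OF R_op[OF w]])
  have e2: "?v = R w ?v - w *\<^sub>C R w (A ?v)"
    using Rv v Av bounded_op_diff[OF R_op[OF w] H] closed_csubspaceD[OF H]
    by (simp add: bounded_opD(3)[OF R_op[OF w]])
  have "w *\<^sub>C R w b - z *\<^sub>C ?v
      = w *\<^sub>C (R w ?v - z *\<^sub>C R w (A ?v)) - z *\<^sub>C (R w ?v - w *\<^sub>C R w (A ?v))"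
    using e1 e2 by metis
  thus "w *\<^sub>C R w b - z *\<^sub>C ?v = (w - z) *\<^sub>C R w ?v"
    by (simp add: complex_vector.scale_right_diff_distrib complex_vector.scale_left_diff_distrib
        scaleC_scaleC mult.commute)
qed

subsection \<open>The transfer function\<close>

abbreviation "\<Theta> \<equiv> transfer_function H U"

lemma transfer_eq: "\<Theta> z x = D x + z *\<^sub>C C (R z (B x))"
  by (simp add: transfer_function_def R_def)

text \<open>The transfer function at z sends x to y exactly when U maps \<open>(x, z h)\<close> to \<open>(y, h)\<close> for some
  state h. Contractivity, invariance under
  conjugacy and the Schur recursion all follow from this closed-loop form.\<close>

lemma transfer_loop:
  assumes z: "cmod z < 1" and x: "x \<in> M"
  shows "U (x, z *\<^sub>C R z (B x)) = (\<Theta> z x, R z (B x))"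
proof -
  have b: "B x \<in> H" using bounded_opD(1)[OF B_op x] .
  note r = R_mem[OF z b]
  have "B x + z *\<^sub>C A (R z (B x)) = R z (B x)" using R_eq[OF z b] by (simp add: algebra_simps)
  thus ?thesis
    using U_split[OF x closed_csubspaceD(6)[OF H r]]
    by (simp add: transfer_eq bounded_opD(3)[OF A_op r] bounded_opD(3)[OF C_op r])
qed

lemma transfer_unique:
  assumes z: "cmod z < 1" and x: "x \<in> M" and h: "h \<in> H" and eq: "U (x, z *\<^sub>C h) = (y, h)"
  shows "\<Theta> z x = y" "R z (B x) = h"
proof -
  have "B x + z *\<^sub>C A h = h" "D x + z *\<^sub>C C h = y"
    using eq U_split[OF x closed_csubspaceD(6)[OF H h]]
    by (simp_all add: bounded_opD(3)[OF A_op h] bounded_opD(3)[OF C_op h])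
  hence "B x = h - z *\<^sub>C A h" by (simp add: eq_diff_eq)
  thus "R z (B x) = h" using R_unique[OF z h] by simp
  with \<open>D x + z *\<^sub>C C h = y\<close> show "\<Theta> z x = y" by (simp add: transfer_eq)
qed

lemma transfer_op:
  assumes z: "cmod z < 1"
  shows "\<Theta> z \<in> bounded_op M N"
proof -
  have "(\<lambda>x. D x + z *\<^sub>C C (R z (B x))) \<in> bounded_op M N"
    by (intro bounded_op_add[OF D_op _ N] bounded_op_scaleC_op[OF _ N]
        bounded_op_compose[OF bounded_op_compose[OF B_op R_op[OF z]] C_op])
  thus ?thesis by (simp add: transfer_eq[abs_def])
qed

lemma transfer_le:
  assumes z: "cmod z < 1" and x: "x \<in> M"
  shows "norm (\<Theta> z x) \<le> norm x"
proof -
  let ?h = "R z (B x)"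
  have h: "?h \<in> H" using R_mem[OF z bounded_opD(1)[OF B_op x]] .
  have "(norm (\<Theta> z x, ?h))\<^sup>2 = (norm (x, z *\<^sub>C ?h))\<^sup>2"
    using unitary_opD(3)[OF U, of "(x, z *\<^sub>C ?h)"] x closed_csubspaceD(6)[OF H h]
    by (simp add: transfer_loop[OF z x])
  hence "(norm (\<Theta> z x))\<^sup>2 + (norm ?h)\<^sup>2 = (norm x)\<^sup>2 + (cmod z)\<^sup>2 * (norm ?h)\<^sup>2"
    by (simp add: norm_Pair norm_scaleC power_mult_distrib)
  moreover have "(cmod z)\<^sup>2 * (norm ?h)\<^sup>2 \<le> 1 * (norm ?h)\<^sup>2"
    using z by (intro mult_right_mono) (auto simp: power_le_one)
  ultimately have "(norm (\<Theta> z x))\<^sup>2 \<le> (norm x)\<^sup>2" by linarith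
  thus ?thesis by (rule power2_le_imp_le) simp
qed

text \<open>The derivative at z is \<open>C (I - z A)\<^sup>-\<^sup>2 B\<close>: two applications of the resolvent identity leave
  an error that is quadratic in \<open>w - z\<close>.\<close>

lemma transfer_holomorphic: "op_holomorphic_disc M N \<Theta>"
  unfolding op_holomorphic_disc_def
proof (intro ballI bexI allI impI)
  fix z :: complex assume "z \<in> ball 0 1"
  hence z: "cmod z < 1" by simp
  let ?A' = "\<lambda>x. C (R z (R z (B x)))"
  show "?A' \<in> bounded_op M N"
    by (intro bounded_op_compose[OF _ C_op] bounded_op_compose[OF _ R_op[OF z]] B_op)
  fix e :: real assume e: "0 < e"
  let ?r = "1 - cmod z"
  have r: "0 < ?r" using z by simp
  \<comment> \<open>\<open>d \<le> r / 2\<close> keeps \<open>1 - |w|\<close> above \<open>r / 2\<close>, so that the error is at most \<open>2 |w - z|\<^sup>2 \<parallel>x\<parallel> / r\<^sup>3\<close>\<close>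
  let ?d = "min (?r / 2) (e * ?r ^ 3 / 2)"
  show "\<exists>d>0. \<forall>w\<in>ball 0 1. cmod (w - z) < d \<longrightarrow>
      (\<forall>x\<in>M. norm (\<Theta> w x - \<Theta> z x - (w - z) *\<^sub>C ?A' x) \<le> e * cmod (w - z) * norm x)"
  proof (intro exI[of _ ?d] conjI ballI impI)
    show "0 < ?d" using r e by simp
    fix w x assume "w \<in> ball 0 1" and d: "cmod (w - z) < ?d" and x: "x \<in> M"
    hence w: "cmod w < 1" by simp
    have wr: "?r / 2 \<le> 1 - cmod w"
      using d norm_triangle_ineq[of z "w - z"] by (simp add: field_simps)
    let ?b = "B x"
    let ?v = "R z ?b"
    have b: "?b \<in> H" using bounded_opD(1)[OF B_op x] .
    have v: "?v \<in> H" using R_mem[OF z b] .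
    have Rwb: "R w ?b \<in> H" and Rwv: "R w ?v \<in> H" and Rzv: "R z ?v \<in> H"
      using R_mem[OF w] R_mem[OF z] b v by auto
    have "\<Theta> w x - \<Theta> z x = C (w *\<^sub>C R w ?b - z *\<^sub>C ?v)"
      using Rwb v closed_csubspaceD(6)[OF H]
      by (simp add: transfer_eq bounded_op_diff[OF C_op H] bounded_opD(3)[OF C_op])
    also have "\<dots> = (w - z) *\<^sub>C C (R w ?v)"
      using Rwv by (simp add: R_resolvent_identity(1)[OF w z b] bounded_opD(3)[OF C_op])
    finally have "\<Theta> w x - \<Theta> z x - (w - z) *\<^sub>C ?A' x = (w - z) *\<^sub>C C (R w ?v - R z ?v)"
      using Rwv Rzv by (simp add: bounded_op_diff[OF C_op H] complex_vector.scale_right_diff_distrib)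
    hence "norm (\<Theta> w x - \<Theta> z x - (w - z) *\<^sub>C ?A' x) = cmod (w - z) * norm (C (R w ?v - R z ?v))"
      by (simp add: norm_scaleC)
    also have "\<dots> \<le> cmod (w - z) * (e * norm x)"
    proof (intro mult_left_mono)
      have ARv: "A (R z ?v) \<in> H" using bounded_opD(1)[OF A_op Rzv] .
      have nv: "norm ?v \<le> norm x / ?r"
        using order_trans[OF R_le[OF z b] divide_right_mono[OF B_le[OF x]]] r by simp
      have "norm (C (R w ?v - R z ?v)) \<le> norm (R w ?v - R z ?v)"
        using C_le closed_csubspaceD(5)[OF H Rwv Rzv] .
      also have "\<dots> = cmod (w - z) * norm (R w (A (R z ?v)))"
        by (simp add: R_resolvent_identity(2)[OF w z v] norm_scaleC)
      also have "\<dots> \<le> cmod (w - z) * (norm x / ?r / ?r / (?r / 2))"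
      proof (intro mult_left_mono)
        have "norm (R w (A (R z ?v))) \<le> norm (A (R z ?v)) / (1 - cmod w)" by (rule R_le[OF w ARv])
        also have "\<dots> \<le> norm (A (R z ?v)) / (?r / 2)" using r wr by (intro divide_left_mono) auto
        also have "norm (A (R z ?v)) \<le> norm x / ?r / ?r"
          using A_le[OF Rzv] R_le[OF z v] divide_right_mono[OF nv, of ?r] r by linarith
        hence "norm (A (R z ?v)) / (?r / 2) \<le> norm x / ?r / ?r / (?r / 2)"
          using r by (intro divide_right_mono) auto
        finally show "norm (R w (A (R z ?v))) \<le> norm x / ?r / ?r / (?r / 2)" .
      qed simp
      also have "\<dots> \<le> (e * ?r ^ 3 / 2) * (norm x / ?r / ?r / (?r / 2))"
        using d r by (intro mult_right_mono) auto
      also have "\<dots> = e * norm x"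
      proof -
        have "(e * s ^ 3 / 2) * (a / s / s / (s / 2)) = e * a" if "0 < s" for s a :: real
          using that by (simp add: field_simps power3_eq_cube)
        from this[OF r] show ?thesis .
      qed
      finally show "norm (C (R w ?v - R z ?v)) \<le> e * norm x" .
    qed simp
    finally show "norm (\<Theta> w x - \<Theta> z x - (w - z) *\<^sub>C ?A' x) \<le> e * cmod (w - z) * norm x"
      by (simp add: mult_ac)
  qed
qed

lemma transfer_schur_class: "\<Theta> \<in> schur_class M N"
  unfolding schur_class_def contraction_def
  using transfer_holomorphic transfer_op transfer_le by auto

end

section \<open>Simplicity and unitary equivalence\<close>

lemma conservative_imp_system:
  "conservative H U \<Longrightarrow> conservative_system UNIV UNIV H U"
  by (simp add: conservative_def conservative_system_def closed_csubspace_UNIV)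

text \<open>The vectors orthogonal to all \<open>A\<^sup>k B x\<close> and \<open>A\<^sup>*\<^sup>l C\<^sup>* y\<close> form a set that U maps onto itself
  without input or output. Hence it suffices to exclude nonzero elements of such sets; adjoints
  and powers of A need not be computed for the system at hand.\<close>

lemma simple_systemI:
  assumes cons: "conservative H U"
    and no_unitary_part: "\<And>P. P \<subseteq> H \<Longrightarrow> (\<And>h. h \<in> P \<Longrightarrow> \<exists>h'\<in>P. U (0, h) = (0, h')) \<Longrightarrow>
      (\<And>h. h \<in> P \<Longrightarrow> \<exists>h'\<in>P. U (0, h') = (0, h)) \<Longrightarrow> P \<subseteq> {0}"
  shows "simple_system H U"
proof -
  interpret conservative_system UNIV UNIV H U using conservative_imp_system[OF cons] .
  let ?As = "adjoint_op H H A" and ?Cs = "adjoint_op H UNIV C"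
  let ?G = "(\<Union>k. range (\<lambda>x. (A ^^ k) (B x))) \<union> (\<Union>l. range (\<lambda>y. (?As ^^ l) (?Cs y)))"
  note As_op = adjoint_op_bounded[OF H H A_op] and Cs_op = adjoint_op_bounded[OF H N C_op]
  have AB: "(A ^^ k) (B x) \<in> H" for k x
    by (induction k) (simp_all add: bounded_opD(1)[OF A_op] bounded_opD(1)[OF B_op])
  have AC: "(?As ^^ l) (?Cs y) \<in> H" for l y
    by (induction l) (simp_all add: bounded_opD(1)[OF As_op] bounded_opD(1)[OF Cs_op])
  have inner: "cinner (U (x, h)) (U (x', h')) = cinner x x' + cinner h h'" if "h \<in> H" "h' \<in> H" for x x' h h'
    using unitary_opD(2)[OF U, of "(x, h)" "(x', h')"] that by (simp add: cinner_prod_def)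
  have zH: "0 \<in> H" using closed_csubspaceD(3)[OF H] .
  define P where "P = {h \<in> H. (\<forall>k x. cinner ((A ^^ k) (B x)) h = 0) \<and> (\<forall>l y. cinner ((?As ^^ l) (?Cs y)) h = 0)}"
  have PH: "h \<in> H" if "h \<in> P" for h using that by (simp add: P_def)
  have PB: "cinner ((A ^^ k) (B x)) h = 0" if "h \<in> P" for h k x using that by (simp add: P_def)
  have PC: "cinner ((?As ^^ l) (?Cs y)) h = 0" if "h \<in> P" for h l y using that by (simp add: P_def)
  have AP: "A h \<in> H" if "h \<in> H" for h using bounded_opD(1)[OF A_op that] .
  have C0: "C h = 0" if h: "h \<in> P" for h
  proof -
    have "cinner (?Cs (C h)) h = 0" using PC[OF h, of 0] by simp
    hence "cinner (C h) (C h) = 0"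
      using cinner_adjoint_op'[OF H N C_op PH[OF h], of "C h"] by simp
    thus ?thesis by (rule cinner_eq_0_imp)
  qed
  have fwd: "A h \<in> P" if h: "h \<in> P" for h
  proof -
    have Uh: "U (0, h) = (0, A h)" using U_0[OF PH[OF h]] C0[OF h] by simp
    have "cinner ((A ^^ k) (B x)) (A h) = 0" for k x
    proof (cases k)
      case 0
      have "cinner (U (x, 0)) (U (0, h)) = 0" using inner[OF zH PH[OF h]] by simp
      thus ?thesis using 0 by (simp add: Uh U_in cinner_prod_def)
    next
      case (Suc j)
      have "cinner (U (0, (A ^^ j) (B x))) (U (0, h)) = 0"
        using inner[OF AB PH[OF h]] PB[OF h] by simp
      thus ?thesis using Suc by (simp add: Uh U_0 AB cinner_prod_def)
    qed
    moreover have "cinner ((?As ^^ l) (?Cs y)) (A h) = 0" for l y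
      using PC[OF h, of "Suc l" y] cinner_adjoint_op'[OF H H A_op PH[OF h] AC[of l y]] by simp
    ultimately show ?thesis using AP[OF PH[OF h]] by (simp add: P_def)
  qed
  have bwd: "\<exists>h'\<in>P. U (0, h') = (0, h)" if h: "h \<in> P" for h
  proof -
    obtain x h' where xh: "h' \<in> H" "U (x, h') = (0, h)"
      using unitary_opD(4)[OF U, of "(0, h)"] PH[OF h] by auto
    \<comment> \<open>no input is needed to reach h, because h is orthogonal to the range of B\<close>
    have "cinner x x = cinner (U (x, 0)) (U (x, h'))" using inner[OF zH xh(1)] by simp
    also have "\<dots> = 0" using PB[OF h, of 0 x] by (simp add: xh(2) U_in cinner_prod_def)
    finally have x: "x = 0" by (rule cinner_eq_0_imp)
    have Uh': "U (0, h') = (0, h)" using xh(2) x by simp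
    hence Ch': "C h' = 0" and Ah': "A h' = h" using U_0[OF xh(1)] by auto
    have "cinner ((A ^^ k) (B x)) h' = 0" for k x
    proof -
      have "cinner ((A ^^ k) (B x)) h' = cinner (U (0, (A ^^ k) (B x))) (U (0, h'))"
        using inner[OF AB xh(1)] by simp
      also have "\<dots> = cinner ((A ^^ Suc k) (B x)) h"
        by (simp add: Uh' U_0 AB cinner_prod_def)
      finally show ?thesis using PB[OF h, of "Suc k" x] by simp
    qed
    moreover have "cinner ((?As ^^ l) (?Cs y)) h' = 0" for l y
    proof (cases l)
      case 0
      thus ?thesis using cinner_adjoint_op'[OF H N C_op xh(1), of y] Ch' by simp
    next
      case (Suc j)
      thus ?thesis using cinner_adjoint_op'[OF H H A_op xh(1) AC[of j y]] Ah' PC[OF h] by simp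
    qed
    ultimately have "h' \<in> P" using xh(1) by (simp add: P_def)
    thus ?thesis using Uh' by blast
  qed
  have "P \<subseteq> {0}"
  proof (rule no_unitary_part)
    show "\<exists>h'\<in>P. U (0, h) = (0, h')" if "h \<in> P" for h
      using fwd[OF that] U_0[OF PH[OF that]] C0[OF that] by auto
  qed (use PH bwd in auto)
  have "closure (cspan ?G) = H"
  proof (rule closure_cspan_eq[OF H])
    show "?G \<subseteq> H" using AB AC by blast
    fix h assume h: "h \<in> H" and orth: "\<And>s. s \<in> ?G \<Longrightarrow> cinner s h = 0"
    have "cinner ((A ^^ k) (B x)) h = 0" for k x by (rule orth) blast
    moreover have "cinner ((?As ^^ l) (?Cs y)) h = 0" for l y by (rule orth) blast
    ultimately have "h \<in> P" using h by (simp add: P_def)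
    thus "h = 0" using \<open>P \<subseteq> {0}\<close> by blast
  qed
  thus ?thesis by (simp add: simple_system_def)
qed

text \<open>Conjugacy is required of the block operators and not entry by entry: in this form it carries
  every closed loop \<open>(x, z h) \<mapsto> (y, h)\<close> of U to the loop \<open>(x, z V h) \<mapsto> (y, V h)\<close> of W, which
  gives equal transfer functions and takes states without input and output to such states.\<close>

locale conjugate_systems =
  S: conservative_system UNIV UNIV H U + S': conservative_system UNIV UNIV K W
  for H :: "'h::chilbert_space set" and U :: "'m::chilbert_space \<times> 'h \<Rightarrow> 'n::chilbert_space \<times> 'h"
    and K :: "'k::chilbert_space set" and W :: "'m \<times> 'k \<Rightarrow> 'n \<times> 'k" +
  fixes V
  assumes V: "unitary_op H K V" and conj: "\<And>x h. h \<in> H \<Longrightarrow> W (x, V h) = map_prod id V (U (x, h))"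
begin

lemma V_0: "V 0 = 0" using bounded_op_zero[OF unitary_opD(1)[OF V] S.H] .

lemma V_mem: "h \<in> H \<Longrightarrow> V h \<in> K" using bounded_opD(1)[OF unitary_opD(1)[OF V]] .

lemma V_inj: "inj_on V H" using unitary_op_inj_on[OF V S.H] .

lemma unitarily_equivalent: "unitarily_equivalent H U K W"
  unfolding unitarily_equivalent_def
proof (intro conjI exI[of _ V] ballI allI)
  have zH: "0 \<in> H" using closed_csubspaceD(3)[OF S.H] .
  show "sys_D U = sys_D W"
    using conj[OF zH] by (auto simp: sys_D_def fun_eq_iff V_0)
  show "unitary_op H K V" by (rule V)
  show "sys_A U h = the_inv_into H V (sys_A W (V h))" if "h \<in> H" for h
    using conj[OF that, of 0] the_inv_into_f_f[OF V_inj bounded_opD(1)[OF S.A_op that]]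
    by (simp add: sys_A_def)
  show "sys_B U x = the_inv_into H V (sys_B W x)" for x
    using conj[OF zH, of x] the_inv_into_f_f[OF V_inj bounded_opD(1)[OF S.B_op, of x]]
    by (simp add: sys_B_def V_0)
  show "sys_C U h = sys_C W (V h)" if "h \<in> H" for h
    using conj[OF that, of 0] by (simp add: sys_C_def)
qed

lemma transfer_function_eq:
  assumes z: "z \<in> ball 0 1"
  shows "transfer_function H U z = transfer_function K W z"
proof
  fix x
  have z': "cmod z < 1" using z by simp
  let ?h = "S.R z (S.B x)"
  have h: "?h \<in> H" using S.R_mem[OF z' bounded_opD(1)[OF S.B_op]] by simp
  have "W (x, z *\<^sub>C V ?h) = W (x, V (z *\<^sub>C ?h))"
    using bounded_opD(3)[OF unitary_opD(1)[OF V] h] by simp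
  also have "\<dots> = (transfer_function H U z x, V ?h)"
    using conj[OF closed_csubspaceD(6)[OF S.H h]] S.transfer_loop[OF z'] by simp
  finally show "transfer_function H U z x = transfer_function K W z x"
    using S'.transfer_unique(1)[OF z' _ V_mem[OF h]] by simp
qed

lemma no_unitary_part_transport:
  assumes no: "\<And>P. P \<subseteq> H \<Longrightarrow> (\<And>h. h \<in> P \<Longrightarrow> \<exists>h'\<in>P. U (0, h) = (0, h')) \<Longrightarrow>
      (\<And>h. h \<in> P \<Longrightarrow> \<exists>h'\<in>P. U (0, h') = (0, h)) \<Longrightarrow> P \<subseteq> {0}"
    and Q: "Q \<subseteq> K" "\<And>h. h \<in> Q \<Longrightarrow> \<exists>h'\<in>Q. W (0, h) = (0, h')" "\<And>h. h \<in> Q \<Longrightarrow> \<exists>h'\<in>Q. W (0, h') = (0, h)"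
  shows "Q \<subseteq> {0}"
proof -
  have loop: "U (0, h) = (0, h')" if h: "h \<in> H" and h': "h' \<in> H" and W: "W (0, V h) = (0, V h')" for h h'
  proof -
    have "U (0, h) \<in> UNIV \<times> H" using S.U_mem[OF _ h] by simp
    moreover have "map_prod id V (U (0, h)) = (0, V h')" using conj[OF h, of 0] W by simp
    ultimately show ?thesis using inj_onD[OF V_inj _ _ h'] by (cases "U (0, h)") auto
  qed
  let ?P = "{h \<in> H. V h \<in> Q}"
  have pre: "\<exists>h\<in>?P. V h = k" if "k \<in> Q" for k
    using unitary_opD(4)[OF V, of k] that Q(1) by auto
  have "?P \<subseteq> {0}"
  proof (rule no)
    fix h assume h: "h \<in> ?P"
    show "\<exists>h'\<in>?P. U (0, h) = (0, h')"
      using Q(2)[of "V h"] h pre loop by (metis (no_types, lifting) mem_Collect_eq)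
    show "\<exists>h'\<in>?P. U (0, h') = (0, h)"
      using Q(3)[of "V h"] h pre loop by (metis (no_types, lifting) mem_Collect_eq)
  qed simp
  thus ?thesis using pre V_0 by auto
qed

end

section \<open>One step of the Schur algorithm\<close>

lemma op_holomorphic_disc_tendsto:
  assumes hol: "op_holomorphic_disc K L \<Theta>" and x: "x \<in> K"
    and w: "\<And>n. w n \<in> ball 0 1" "w \<longlonglongrightarrow> z" and z: "z \<in> ball 0 1"
  shows "(\<lambda>n. \<Theta> (w n) x) \<longlonglongrightarrow> \<Theta> z x"
proof -
  obtain A where A: "\<forall>e>0. \<exists>d>0. \<forall>w\<in>ball 0 1. cmod (w - z) < d \<longrightarrow>
       (\<forall>x\<in>K. norm (\<Theta> w x - \<Theta> z x - (w - z) *\<^sub>C A x) \<le> e * cmod (w - z) * norm x)"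
    using hol z unfolding op_holomorphic_disc_def by blast
  obtain d where d: "d > 0" "\<forall>w\<in>ball 0 1. cmod (w - z) < d \<longrightarrow>
       (\<forall>x\<in>K. norm (\<Theta> w x - \<Theta> z x - (w - z) *\<^sub>C A x) \<le> 1 * cmod (w - z) * norm x)"
    using A zero_less_one by blast
  have wz: "(\<lambda>n. cmod (w n - z)) \<longlonglongrightarrow> 0" using tendsto_norm_zero[OF LIM_zero[OF w(2)]] .
  have "\<forall>\<^sub>F n in sequentially. norm (\<Theta> (w n) x - \<Theta> z x) \<le> cmod (w n - z) * (norm x + norm (A x))"
    using order_tendstoD(2)[OF wz d(1)]
  proof eventually_elim
    case (elim n)
    hence "norm (\<Theta> (w n) x - \<Theta> z x - (w n - z) *\<^sub>C A x) \<le> cmod (w n - z) * norm x"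
      using d(2) w(1) x by simp
    thus ?case
      using norm_triangle_ineq2[of "\<Theta> (w n) x - \<Theta> z x" "(w n - z) *\<^sub>C A x"]
      by (simp add: norm_scaleC distrib_left)
  qed
  moreover have "(\<lambda>n. cmod (w n - z) * (norm x + norm (A x))) \<longlonglongrightarrow> 0"
    using tendsto_mult_left_zero[OF wz] .
  ultimately have "(\<lambda>n. \<Theta> (w n) x - \<Theta> z x) \<longlonglongrightarrow> 0" by (rule Lim_null_comparison)
  thus ?thesis by (rule LIM_zero_cancel)
qed

context contraction_between
begin

context
  fixes \<Psi> and z :: complex
  assumes \<Psi>: "\<Psi> \<in> schur_class DD DDs" and z: "cmod z < 1"
begin

lemma \<Psi>_op: "\<Psi> z \<in> bounded_op DD DDs" and \<Psi>_le: "u \<in> DD \<Longrightarrow> norm (\<Psi> z u) \<le> norm u"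
  using \<Psi> z by (auto simp: schur_class_def contraction_def)

lemma perturbation_op: "(\<lambda>u. (- z) *\<^sub>C Ts (\<Psi> z u)) \<in> bounded_op DD DD"
proof -
  have "Ts \<in> bounded_op DDs DD"
    using subsetD[OF DDs_sub] Ts_DDs Ts_le bounded_opD(2,3)[OF Ts_op]
    by (intro bounded_opI[where B = 1]) auto
  thus ?thesis using bounded_op_scaleC_op[OF bounded_op_compose[OF \<Psi>_op] DD_closed] by blast
qed

lemma perturbation_le: "u \<in> DD \<Longrightarrow> norm ((- z) *\<^sub>C Ts (\<Psi> z u)) \<le> cmod z * norm u"
  using order_trans[OF Ts_le \<Psi>_le] bounded_opD(1)[OF \<Psi>_op] DDs_sub
  by (auto simp: norm_scaleC intro!: mult_left_mono)

lemma perturbation_minus: "u - (- z) *\<^sub>C Ts (\<Psi> z u) = u + z *\<^sub>C Ts (\<Psi> z u)"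
  by (simp add: complex_vector.scale_minus_left)

lemma step_operator_bij: "bij_betw (\<lambda>u. u + z *\<^sub>C Ts (\<Psi> z u)) DD DD"
  using bounded_op_perturbed_identity_bij(1)[OF DD_closed perturbation_op z perturbation_le]
  by (simp add: perturbation_minus)

lemma step_operator_lower:
  assumes "u \<in> DD" "v \<in> DD"
  shows "(1 - cmod z) * norm (u - v) \<le> norm ((u + z *\<^sub>C Ts (\<Psi> z u)) - (v + z *\<^sub>C Ts (\<Psi> z v)))"
proof -
  have "(1 - cmod z) * norm (u - v) \<le> norm ((u - v) - (- z) *\<^sub>C Ts (\<Psi> z (u - v)))"
    using bounded_op_perturbed_identity_bij(2)[OF DD_closed perturbation_op z perturbation_le
        closed_csubspaceD(5)[OF DD_closed assms]] .
  also have "(u - v) - (- z) *\<^sub>C Ts (\<Psi> z (u - v))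
      = (u - (- z) *\<^sub>C Ts (\<Psi> z u)) - (v - (- z) *\<^sub>C Ts (\<Psi> z v))"
    using bounded_op_diff[OF perturbation_op DD_closed assms] by simp
  finally show ?thesis by (simp only: perturbation_minus)
qed

end

lemma step_inverse_eq:
  assumes \<Psi>: "\<Psi> \<in> schur_class DD DDs" and z: "cmod z < 1"
    and u: "u \<in> DD" and eq: "u + z *\<^sub>C Ts (\<Psi> z u) = v"
  shows "the_inv_into DD (\<lambda>u. u + z *\<^sub>C Ts (\<Psi> z u)) v = u"
  using the_inv_into_f_f[of "\<lambda>u. u + z *\<^sub>C Ts (\<Psi> z u)" DD u] step_operator_bij[OF \<Psi> z] u eq
  by (simp add: bij_betw_def)

text \<open>Since \<open>D\<^sub>*\<close> is injective on the codefect space, the recursion determines \<open>\<Psi>(z)\<close>, for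
  \<open>z \<noteq> 0\<close>, on the vectors \<open>(I + z T\<^sup>* \<Psi>(z))\<^sup>-\<^sup>1 D x\<close>. They are dense in the defect space,
  because the vectors D x are and \<open>I + z T\<^sup>* \<Psi>(z)\<close> is a homeomorphism. The value at 0 follows by
  continuity.\<close>

lemma schur_step_unique:
  assumes 1: "schur_step K L T \<Theta> \<Psi>1" and 2: "schur_step K L T \<Theta> \<Psi>2"
    and z: "z \<in> ball 0 1" and v: "v \<in> DD"
  shows "\<Psi>1 z v = \<Psi>2 z v"
proof -
  have cls: "\<Psi>1 \<in> schur_class DD DDs" "\<Psi>2 \<in> schur_class DD DDs"
    using 1 2 by (auto simp: schur_step_def)
  have nonzero: "\<Psi>1 z v = \<Psi>2 z v" if z: "cmod z < 1" "z \<noteq> 0" and v: "v \<in> DD" for z v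
  proof -
    let ?F1 = "\<lambda>u. u + z *\<^sub>C Ts (\<Psi>1 z u)" and ?F2 = "\<lambda>u. u + z *\<^sub>C Ts (\<Psi>2 z u)"
    note b1 = step_operator_bij[OF cls(1) z(1)] and b2 = step_operator_bij[OF cls(2) z(1)]
    note p1 = \<Psi>_op[OF cls(1) z(1)] and p2 = \<Psi>_op[OF cls(2) z(1)]
    have agree: "\<exists>u\<in>DD. ?F1 u = D x \<and> \<Psi>1 z u = \<Psi>2 z u" if x: "x \<in> K" for x
    proof -
      obtain u where u: "u \<in> DD" "?F1 u = D x"
        using b1 D_mem[OF x] unfolding bij_betw_def by (metis (no_types, lifting) imageE)
      obtain w where w: "w \<in> DD" "?F2 w = D x"
        using b2 D_mem[OF x] unfolding bij_betw_def by (metis (no_types, lifting) imageE)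
      have "\<Theta> z x = T x + z *\<^sub>C Ds (\<Psi>1 z u)"
        using 1 z(1) x step_inverse_eq[OF cls(1) z(1) u] by (simp add: schur_step_def)
      moreover have "\<Theta> z x = T x + z *\<^sub>C Ds (\<Psi>2 z w)"
        using 2 z(1) x step_inverse_eq[OF cls(2) z(1) w] by (simp add: schur_step_def)
      ultimately have "z *\<^sub>C Ds (\<Psi>1 z u) = z *\<^sub>C Ds (\<Psi>2 z w)" by (metis add_left_cancel)
      hence Ds: "Ds (\<Psi>1 z u) = Ds (\<Psi>2 z w)" using z(2) complex_vector.scale_left_imp_eq by blast
      have m: "\<Psi>1 z u \<in> DDs" "\<Psi>2 z w \<in> DDs" using bounded_opD(1)[OF p1 u(1)] bounded_opD(1)[OF p2 w(1)] .
      have "Ds (\<Psi>1 z u - \<Psi>2 z w) = 0"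
        using bounded_op_diff[OF Ds_op L, of "\<Psi>1 z u" "\<Psi>2 z w"] m DDs_sub Ds by auto
      hence "\<Psi>1 z u - \<Psi>2 z w = 0" using Ds_eq_0_imp[OF closed_csubspaceD(5)[OF DDs_closed m]] by blast
      hence eq: "\<Psi>1 z u = \<Psi>2 z w" by simp
      hence "u = w" using u(2) w(2) by (metis add_right_cancel)
      thus ?thesis using u eq by blast
    qed
    have Fv: "?F1 v \<in> closure (D ` K)"
      using b1 v unfolding bij_betw_def defect_space_def by blast
    then obtain f where f: "\<And>n. f n \<in> D ` K" "f \<longlonglongrightarrow> ?F1 v" unfolding closure_sequential by blast
    have "\<exists>u\<in>DD. ?F1 u = f n \<and> \<Psi>1 z u = \<Psi>2 z u" for n using f(1)[of n] agree by auto
    then obtain u where u: "\<And>n. u n \<in> DD" "\<And>n. ?F1 (u n) = f n" "\<And>n. \<Psi>1 z (u n) = \<Psi>2 z (u n)"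
      by metis
    have "(\<lambda>n. u n - v) \<longlonglongrightarrow> 0"
    proof (rule Lim_null_comparison)
      show "(\<lambda>n. norm (f n - ?F1 v) / (1 - cmod z)) \<longlonglongrightarrow> 0"
        using tendsto_divide_zero[OF tendsto_norm_zero[OF LIM_zero[OF f(2)]]] .
      have "norm (u n - v) \<le> norm (f n - ?F1 v) / (1 - cmod z)" for n
        using step_operator_lower[OF cls(1) z(1) u(1) v, of n] z(1)
        by (simp add: u(2) pos_le_divide_eq mult.commute)
      thus "\<forall>\<^sub>F n in sequentially. norm (u n - v) \<le> norm (f n - ?F1 v) / (1 - cmod z)" by simp
    qed
    hence uv: "u \<longlonglongrightarrow> v" by (rule LIM_zero_cancel)
    have "(\<lambda>n. \<Psi>1 z (u n)) \<longlonglongrightarrow> \<Psi>1 z v" by (rule bounded_op_tendsto[OF p1 DD_closed u(1) uv v])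
    moreover have "(\<lambda>n. \<Psi>2 z (u n)) \<longlonglongrightarrow> \<Psi>2 z v" by (rule bounded_op_tendsto[OF p2 DD_closed u(1) uv v])
    ultimately show ?thesis using LIMSEQ_unique by (simp add: u(3))
  qed
  show ?thesis
  proof (cases "z = 0")
    case True
    let ?w = "\<lambda>n. of_real (1 / real (Suc (Suc n))) :: complex"
    have w: "?w n \<in> ball 0 1" "?w n \<noteq> 0" for n
      unfolding mem_ball dist_0_norm norm_of_real of_real_eq_0_iff by simp_all
    have "(\<lambda>n. 1 / real (Suc (Suc n))) \<longlonglongrightarrow> 0" by (intro LIMSEQ_Suc lim_1_over_n)
    from tendsto_of_real[OF this, where 'a = complex]
    have w0: "?w \<longlonglongrightarrow> 0" by (simp only: of_real_0)
    have hol: "op_holomorphic_disc DD DDs \<Psi>1" "op_holomorphic_disc DD DDs \<Psi>2"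
      using cls by (simp_all add: schur_class_def)
    have 0: "(0::complex) \<in> ball 0 1" by simp
    have "(\<lambda>n. \<Psi>1 (?w n) v) \<longlonglongrightarrow> \<Psi>1 0 v"
      by (rule op_holomorphic_disc_tendsto[OF hol(1) v w(1) w0 0])
    moreover have "(\<lambda>n. \<Psi>2 (?w n) v) \<longlonglongrightarrow> \<Psi>2 0 v"
      by (rule op_holomorphic_disc_tendsto[OF hol(2) v w(1) w0 0])
    moreover have "\<Psi>1 (?w n) v = \<Psi>2 (?w n) v" for n
      using nonzero[OF _ w(2) v] w(1)[of n] by (simp only: mem_ball dist_0_norm)
    ultimately have "\<Psi>1 0 v = \<Psi>2 0 v" using LIMSEQ_unique by (simp only:) blast
    thus ?thesis using True by simp
  next
    case False
    thus ?thesis using nonzero z v by simp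
  qed
qed

end

section \<open>Orthogonal sums\<close>

definition ell2_sum :: "(nat \<Rightarrow> 'a::chilbert_space set) \<Rightarrow> 'a ell2 set" where
  "ell2_sum S = {f. \<forall>n. ell2_nth f n \<in> S n}"

lemma ell2_sumD: "f \<in> ell2_sum S \<Longrightarrow> ell2_nth f n \<in> S n"
  by (simp add: ell2_sum_def)

lemma bounded_linear_ell2_nth: "bounded_linear (\<lambda>f. ell2_nth f n)"
  by (rule bounded_linear_intro[where K = 1])
    (auto simp: plus_ell2.rep_eq scaleR_ell2.rep_eq norm_ell2_nth_le)

lemma closed_csubspace_ell2_sum:
  assumes S: "\<And>n. closed_csubspace (S n)"
  shows "closed_csubspace (ell2_sum S)"
  unfolding closed_csubspace_def
proof
  show "csubspace (ell2_sum S)"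
    using closed_csubspaceD[OF S] unfolding complex_vector.subspace_def ell2_sum_def
    by (simp add: zero_ell2.rep_eq plus_ell2.rep_eq scaleC_ell2.rep_eq)
  show "closed (ell2_sum S)"
    unfolding closed_sequential_limits
  proof (intro allI impI)
    fix f g assume fg: "(\<forall>k. f k \<in> ell2_sum S) \<and> f \<longlonglongrightarrow> g"
    have "ell2_nth g n \<in> S n" for n
    proof (rule closed_sequentially[OF closed_csubspaceD(2)[OF S]])
      show "ell2_nth (f k) n \<in> S n" for k using fg ell2_sumD by blast
      show "(\<lambda>k. ell2_nth (f k) n) \<longlonglongrightarrow> ell2_nth g n"
        using fg bounded_linear.tendsto[OF bounded_linear_ell2_nth] by blast
    qed
    thus "g \<in> ell2_sum S" by (simp add: ell2_sum_def)
  qed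
qed

lemma ell2_nth_Abs_sums:
  assumes "(\<lambda>n. (norm (F n))\<^sup>2) sums s"
  shows "ell2_nth (Abs_ell2 F) = F" "(norm (Abs_ell2 F))\<^sup>2 = s"
proof -
  show *: "ell2_nth (Abs_ell2 F) = F"
    using sums_summable[OF assms] by (simp add: Abs_ell2_inverse)
  show "(norm (Abs_ell2 F))\<^sup>2 = s"
    unfolding norm_ell2_sq * using sums_unique[OF assms] by simp
qed

lemma norm_ell2_sums: "(\<lambda>n. (norm (ell2_nth f n))\<^sup>2) sums (norm f)\<^sup>2"
  unfolding norm_ell2_sq by (rule summable_sums[OF summable_ell2])

lemma unitary_dsum_op:
  assumes T: "\<And>n. unitary_op (S n) (R n) (T n)" and S: "\<And>n. closed_csubspace (S n)"
  shows ell2_nth_dsum_op: "f \<in> ell2_sum S \<Longrightarrow> ell2_nth (dsum_op T f) n = T n (ell2_nth f n)"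
    and "unitary_op (ell2_sum S) (ell2_sum R) (dsum_op T)"
proof -
  note op = unitary_opD(1)[OF T]
  have sums: "(\<lambda>n. (norm (T n (ell2_nth f n)))\<^sup>2) sums (norm f)\<^sup>2" if "f \<in> ell2_sum S" for f
    using norm_ell2_sums[of f] unitary_opD(3)[OF T ell2_sumD[OF that]] by simp
  show nth: "ell2_nth (dsum_op T f) n = T n (ell2_nth f n)" if "f \<in> ell2_sum S" for f n
    unfolding dsum_op_def by (simp add: ell2_nth_Abs_sums(1)[OF sums[OF that]])
  have norm: "norm (dsum_op T f) = norm f" if "f \<in> ell2_sum S" for f
    using ell2_nth_Abs_sums(2)[OF sums[OF that]] by (simp add: dsum_op_def)
  note sum = closed_csubspace_ell2_sum[OF S]
  show "unitary_op (ell2_sum S) (ell2_sum R) (dsum_op T)"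
  proof (rule unitary_opI[OF _ sum norm])
    show "dsum_op T \<in> bounded_op (ell2_sum S) (ell2_sum R)"
    proof (rule bounded_opI[where B = 1])
      show "dsum_op T f \<in> ell2_sum R" if "f \<in> ell2_sum S" for f
        using that bounded_opD(1)[OF op ell2_sumD[OF that]] by (simp add: ell2_sum_def[of R] nth)
      show "dsum_op T (f + g) = dsum_op T f + dsum_op T g" if "f \<in> ell2_sum S" "g \<in> ell2_sum S" for f g
        using that closed_csubspaceD(4)[OF sum that] bounded_opD(2)[OF op ell2_sumD[OF that(1)] ell2_sumD[OF that(2)]]
        by (intro ell2_eqI) (simp add: nth plus_ell2.rep_eq)
      show "dsum_op T (c *\<^sub>C f) = c *\<^sub>C dsum_op T f" if "f \<in> ell2_sum S" for c f
        using that closed_csubspaceD(6)[OF sum that] bounded_opD(3)[OF op ell2_sumD[OF that]]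
        by (intro ell2_eqI) (simp add: nth scaleC_ell2.rep_eq)
    qed (simp add: norm)
    fix g assume g: "g \<in> ell2_sum R"
    have "\<forall>n. \<exists>x\<in>S n. T n x = ell2_nth g n" using unitary_opD(4)[OF T ell2_sumD[OF g]] by blast
    then obtain F where F: "\<And>n. F n \<in> S n" "\<And>n. T n (F n) = ell2_nth g n" by metis
    have "norm (F n) = norm (ell2_nth g n)" for n using unitary_opD(3)[OF T F(1)] F(2) by metis
    hence "(\<lambda>n. (norm (F n))\<^sup>2) sums (norm g)\<^sup>2" using norm_ell2_sums[of g] by simp
    note Abs = ell2_nth_Abs_sums(1)[OF this]
    have mem: "Abs_ell2 F \<in> ell2_sum S" using F(1) by (simp add: ell2_sum_def Abs)
    moreover have "dsum_op T (Abs_ell2 F) = g" by (intro ell2_eqI) (simp add: nth[OF mem] Abs F(2))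
    ultimately show "\<exists>f\<in>ell2_sum S. dsum_op T f = g" by blast
  qed
qed

lemma unitary_map_prod_id:
  assumes V: "unitary_op H K V" and M: "closed_csubspace M" and H: "closed_csubspace H"
  shows "unitary_op (M \<times> H) (M \<times> K) (map_prod id V)"
proof (rule unitary_opI)
  note op = unitary_opD(1)[OF V]
  show norm: "norm (map_prod id V p) = norm p" if "p \<in> M \<times> H" for p
    using that unitary_opD(3)[OF V] by (auto simp: norm_Pair)
  show "map_prod id V \<in> bounded_op (M \<times> H) (M \<times> K)"
    by (rule bounded_opI[where B = 1])
      (use norm bounded_opD[OF op] in \<open>auto simp: scaleC_prod_def\<close>)
  show "closed_csubspace (M \<times> H)" by (rule closed_csubspace_Times[OF M H])
  show "\<exists>p\<in>M \<times> H. map_prod id V p = q" if "q \<in> M \<times> K" for q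
    using that unitary_opD(4)[OF V] by force
qed

section \<open>The regroupings of summands\<close>

lemma ell2_pair_sums:
  fixes f :: "('a::complex_inner \<times> 'b::complex_inner) ell2"
  obtains a b where "(\<lambda>n. (norm (fst (ell2_nth f n)))\<^sup>2) sums a"
    "(\<lambda>n. (norm (snd (ell2_nth f n)))\<^sup>2) sums b" "(norm f)\<^sup>2 = a + b"
proof -
  have sq: "(norm (ell2_nth f n))\<^sup>2 = (norm (fst (ell2_nth f n)))\<^sup>2 + (norm (snd (ell2_nth f n)))\<^sup>2" for n
    by (simp add: norm_prod_def)
  have s: "summable (\<lambda>n. (norm (fst (ell2_nth f n)))\<^sup>2)" "summable (\<lambda>n. (norm (snd (ell2_nth f n)))\<^sup>2)"
    by (rule summable_comparison_test'[OF summable_ell2[of f]], simp add: sq)+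
  show thesis
  proof (rule that[OF summable_sums[OF s(1)] summable_sums[OF s(2)]])
    show "(norm f)\<^sup>2 = (\<Sum>n. (norm (fst (ell2_nth f n)))\<^sup>2) + (\<Sum>n. (norm (snd (ell2_nth f n)))\<^sup>2)"
      unfolding norm_ell2_sq sq by (rule suminf_add[OF s, symmetric])
  qed
qed

lemma shift_in:
  shows ell2_nth_shift_in: "ell2_nth (shift_in (x, f)) n
      = (case n of 0 \<Rightarrow> x | Suc k \<Rightarrow> snd (ell2_nth f k), fst (ell2_nth f n))"
    and norm_shift_in: "norm (shift_in (x, f)) = norm (x, f)"
proof -
  let ?F = "\<lambda>n. (case n of 0 \<Rightarrow> x | Suc k \<Rightarrow> snd (ell2_nth f k), fst (ell2_nth f n))"
  obtain a b where ab: "(\<lambda>n. (norm (fst (ell2_nth f n)))\<^sup>2) sums a"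
    "(\<lambda>n. (norm (snd (ell2_nth f n)))\<^sup>2) sums b" "(norm f)\<^sup>2 = a + b" by (rule ell2_pair_sums)
  have "(\<lambda>n. (norm (case n of 0 \<Rightarrow> x | Suc k \<Rightarrow> snd (ell2_nth f k)))\<^sup>2) sums (b + (norm x)\<^sup>2)"
    using sums_Suc[of "\<lambda>n. (norm (case n of 0 \<Rightarrow> x | Suc k \<Rightarrow> snd (ell2_nth f k)))\<^sup>2" b] ab(2) by simp
  from sums_add[OF this ab(1)] have F: "(\<lambda>n. (norm (?F n))\<^sup>2) sums (b + (norm x)\<^sup>2 + a)"
    by (simp add: norm_Pair)
  show "ell2_nth (shift_in (x, f)) n = ?F n"
    using ell2_nth_Abs_sums(1)[OF F] by (simp add: shift_in_def)
  have "(norm (x, f))\<^sup>2 = (norm x)\<^sup>2 + (norm f)\<^sup>2" by (simp add: norm_prod_def)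
  hence "(norm (shift_in (x, f)))\<^sup>2 = (norm (x, f))\<^sup>2"
    using ell2_nth_Abs_sums(2)[OF F] ab(3) by (simp add: shift_in_def)
  thus "norm (shift_in (x, f)) = norm (x, f)" by simp
qed

lemma ell2_nth_shift_out:
  "ell2_nth (snd (shift_out g)) n = (snd (ell2_nth g n), fst (ell2_nth g (Suc n)))"
proof -
  obtain a b where ab: "(\<lambda>n. (norm (fst (ell2_nth g n)))\<^sup>2) sums a"
    "(\<lambda>n. (norm (snd (ell2_nth g n)))\<^sup>2) sums b" by (rule ell2_pair_sums)
  have "(\<lambda>n. (norm (fst (ell2_nth g (Suc n))))\<^sup>2) sums (a - (norm (fst (ell2_nth g 0)))\<^sup>2)"
    using ab(1) by (subst sums_Suc_iff) simp
  from sums_add[OF ab(2) this]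
  have "(\<lambda>n. (norm (snd (ell2_nth g n), fst (ell2_nth g (Suc n))))\<^sup>2) sums
      (b + (a - (norm (fst (ell2_nth g 0)))\<^sup>2))" by (simp add: norm_Pair)
  from ell2_nth_Abs_sums(1)[OF this] show ?thesis by (simp add: shift_out_def)
qed

lemma fst_shift_out: "fst (shift_out g) = fst (ell2_nth g 0)"
  by (simp add: shift_out_def)

lemma shift_in_out: "shift_in (shift_out g) = g"
proof (rule ell2_eqI)
  fix n
  have eq: "shift_out g = (fst (ell2_nth g 0), snd (shift_out g))"
    by (simp add: fst_shift_out[symmetric])
  show "ell2_nth (shift_in (shift_out g)) n = ell2_nth g n"
    by (subst eq, cases n) (simp_all add: ell2_nth_shift_in ell2_nth_shift_out)
qed

lemma shift_out_in: "shift_out (shift_in (x, f)) = (x, f)"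
proof (rule prod_eqI)
  show "fst (shift_out (shift_in (x, f))) = fst (x, f)"
    by (simp add: fst_shift_out ell2_nth_shift_in)
  show "snd (shift_out (shift_in (x, f))) = snd (x, f)"
    by (rule ell2_eqI) (simp add: ell2_nth_shift_out ell2_nth_shift_in)
qed

lemma shift_in_mem:
  assumes "x \<in> Q 0" "f \<in> ell2_sum (\<lambda>n. P n \<times> Q (Suc n))"
  shows "shift_in (x, f) \<in> ell2_sum (\<lambda>n. Q n \<times> P n)"
  using assms(1) ell2_sumD[OF assms(2)]
  by (auto simp: ell2_sum_def ell2_nth_shift_in mem_Times_iff split: nat.split)

lemma shift_out_mem:
  assumes "g \<in> ell2_sum (\<lambda>n. Q n \<times> P n)"
  shows "shift_out g \<in> Q 0 \<times> ell2_sum (\<lambda>n. P n \<times> Q (Suc n))"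
  using ell2_sumD[OF assms] by (auto simp: mem_Times_iff fst_shift_out ell2_sum_def ell2_nth_shift_out)

lemma unitary_shift_in:
  assumes P: "\<And>n. closed_csubspace (P n)" and Q: "\<And>n. closed_csubspace (Q n)"
  shows "unitary_op (Q 0 \<times> ell2_sum (\<lambda>n. P n \<times> Q (Suc n))) (ell2_sum (\<lambda>n. Q n \<times> P n)) shift_in"
proof (rule unitary_opI)
  show "shift_in \<in> bounded_op (Q 0 \<times> ell2_sum (\<lambda>n. P n \<times> Q (Suc n))) (ell2_sum (\<lambda>n. Q n \<times> P n))"
  proof (rule bounded_opI[where B = 1])
    show "shift_in p \<in> ell2_sum (\<lambda>n. Q n \<times> P n)" if "p \<in> Q 0 \<times> ell2_sum (\<lambda>n. P n \<times> Q (Suc n))" for p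
      using that shift_in_mem[of _ Q] by auto
    show "shift_in (p + q) = shift_in p + shift_in q" for p q :: "'b \<times> ('a \<times> 'b) ell2"
      by (cases p; cases q) (auto intro!: ell2_eqI simp: ell2_nth_shift_in plus_ell2.rep_eq split: nat.split)
    show "shift_in (c *\<^sub>C p) = c *\<^sub>C shift_in p" for c and p :: "'b \<times> ('a \<times> 'b) ell2"
      by (cases p) (auto intro!: ell2_eqI simp: ell2_nth_shift_in scaleC_ell2.rep_eq scaleC_prod_def
          split: nat.split)
  qed (auto simp: norm_shift_in)
  show "closed_csubspace (Q 0 \<times> ell2_sum (\<lambda>n. P n \<times> Q (Suc n)))"
    by (intro closed_csubspace_Times closed_csubspace_ell2_sum P Q)
  show "\<exists>p\<in>Q 0 \<times> ell2_sum (\<lambda>n. P n \<times> Q (Suc n)). shift_in p = g" if "g \<in> ell2_sum (\<lambda>n. Q n \<times> P n)" for g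
    by (rule bexI[where x = "shift_out g"], rule shift_in_out, rule shift_out_mem[OF that])
qed (auto simp: norm_shift_in)

lemma unitary_shift_out:
  assumes P: "\<And>n. closed_csubspace (P n)" and Q: "\<And>n. closed_csubspace (Q n)"
  shows "unitary_op (ell2_sum (\<lambda>n. Q n \<times> P n)) (Q 0 \<times> ell2_sum (\<lambda>n. P n \<times> Q (Suc n))) shift_out"
proof (rule unitary_opI)
  show norm: "norm (shift_out g) = norm g" for g :: "('b \<times> 'a) ell2"
    using norm_shift_in[of "fst (shift_out g)" "snd (shift_out g)"] by (simp add: shift_in_out)
  show "shift_out \<in> bounded_op (ell2_sum (\<lambda>n. Q n \<times> P n)) (Q 0 \<times> ell2_sum (\<lambda>n. P n \<times> Q (Suc n)))"
  proof (rule bounded_opI[where B = 1])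
    show "shift_out g \<in> Q 0 \<times> ell2_sum (\<lambda>n. P n \<times> Q (Suc n))" if "g \<in> ell2_sum (\<lambda>n. Q n \<times> P n)" for g
      by (rule shift_out_mem[OF that])
    show "shift_out (f + g) = shift_out f + shift_out g" for f g :: "('b \<times> 'a) ell2"
      by (rule prod_eqI) (auto intro!: ell2_eqI simp: fst_shift_out ell2_nth_shift_out plus_ell2.rep_eq)
    show "shift_out (c *\<^sub>C f) = c *\<^sub>C shift_out f" for c and f :: "('b \<times> 'a) ell2"
      by (rule prod_eqI)
        (auto intro!: ell2_eqI simp: fst_shift_out ell2_nth_shift_out scaleC_ell2.rep_eq scaleC_prod_def)
  qed (simp add: norm)
  show "closed_csubspace (ell2_sum (\<lambda>n. Q n \<times> P n))"
    by (intro closed_csubspace_Times closed_csubspace_ell2_sum P Q)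
  show "\<exists>g\<in>ell2_sum (\<lambda>n. Q n \<times> P n). shift_out g = p" if pm: "p \<in> Q 0 \<times> ell2_sum (\<lambda>n. P n \<times> Q (Suc n))" for p
  proof -
    obtain x f where p: "p = (x, f)" "x \<in> Q 0" "f \<in> ell2_sum (\<lambda>n. P n \<times> Q (Suc n))"
      using pm by (cases p) auto
    show ?thesis unfolding p(1)
      by (rule bexI[where x = "shift_in (x, f)"], rule shift_out_in, rule shift_in_mem[of _ Q, OF p(2,3)])
  qed
qed

section \<open>Block operator CMV matrices\<close>

declare par_dom.simps [simp del] par_cod.simps [simp del]

locale cmv =
  fixes \<Gamma> :: "nat \<Rightarrow> 'm::chilbert_space \<Rightarrow> 'n::chilbert_space"
  assumes choice_sequence: "choice_sequence \<Gamma>"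
begin

lemma contraction_\<Gamma>: "contraction (par_dom \<Gamma> n) (par_cod \<Gamma> n) (\<Gamma> n)"
  using choice_sequence by (simp add: choice_sequence_def)

lemma closed_par: "closed_csubspace (par_dom \<Gamma> n) \<and> closed_csubspace (par_cod \<Gamma> n)"
proof (induction n)
  case (Suc n)
  interpret contraction_between "par_dom \<Gamma> n" "par_cod \<Gamma> n" "\<Gamma> n"
    using Suc contraction_\<Gamma> by unfold_locales auto
  show ?case using DD_closed DDs_closed by (simp add: par_dom.simps par_cod.simps)
qed (simp add: par_dom.simps par_cod.simps closed_csubspace_UNIV)

lemmas closed_dom = closed_par[THEN conjunct1] and closed_cod = closed_par[THEN conjunct2]

lemma contraction_between_\<Gamma>: "contraction_between (par_dom \<Gamma> n) (par_cod \<Gamma> n) (\<Gamma> n)"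
  by unfold_locales (rule closed_dom closed_cod contraction_\<Gamma>)+

lemma unitary_rotation:
  "unitary_op (par_dom \<Gamma> n \<times> par_cod \<Gamma> (Suc n)) (par_cod \<Gamma> n \<times> par_dom \<Gamma> (Suc n)) (rotation \<Gamma> n)"
  unfolding rotation_def par_dom.simps par_cod.simps
  by (rule contraction_between.unitary_J[OF contraction_between_\<Gamma>])

text \<open>W n is the direct sum of every second rotation from the n-th one on. Then
  \<open>\<L>\<^sub>0\<close> and \<open>\<V>\<^sub>0\<close> are W 0, up to regrouping, and W 1. Keeping n free gives the same matrix
  for the sequence with its first n parameters removed, whose entries live on subspaces.\<close>

definition X :: "nat \<Rightarrow> ('m \<times> 'n) ell2 set" where
  "X n = ell2_sum (\<lambda>k. par_dom \<Gamma> (n + 2*k) \<times> par_cod \<Gamma> (Suc (n + 2*k)))"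

definition Y :: "nat \<Rightarrow> ('n \<times> 'm) ell2 set" where
  "Y n = ell2_sum (\<lambda>k. par_cod \<Gamma> (n + 2*k) \<times> par_dom \<Gamma> (Suc (n + 2*k)))"

definition W :: "nat \<Rightarrow> ('m \<times> 'n) ell2 \<Rightarrow> ('n \<times> 'm) ell2" where
  "W n = dsum_op (\<lambda>k. rotation \<Gamma> (n + 2*k))"

definition L :: "nat \<Rightarrow> 'm \<times> ('n \<times> 'm) ell2 \<Rightarrow> 'n \<times> ('m \<times> 'n) ell2" where
  "L n = shift_out \<circ> W n \<circ> shift_in"

definition U :: "nat \<Rightarrow> 'm \<times> ('m \<times> 'n) ell2 \<Rightarrow> 'n \<times> ('m \<times> 'n) ell2" where
  "U n = L n \<circ> map_prod id (W (Suc n))"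

lemma closed_X: "closed_csubspace (X n)" and closed_Y: "closed_csubspace (Y n)"
  unfolding X_def Y_def by (intro closed_csubspace_ell2_sum closed_csubspace_Times closed_dom closed_cod)+

lemma unitary_W: "unitary_op (X n) (Y n) (W n)"
  unfolding X_def Y_def W_def
  by (intro unitary_dsum_op(2) unitary_rotation closed_csubspace_Times closed_dom closed_cod)

lemma ell2_nth_W: "f \<in> X n \<Longrightarrow> ell2_nth (W n f) k = rotation \<Gamma> (n + 2*k) (ell2_nth f k)"
  unfolding X_def W_def
  by (rule unitary_dsum_op(1)[OF unitary_rotation])
    (intro closed_csubspace_Times closed_dom closed_cod)

lemma unitary_in: "unitary_op (par_dom \<Gamma> n \<times> Y (Suc n)) (X n) shift_in"
  using unitary_shift_in[of "\<lambda>k. par_cod \<Gamma> (Suc (n + 2*k))" "\<lambda>k. par_dom \<Gamma> (n + 2*k)"]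
  by (simp add: X_def Y_def closed_dom closed_cod)

lemma unitary_out: "unitary_op (Y n) (par_cod \<Gamma> n \<times> X (Suc n)) shift_out"
  using unitary_shift_out[of "\<lambda>k. par_dom \<Gamma> (Suc (n + 2*k))" "\<lambda>k. par_cod \<Gamma> (n + 2*k)"]
  by (simp add: X_def Y_def closed_dom closed_cod)

lemma unitary_L: "unitary_op (par_dom \<Gamma> n \<times> Y (Suc n)) (par_cod \<Gamma> n \<times> X (Suc n)) (L n)"
  unfolding L_def
  by (rule unitary_op_compose[OF unitary_in unitary_op_compose[OF unitary_W unitary_out], unfolded o_assoc])

lemma unitary_U: "unitary_op (par_dom \<Gamma> n \<times> X (Suc n)) (par_cod \<Gamma> n \<times> X (Suc n)) (U n)"
  unfolding U_def
  by (rule unitary_op_compose[OF unitary_map_prod_id[OF unitary_W closed_dom closed_X] unitary_L])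

sublocale S: conservative_system "par_dom \<Gamma> n" "par_cod \<Gamma> n" "X (Suc n)" "U n" for n
  by unfold_locales (rule closed_dom closed_cod closed_X unitary_U)+

lemma cmv_H_eq: "cmv_H \<Gamma> = X 1" and cmv_Ht_eq: "cmv_Ht \<Gamma> = Y 1"
  by (simp_all add: cmv_H_def cmv_Ht_def X_def Y_def ell2_sum_def)

lemma cmv_L_eq: "cmv_L \<Gamma> = L 0" and cmv_V_eq: "cmv_V \<Gamma> = W 1"
  by (simp_all add: cmv_L_def cmv_V_def L_def W_def)

lemma cmv_U_eq: "cmv_U \<Gamma> = U 0" and cmv_Ut_eq: "cmv_Ut \<Gamma> = map_prod id (W 1) \<circ> L 0"
  by (simp_all add: cmv_U_def cmv_Ut_def U_def cmv_L_eq cmv_V_eq)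

lemma conservative_cmv_U: "conservative (X 1) (U 0)"
  using unitary_U[of 0] closed_X by (simp add: conservative_def par_dom.simps par_cod.simps)

lemma conservative_cmv_Ut: "conservative (Y 1) (map_prod id (W 1) \<circ> L 0)"
  using unitary_op_compose[OF unitary_L[of 0] unitary_map_prod_id[OF unitary_W[of "Suc 0"], of "par_cod \<Gamma> 0"]]
  by (simp add: conservative_def par_dom.simps par_cod.simps closed_Y closed_X closed_csubspace_UNIV)

sublocale E: conjugate_systems "X 1" "U 0" "Y 1" "map_prod id (W 1) \<circ> L 0" "W 1"
proof (intro conjugate_systems.intro conjugate_systems_axioms.intro)
  show "(map_prod id (W 1) \<circ> L 0) (x, W 1 h) = map_prod id (W 1) (U 0 (x, h))" for x h
    by (simp add: U_def)
qed (rule conservative_imp_system conservative_cmv_U conservative_cmv_Ut unitary_W)+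

section \<open>Schur parameters and simplicity of CMV matrices\<close>

lemma rotation_apply:
  "rotation \<Gamma> n (x, y) = (\<Gamma> n x + codefect (par_dom \<Gamma> n) (par_cod \<Gamma> n) (\<Gamma> n) y,
     defect (par_dom \<Gamma> n) (par_cod \<Gamma> n) (\<Gamma> n) x - adjoint_op (par_dom \<Gamma> n) (par_cod \<Gamma> n) (\<Gamma> n) y)"
  by (simp add: rotation_def elementary_rotation_def)

text \<open>If U n closes the loop \<open>(x, z h) \<mapsto> (y, h)\<close> and \<open>g = W (n+1) h\<close>, then g without its first
  component c is a state \<open>h'\<close> for U (n+1). With \<open>(y, a) = J (x, z c)\<close> one has
  \<open>h = shift_in (a, W (n+2) (z h'))\<close>, because the tail of \<open>shift_in (x, z g)\<close> is \<open>z h'\<close>. Applying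
  W (n+1) returns g, so U (n+1) closes the loop \<open>(a, z h') \<mapsto> (c, h')\<close>.\<close>

lemma transfer_peel:
  assumes z: "cmod z < 1" and x: "x \<in> par_dom \<Gamma> n"
  obtains a c where "a \<in> par_dom \<Gamma> (Suc n)" "c \<in> par_cod \<Gamma> (Suc n)"
    "rotation \<Gamma> n (x, z *\<^sub>C c) = (transfer_function (X (Suc n)) (U n) z x, a)"
    "transfer_function (X (Suc (Suc n))) (U (Suc n)) z a = c"
proof -
  define h where "h = S.R n z (sys_B (U n) x)"
  define y where "y = transfer_function (X (Suc n)) (U n) z x"
  have h: "h \<in> X (Suc n)"
    unfolding h_def using S.R_mem[OF z bounded_opD(1)[OF S.B_op x]] .
  have loop: "U n (x, z *\<^sub>C h) = (y, h)" unfolding h_def y_def by (rule S.transfer_loop[OF z x])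
  define g where "g = W (Suc n) h"
  have g: "g \<in> Y (Suc n)" unfolding g_def using bounded_opD(1)[OF unitary_opD(1)[OF unitary_W] h] .
  have Wzh: "W (Suc n) (z *\<^sub>C h) = z *\<^sub>C g"
    unfolding g_def by (rule bounded_opD(3)[OF unitary_opD(1)[OF unitary_W] h])
  obtain c h' where ch: "shift_out g = (c, h')" by (cases "shift_out g")
  have c: "c \<in> par_cod \<Gamma> (Suc n)" and h': "h' \<in> X (Suc (Suc n))"
    using bounded_opD(1)[OF unitary_opD(1)[OF unitary_out] g] by (auto simp: ch)
  have c_eq: "c = fst (ell2_nth g 0)" using fst_shift_out[of g] by (simp add: ch)
  have h'_nth: "ell2_nth h' k = (snd (ell2_nth g k), fst (ell2_nth g (Suc k)))" for k
    using ell2_nth_shift_out[of g k] by (simp add: ch)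
  have zh': "z *\<^sub>C h' \<in> X (Suc (Suc n))" using closed_csubspaceD(6)[OF closed_X h'] .
  define p where "p = shift_in (x, z *\<^sub>C g)"
  have p: "p \<in> X n"
    unfolding p_def using bounded_opD(1)[OF unitary_opD(1)[OF unitary_in]] x closed_csubspaceD(6)[OF closed_Y g]
    by blast
  have p0: "ell2_nth p 0 = (x, z *\<^sub>C c)"
    by (simp add: p_def ell2_nth_shift_in scaleC_ell2.rep_eq c_eq scaleC_prod_def)
  have pS: "ell2_nth p (Suc k) = ell2_nth (z *\<^sub>C h') k" for k
    by (simp add: p_def ell2_nth_shift_in scaleC_ell2.rep_eq h'_nth scaleC_prod_def)
  define q where "q = W n p"
  have out: "shift_out q = (y, h)"
    using loop by (simp add: U_def L_def Wzh p_def q_def)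
  define a where "a = snd (ell2_nth q 0)"
  have q0: "ell2_nth q 0 = rotation \<Gamma> n (x, z *\<^sub>C c)"
    unfolding q_def using ell2_nth_W[OF p, of 0] by (simp add: p0)
  have qS: "ell2_nth q (Suc k) = ell2_nth (W (Suc (Suc n)) (z *\<^sub>C h')) k" for k
    unfolding q_def using ell2_nth_W[OF p, of "Suc k"] ell2_nth_W[OF zh', of k] by (simp add: pS)
  have y_eq: "y = fst (ell2_nth q 0)" using fst_shift_out[of q] by (simp add: out)
  have h_nth: "ell2_nth h k = (snd (ell2_nth q k), fst (ell2_nth q (Suc k)))" for k
    using ell2_nth_shift_out[of q k] by (simp add: out)
  have a: "a \<in> par_dom \<Gamma> (Suc n)"
    using ell2_sumD[OF h[unfolded X_def], of 0] h_nth[of 0] by (simp add: a_def)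
  have h_eq: "h = shift_in (a, W (Suc (Suc n)) (z *\<^sub>C h'))"
    by (rule ell2_eqI) (simp add: h_nth ell2_nth_shift_in a_def qS split: nat.split)
  have "U (Suc n) (a, z *\<^sub>C h') = (c, h')"
    by (simp add: U_def L_def h_eq[symmetric] g_def[symmetric] ch)
  from S.transfer_unique(1)[OF z a h' this]
  have "transfer_function (X (Suc (Suc n))) (U (Suc n)) z a = c" .
  moreover have "rotation \<Gamma> n (x, z *\<^sub>C c) = (y, a)"
    using q0 y_eq by (simp add: a_def)
  ultimately show thesis using that[OF a c] by (simp add: y_def)
qed

lemma schur_step_transfer:
  "schur_step (par_dom \<Gamma> n) (par_cod \<Gamma> n) (\<Gamma> n) (transfer_function (X (Suc n)) (U n))
     (transfer_function (X (Suc (Suc n))) (U (Suc n)))"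
    (is "schur_step _ _ _ ?\<Theta> ?\<Psi>")
proof -
  interpret G: contraction_between "par_dom \<Gamma> n" "par_cod \<Gamma> n" "\<Gamma> n"
    by (rule contraction_between_\<Gamma>)
  have cls: "?\<Psi> \<in> schur_class G.DD G.DDs"
    using S.transfer_schur_class[of "Suc n"] by (simp add: par_dom.simps par_cod.simps)
  have "?\<Theta> z x = \<Gamma> n x + z *\<^sub>C G.Ds (?\<Psi> z (the_inv_into G.DD (\<lambda>u. u + z *\<^sub>C G.Ts (?\<Psi> z u)) (G.D x)))"
    if z: "cmod z < 1" and x: "x \<in> par_dom \<Gamma> n" for z x
  proof -
    obtain a c where ac: "a \<in> par_dom \<Gamma> (Suc n)" "c \<in> par_cod \<Gamma> (Suc n)"
      and rot: "rotation \<Gamma> n (x, z *\<^sub>C c) = (?\<Theta> z x, a)" and c: "?\<Psi> z a = c"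
      by (rule transfer_peel[OF z x])
    have cL: "c \<in> par_cod \<Gamma> n" using ac(2) G.DDs_sub by (auto simp: par_cod.simps)
    have \<Theta>: "?\<Theta> z x = \<Gamma> n x + z *\<^sub>C G.Ds c" and a: "a = G.D x - z *\<^sub>C G.Ts c"
      using rot by (simp_all add: rotation_apply bounded_opD(3)[OF G.Ds_op cL] bounded_opD(3)[OF G.Ts_op cL])
    have inv: "the_inv_into G.DD (\<lambda>u. u + z *\<^sub>C G.Ts (?\<Psi> z u)) (G.D x) = a"
      by (rule G.step_inverse_eq[OF cls z]) (use ac(1) a c in \<open>simp_all add: par_dom.simps\<close>)
    show ?thesis by (simp only: \<Theta> inv c)
  qed
  thus ?thesis using cls by (simp add: schur_step_def)
qed

lemma transfer_at_0:
  assumes "x \<in> par_dom \<Gamma> n"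
  shows "transfer_function (X (Suc n)) (U n) 0 x = \<Gamma> n x"
proof -
  interpret G: contraction_between "par_dom \<Gamma> n" "par_cod \<Gamma> n" "\<Gamma> n"
    by (rule contraction_between_\<Gamma>)
  obtain a c where "rotation \<Gamma> n (x, 0 *\<^sub>C c) = (transfer_function (X (Suc n)) (U n) 0 x, a)"
    by (rule transfer_peel[of 0, OF _ assms]) auto
  thus ?thesis using bounded_op_zero[OF G.Ds_op G.L] by (simp add: rotation_apply)
qed

lemma schur_parameters_transfer: "schur_parameters (transfer_function (X 1) (U 0)) \<Gamma>"
  unfolding schur_parameters_def
proof (intro conjI exI[of _ "\<lambda>n. transfer_function (X (Suc n)) (U n)"] allI ballI impI)
  show "transfer_function (X 1) (U 0) \<in> schur_class UNIV UNIV"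
    using S.transfer_schur_class[of 0] by (simp add: par_dom.simps par_cod.simps)
  show "\<Gamma> n x = transfer_function (X (Suc n)) (U n) 0 x" if "x \<in> par_dom \<Gamma> n" for n x
    using transfer_at_0[OF that] by simp
  show "schur_step (par_dom \<Gamma> n) (par_cod \<Gamma> n) (\<Gamma> n) (transfer_function (X (Suc n)) (U n))
     (transfer_function (X (Suc (Suc n))) (U (Suc n)))" for n
    by (rule schur_step_transfer)
  show "\<Psi> z x = transfer_function (X (Suc (Suc n))) (U (Suc n)) z x"
    if "schur_step (par_dom \<Gamma> n) (par_cod \<Gamma> n) (\<Gamma> n) (transfer_function (X (Suc n)) (U n)) \<Psi>"
      "z \<in> ball 0 1" "x \<in> par_dom \<Gamma> (Suc n)" for n \<Psi> z x
    using contraction_between.schur_step_unique[OF contraction_between_\<Gamma> that(1) schur_step_transfer that(2)] that(3)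
    by (simp add: par_dom.simps)
qed simp

lemma rotation_0_eq_0_imp:
  assumes "b \<in> par_cod \<Gamma> (Suc n)" "fst (rotation \<Gamma> n (0, b)) = 0"
  shows "b = 0"
proof -
  interpret G: contraction_between "par_dom \<Gamma> n" "par_cod \<Gamma> n" "\<Gamma> n"
    by (rule contraction_between_\<Gamma>)
  show ?thesis
    by (rule G.Ds_eq_0_imp)
      (use assms bounded_op_zero[OF G.T_op G.K] in \<open>simp_all add: rotation_apply par_cod.simps\<close>)
qed

lemma rotation_0: "rotation \<Gamma> n 0 = 0"
  by (rule bounded_op_zero[OF unitary_opD(1)[OF unitary_rotation]
        closed_csubspace_Times[OF closed_dom closed_cod]])

text \<open>By induction on j, the j-th pair of every h in P vanishes. Put \<open>g = W 1 h\<close>. The rotation with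
  index \<open>2 j\<close> receives \<open>(0, b)\<close>, where b is the first half of the j-th pair of g, and the first
  component \<open>D\<^sub>* b\<close> of its output is 0: it is the output of the system if \<open>j = 0\<close>, and otherwise a half
  of an earlier pair of the image of h. So \<open>b = 0\<close>. The same applies to the preimage of h, and there
  the second component of that output is the first half of the j-th pair of h, which is therefore 0.
  Now the rotation with index \<open>2 j + 1\<close> maps the j-th pair \<open>(0, b')\<close> of h to a pair with first half
  \<open>b = 0\<close>, and \<open>b' = 0\<close> follows as before.\<close>

lemma cmv_no_unitary_part:
  assumes P: "P \<subseteq> X 1" and fwd: "\<And>h. h \<in> P \<Longrightarrow> \<exists>h'\<in>P. U 0 (0, h) = (0, h')"
    and bwd: "\<And>h. h \<in> P \<Longrightarrow> \<exists>h'\<in>P. U 0 (0, h') = (0, h)"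
  shows "P \<subseteq> {0}"
proof -
  have "\<forall>h\<in>P. \<forall>i<j. ell2_nth h i = 0" for j
  proof (induction j)
    case (Suc j)
    define p where "p h = shift_in (0, W 1 h)" for h
    have pX: "p h \<in> X 0" if "h \<in> P" for h
      unfolding p_def using bounded_opD(1)[OF unitary_opD(1)[OF unitary_in[of 0]]]
        bounded_opD(1)[OF unitary_opD(1)[OF unitary_W[of 1]]] P that
      by (auto simp: par_dom.simps)
    have W1: "ell2_nth (W 1 h) i = rotation \<Gamma> (Suc (2*i)) (ell2_nth h i)" if "h \<in> P" for h i
      using ell2_nth_W[of h 1 i] P that by auto
    have image: "ell2_nth h' i = (snd (rotation \<Gamma> (2*i) (ell2_nth (p h) i)),
          fst (rotation \<Gamma> (2 * Suc i) (ell2_nth (p h) (Suc i))))"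
      and out: "fst (rotation \<Gamma> 0 (ell2_nth (p h) 0)) = 0"
      if h: "h \<in> P" and U: "U 0 (0, h) = (0, h')" for h h' i
    proof -
      have so: "shift_out (W 0 (p h)) = (0, h')" using U by (simp add: U_def L_def p_def)
      show "ell2_nth h' i = (snd (rotation \<Gamma> (2*i) (ell2_nth (p h) i)),
          fst (rotation \<Gamma> (2 * Suc i) (ell2_nth (p h) (Suc i))))"
        using ell2_nth_shift_out[of "W 0 (p h)" i] ell2_nth_W[OF pX[OF h]] by (simp add: so)
      show "fst (rotation \<Gamma> 0 (ell2_nth (p h) 0)) = 0"
        using fst_shift_out[of "W 0 (p h)"] ell2_nth_W[OF pX[OF h], of 0] by (simp add: so)
    qed
    have pj: "ell2_nth (p h) j = (0, fst (ell2_nth (W 1 h) j))" if h: "h \<in> P" for h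
    proof (cases j)
      case (Suc i)
      hence "ell2_nth h i = 0" using Suc.IH h by simp
      thus ?thesis using Suc W1[OF h, of i] rotation_0 by (simp add: p_def ell2_nth_shift_in)
    qed (simp add: p_def ell2_nth_shift_in)
    have p0: "ell2_nth (p h) j = 0" if h: "h \<in> P" for h
    proof -
      obtain h' where h': "h' \<in> P" "U 0 (0, h) = (0, h')" using fwd[OF h] by blast
      have "fst (rotation \<Gamma> (2*j) (ell2_nth (p h) j)) = 0"
      proof (cases j)
        case 0
        thus ?thesis using out[OF h h'(2)] by simp
      next
        case (Suc i)
        have "ell2_nth h' i = 0" using Suc.IH h'(1) Suc by simp
        thus ?thesis using image[OF h h'(2), of i] Suc by (simp add: zero_prod_def)
      qed
      moreover have "fst (ell2_nth (W 1 h) j) \<in> par_cod \<Gamma> (Suc (2*j))"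
        using ell2_sumD[OF pX[OF h, unfolded X_def], of j] pj[OF h] by simp
      ultimately have "fst (ell2_nth (W 1 h) j) = 0"
        using rotation_0_eq_0_imp[of _ "2*j"] pj[OF h] by simp
      thus ?thesis using pj[OF h] by (simp add: zero_prod_def)
    qed
    have "ell2_nth h j = 0" if h: "h \<in> P" for h
    proof -
      obtain h' where h': "h' \<in> P" "U 0 (0, h') = (0, h)" using bwd[OF h] by blast
      have "fst (ell2_nth h j) = 0"
        using image[OF h'(1,2), of j] p0[OF h'(1)] rotation_0 by (simp add: zero_prod_def)
      hence hj: "ell2_nth h j = (0, snd (ell2_nth h j))" by (simp add: prod_eq_iff)
      have "fst (ell2_nth (W 1 h) j) = 0" using pj[OF h] p0[OF h] by (simp add: zero_prod_def)
      hence "fst (rotation \<Gamma> (Suc (2*j)) (0, snd (ell2_nth h j))) = 0" using W1[OF h, of j] hj by simp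
      moreover have "snd (ell2_nth h j) \<in> par_cod \<Gamma> (Suc (Suc (2*j)))"
        using ell2_sumD[OF subsetD[OF P h, unfolded X_def], of j] by (simp add: mem_Times_iff)
      ultimately have "snd (ell2_nth h j) = 0" by (rule rotation_0_eq_0_imp[rotated])
      thus ?thesis using hj by (simp add: zero_prod_def)
    qed
    thus ?case using Suc.IH by (auto simp: less_Suc_eq)
  qed simp
  hence "h = 0" if "h \<in> P" for h
    using that by (intro ell2_eqI) (auto simp: zero_ell2.rep_eq)
  thus ?thesis by blast
qed

end

text \<open>Schur parameters are determined by the values on the disc, and it is only there that the transfer
  functions of the two systems are known to agree.\<close>

lemma schur_parameters_cong:
  assumes eq: "\<And>z. z \<in> ball 0 1 \<Longrightarrow> \<Theta> z = \<Theta>' z" and \<Theta>: "schur_parameters \<Theta> \<Gamma>"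
  shows "schur_parameters \<Theta>' \<Gamma>"
proof -
  have cls: "\<Theta>' \<in> schur_class UNIV UNIV"
  proof -
    have "\<Theta> \<in> schur_class UNIV UNIV" using \<Theta> by (simp add: schur_parameters_def)
    thus ?thesis using eq by (simp add: schur_class_def op_holomorphic_disc_def)
  qed
  obtain \<Phi> where \<Phi>: "\<Phi> 0 = \<Theta>"
    "\<forall>n. (\<forall>x\<in>par_dom \<Gamma> n. \<Gamma> n x = \<Phi> n 0 x) \<and>
       schur_step (par_dom \<Gamma> n) (par_cod \<Gamma> n) (\<Gamma> n) (\<Phi> n) (\<Phi> (Suc n)) \<and>
       (\<forall>\<Psi>. schur_step (par_dom \<Gamma> n) (par_cod \<Gamma> n) (\<Gamma> n) (\<Phi> n) \<Psi> \<longrightarrow>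
         (\<forall>z\<in>ball 0 1. \<forall>x\<in>par_dom \<Gamma> (Suc n). \<Psi> z x = \<Phi> (Suc n) z x))"
    using \<Theta> unfolding schur_parameters_def by blast
  define \<Phi>' where "\<Phi>' = \<Phi>(0 := \<Theta>')"
  have \<Phi>'_eq: "\<Phi>' n z = \<Phi> n z" if "z \<in> ball 0 1" for n z
    using that eq \<Phi>(1) by (simp add: \<Phi>'_def)
  have step: "schur_step K L G (\<Phi>' n) \<Psi> \<longleftrightarrow> schur_step K L G (\<Phi> n) \<Psi>" for K L G \<Psi> n
    using \<Phi>'_eq by (simp add: schur_step_def)
  have Suc: "\<Phi>' (Suc n) = \<Phi> (Suc n)" for n by (simp add: \<Phi>'_def)
  show ?thesis
    unfolding schur_parameters_def
    by (intro conjI cls exI[of _ \<Phi>'], simp add: \<Phi>'_def)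
      (use \<Phi>(2) in \<open>simp only: step Suc, simp add: \<Phi>'_eq\<close>)
qed

theorem theorem5p2:
  fixes \<Gamma> :: "nat \<Rightarrow> 'm::chilbert_space \<Rightarrow> 'n::chilbert_space"
  assumes "separable_space (euclidean :: 'm topology)"
    and "separable_space (euclidean :: 'n topology)"
    and "choice_sequence \<Gamma>"
    and "\<And>n. \<not> isometric (par_dom \<Gamma> n) (\<Gamma> n)"
    and "\<And>n. \<not> coisometric (par_dom \<Gamma> n) (par_cod \<Gamma> n) (\<Gamma> n)"
  shows "conservative (cmv_H \<Gamma>) (cmv_U \<Gamma>) \<and>
    conservative (cmv_Ht \<Gamma>) (cmv_Ut \<Gamma>) \<and>
    unitarily_equivalent (cmv_H \<Gamma>) (cmv_U \<Gamma>) (cmv_Ht \<Gamma>) (cmv_Ut \<Gamma>) \<and>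
    simple_system (cmv_H \<Gamma>) (cmv_U \<Gamma>) \<and>
    simple_system (cmv_Ht \<Gamma>) (cmv_Ut \<Gamma>) \<and>
    (\<forall>z\<in>ball 0 1. transfer_function (cmv_H \<Gamma>) (cmv_U \<Gamma>) z =
      transfer_function (cmv_Ht \<Gamma>) (cmv_Ut \<Gamma>) z) \<and>
    schur_parameters (transfer_function (cmv_H \<Gamma>) (cmv_U \<Gamma>)) \<Gamma> \<and>
    schur_parameters (transfer_function (cmv_Ht \<Gamma>) (cmv_Ut \<Gamma>)) \<Gamma>"
proof -
  interpret cmv \<Gamma> using assms(3) by unfold_locales
  have "simple_system (X 1) (U 0)"
    by (rule simple_systemI[OF conservative_cmv_U cmv_no_unitary_part])
  moreover have "simple_system (Y 1) (map_prod id (W 1) \<circ> L 0)"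
    by (rule simple_systemI[OF conservative_cmv_Ut E.no_unitary_part_transport[OF cmv_no_unitary_part]])
  ultimately show ?thesis
    unfolding cmv_H_eq cmv_Ht_eq cmv_U_eq cmv_Ut_eq
    using conservative_cmv_U conservative_cmv_Ut E.unitarily_equivalent E.transfer_function_eq
      schur_parameters_transfer schur_parameters_cong[OF E.transfer_function_eq schur_parameters_transfer]
    by blast
qed

end
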